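(* Let $f:\mathbb{R}\to\mathbb{R}$ be a bounded and continuous function and let $u:[0,T]\times\mathbb{R}\to\mathbb{R}$ be the unique solution of $$\partial_t u(t,x)=\tfrac12\partial_{xx}u(t,x),\quad x\in\mathbb{R},\ t\in\,]0,T],\qquad u(0,x)=f(x),\quad x\in\mathbb{R},$$ among the class of functions satisfying the bound $|u(t,x)|\le A e^{a x^2}$ for all $x\in\mathbb{R}$, $t\in[0,T]$, for some $a,A>0$. Then for every $t\in[0,T]$, $$u(t,B_t)=f^{\circ}(B_t)\quad\text{almost surely},$$ where $f^{\circ}(B_t)=\Gamma\big(\tfrac{1}{\sqrt2}\big)f(\Gamma(\sqrt2)B_t)$.
   Context: Let $T>0$ and let $(\Omega,\mathcal{F},\mathcal{P})$ be a complete probability space carrying a one-dimensional Brownian motion $\{B_t\}_{0\le t\le T}$, with $\mathcal{F}=\mathcal{F}_T$, where $\{\mathcal{F}_t\}_{0\le t\le T}$ is the augmented Brownian filtration. Every $X\in\mathcal{L}^2(\Omega)$ has a unique Wiener–Itô chaos decomposition $X=\sum_{n\ge0}I_n(h_n)$ with $h_n\in\mathcal{L}^2([0,T]^n)$ symmetric, $I_n$ the $n$-th order multiple Itô integral, $I_0(h_0)=E[X]$, and $E[|X|^2]=\sum_{n\ge0}n!|h_n|^2_{\mathcal{L}^2([0,T]^n)}$. For $\lambda>0$, the second quantization operator $\Gamma(\lambda)$ is $\Gamma(\lambda)\sum_{n\ge0}I_n(h_n)=\sum_{n\ge0}\lambda^n I_n(h_n)$, defined on those $X\in\mathcal{L}^2(\Omega)$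 for which the right-hand side converges in $\mathcal{L}^2(\Omega)$, that is, $\sum_n n!\lambda^{2n}|h_n|^2<\infty$. For $\lambda\le1$ it is a contraction on all of $\mathcal{L}^2(\Omega)$ and extends uniquely by continuity to a contraction on $\mathcal{L}^1(\Omega)$, still denoted $\Gamma(\lambda)$. Let $\mathcal{G}_{\sqrt2}$ be the set of $X\in\mathcal{L}^2(\Omega)$ with $\sum_n n!2^{n}|h_n|^2<\infty$. For $X\in\mathcal{G}_{\sqrt2}$ and $f:\mathbb{R}\to\mathbb{R}$ such that $f(\Gamma(\sqrt2)X)\in\mathcal{L}^1(\Omega)$, define $f^{\circ}(X):=\Gamma\big(\tfrac1{\sqrt2}\big)f(\Gamma(\sqrt2)X)\in\mathcal{L}^1(\Omega)$. "Solution" means classical solution: $u$ continuous on $[0,T]\times\mathbb{R}$, once continuously differentiable in $t$ and twice in $x$ on $]0,T]\times\mathbb{R}$. *)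

theory Defs
  imports "HOL-Probability.Probability"
begin

section \<open>Lebesgue spaces\<close>

definition Lp :: "'b measure \<Rightarrow> nat \<Rightarrow> ('b \<Rightarrow> real) set" where
  "Lp N p = {X \<in> borel_measurable N. integrable N (\<lambda>x. \<bar>X x\<bar> ^ p)}"

definition tendsto_Lp :: "'b measure \<Rightarrow> nat \<Rightarrow> (nat \<Rightarrow> 'b \<Rightarrow> real) \<Rightarrow> ('b \<Rightarrow> real) \<Rightarrow> bool" where
  "tendsto_Lp N p Xs X \<longleftrightarrow>
     (\<forall>k. Xs k \<in> Lp N p) \<and> X \<in> Lp N p \<and>
     (\<lambda>k. \<integral>x. \<bar>Xs k x - X x\<bar> ^ p \<partial>N) \<longlonglongrightarrow> 0"

section \<open>Brownian motion on a finite time interval\<close>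

definition brownian_motion :: "'a measure \<Rightarrow> real \<Rightarrow> (real \<Rightarrow> 'a \<Rightarrow> real) \<Rightarrow> bool" where
  "brownian_motion M T B \<longleftrightarrow>
     (\<forall>t\<in>{0..T}. B t \<in> borel_measurable M) \<and>
     (AE \<omega> in M. B 0 \<omega> = 0) \<and>
     (AE \<omega> in M. continuous_on {0..T} (\<lambda>t. B t \<omega>)) \<and>
     (\<forall>s t. 0 \<le> s \<and> s < t \<and> t \<le> T \<longrightarrow>
        distributed M lborel (\<lambda>\<omega>. B t \<omega> - B s \<omega>) (normal_density 0 (sqrt (t - s)))) \<and>
     (\<forall>n \<tau>. 0 \<le> \<tau> 0 \<and> strict_mono_on {..n} \<tau> \<and> \<tau> n \<le> T \<longrightarrow>
        prob_space.indep_vars M (\<lambda>_. borel) (\<lambda>i \<omega>. B (\<tau> (Suc i)) \<omega> - B (\<tau> i) \<omega>) {..<n})"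

definition augmented_filtration :: "'a measure \<Rightarrow> (real \<Rightarrow> 'a \<Rightarrow> real) \<Rightarrow> real \<Rightarrow> 'a measure" where
  "augmented_filtration M B t =
     sigma (space M) ({B s -` A \<inter> space M | s A. s \<in> {0..t} \<and> A \<in> sets borel} \<union> null_sets M)"

section \<open>Multiple Ito integrals\<close>

text \<open>A point of \<open>[0,T]\<^sup>n\<close> is a function on \<open>{..<n}\<close>.\<close>

definition cube :: "real \<Rightarrow> nat \<Rightarrow> (nat \<Rightarrow> real) measure" where
  "cube T n = (\<Pi>\<^sub>M j\<in>{..<n}. restrict_space lborel {0..T})"

text \<open>
  Elementary kernels on a grid \<open>\<tau> 0 < \<dots> < \<tau> m\<close> in \<open>[0,T]\<close>: the multi-index
  \<open>i\<close> selects the box with sides \<open>]\<tau> (i j), \<tau> (i j + 1)]\<close>, \<open>j < n\<close>.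
  The coefficients vanish on all boxes meeting a diagonal, that is, whenever \<open>i\<close> has a
  repeated entry.
\<close>

definition off_diagonal_grid ::
  "real \<Rightarrow> nat \<Rightarrow> nat \<Rightarrow> (nat \<Rightarrow> real) \<Rightarrow> ((nat \<Rightarrow> nat) \<Rightarrow> real) \<Rightarrow> bool" where
  "off_diagonal_grid T n m \<tau> c \<longleftrightarrow>
     0 \<le> \<tau> 0 \<and> strict_mono_on {..m} \<tau> \<and> \<tau> m \<le> T \<and>
     (\<forall>i \<in> {..<n} \<rightarrow>\<^sub>E {..<m}. \<not> inj_on i {..<n} \<longrightarrow> c i = 0)"

definition elem_kernel ::
  "nat \<Rightarrow> nat \<Rightarrow> (nat \<Rightarrow> real) \<Rightarrow> ((nat \<Rightarrow> nat) \<Rightarrow> real) \<Rightarrow> (nat \<Rightarrow> real) \<Rightarrow> real" where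
  "elem_kernel n m \<tau> c s =
     (\<Sum>i \<in> {..<n} \<rightarrow>\<^sub>E {..<m}. c i * (\<Prod>j<n. indicator {\<tau> (i j)<..\<tau> (Suc (i j))} (s j)))"

definition elem_ito ::
  "(real \<Rightarrow> 'a \<Rightarrow> real) \<Rightarrow> nat \<Rightarrow> nat \<Rightarrow> (nat \<Rightarrow> real) \<Rightarrow> ((nat \<Rightarrow> nat) \<Rightarrow> real) \<Rightarrow> 'a \<Rightarrow> real" where
  "elem_ito B n m \<tau> c \<omega> =
     (\<Sum>i \<in> {..<n} \<rightarrow>\<^sub>E {..<m}. c i * (\<Prod>j<n. B (\<tau> (Suc (i j))) \<omega> - B (\<tau> (i j)) \<omega>))"

text \<open>
  The multiple integral is the \<open>L\<^sup>2\<close>-continuous extension from elementary kernels. With this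
  normalisation \<open>E[I\<^sub>n(h)\<^sup>2] = n! |h|\<^sup>2\<close> for symmetric \<open>h\<close>, and \<open>I\<^sub>0\<close>
  is the identity on constants. Integrals, and likewise the operators below, are random variables
  determined up to almost sure equality; \<open>SOME\<close> selects a version.
\<close>

definition has_multiple_ito ::
  "'a measure \<Rightarrow> real \<Rightarrow> (real \<Rightarrow> 'a \<Rightarrow> real) \<Rightarrow> nat \<Rightarrow> ((nat \<Rightarrow> real) \<Rightarrow> real) \<Rightarrow> ('a \<Rightarrow> real) \<Rightarrow> bool"
  where
  "has_multiple_ito M T B n h Y \<longleftrightarrow>
     (\<exists>m \<tau> c. (\<forall>k. off_diagonal_grid T n (m k) (\<tau> k) (c k)) \<and>
        tendsto_Lp (cube T n) 2 (\<lambda>k. elem_kernel n (m k) (\<tau> k) (c k)) h \<and>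
        tendsto_Lp M 2 (\<lambda>k. elem_ito B n (m k) (\<tau> k) (c k)) Y)"

definition multiple_ito ::
  "'a measure \<Rightarrow> real \<Rightarrow> (real \<Rightarrow> 'a \<Rightarrow> real) \<Rightarrow> nat \<Rightarrow> ((nat \<Rightarrow> real) \<Rightarrow> real) \<Rightarrow> 'a \<Rightarrow> real" where
  "multiple_ito M T B n h = (SOME Y. has_multiple_ito M T B n h Y)"

section \<open>Chaos decomposition and second quantization\<close>

definition symmetric_L2 :: "real \<Rightarrow> nat \<Rightarrow> ((nat \<Rightarrow> real) \<Rightarrow> real) set" where
  "symmetric_L2 T n = {h \<in> Lp (cube T n) 2.
     \<forall>\<pi>. \<pi> permutes {..<n} \<longrightarrow> (AE s in cube T n. h (\<lambda>j. s (\<pi> j)) = h s)}"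

definition has_chaos ::
  "'a measure \<Rightarrow> real \<Rightarrow> (real \<Rightarrow> 'a \<Rightarrow> real) \<Rightarrow> ('a \<Rightarrow> real) \<Rightarrow> (nat \<Rightarrow> (nat \<Rightarrow> real) \<Rightarrow> real) \<Rightarrow> bool"
  where
  "has_chaos M T B X h \<longleftrightarrow>
     (\<forall>n. h n \<in> symmetric_L2 T n) \<and>
     tendsto_Lp M 2 (\<lambda>N \<omega>. \<Sum>n<N. multiple_ito M T B n (h n) \<omega>) X"

text \<open>
  The domain of the second quantization operator \<open>\<Gamma>(l)\<close> in \<open>L\<^sup>2\<close>; for \<open>l = \<surd>2\<close> the weight \<open>l\<^bsup>2n\<^esup>\<close> is
  \<open>2\<^sup>n\<close> and this is the space \<open>\<G>\<^bsub>\<surd>2\<^esub>\<close>. The kernels \<open>h\<close> are almost everywhere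
  unique, so the quantifier over them is immaterial.
\<close>

definition second_quant_dom :: "'a measure \<Rightarrow> real \<Rightarrow> (real \<Rightarrow> 'a \<Rightarrow> real) \<Rightarrow> real \<Rightarrow> ('a \<Rightarrow> real) set" where
  "second_quant_dom M T B l = {X. \<exists>h. has_chaos M T B X h \<and>
     summable (\<lambda>n. fact n * l ^ (2 * n) * (\<integral>s. \<bar>h n s\<bar> ^ 2 \<partial>cube T n))}"

definition second_quant :: "'a measure \<Rightarrow> real \<Rightarrow> (real \<Rightarrow> 'a \<Rightarrow> real) \<Rightarrow> real \<Rightarrow> ('a \<Rightarrow> real) \<Rightarrow> 'a \<Rightarrow> real" where
  "second_quant M T B l X = (SOME Y. \<exists>h. has_chaos M T B X h \<and>
     tendsto_Lp M 2 (\<lambda>N \<omega>. \<Sum>n<N. l ^ n * multiple_ito M T B n (h n) \<omega>) Y)"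

text \<open>
  The continuous extension of \<open>\<Gamma>(l)\<close> to \<open>L\<^sup>1\<close>, meaningful for \<open>0 < l \<le> 1\<close>, in which case
  \<open>second_quant_dom M T B l\<close> is all of \<open>L\<^sup>2\<close>.
\<close>

definition second_quant_L1 :: "'a measure \<Rightarrow> real \<Rightarrow> (real \<Rightarrow> 'a \<Rightarrow> real) \<Rightarrow> real \<Rightarrow> ('a \<Rightarrow> real) \<Rightarrow> 'a \<Rightarrow> real" where
  "second_quant_L1 M T B l Y = (SOME Z. \<exists>Ys. (\<forall>k. Ys k \<in> second_quant_dom M T B l) \<and>
     tendsto_Lp M 1 Ys Y \<and> tendsto_Lp M 1 (\<lambda>k. second_quant M T B l (Ys k)) Z)"

definition wick_fun ::
  "'a measure \<Rightarrow> real \<Rightarrow> (real \<Rightarrow> 'a \<Rightarrow> real) \<Rightarrow> (real \<Rightarrow> real) \<Rightarrow> ('a \<Rightarrow> real) \<Rightarrow> 'a \<Rightarrow> real" where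
  "wick_fun M T B f X =
     second_quant_L1 M T B (1 / sqrt 2) (\<lambda>\<omega>. f (second_quant M T B (sqrt 2) X \<omega>))"

section \<open>The heat equation\<close>

text \<open>
  At \<open>t = T\<close> the time derivative is one-sided.
\<close>

definition heat_solution :: "real \<Rightarrow> (real \<Rightarrow> real) \<Rightarrow> (real \<Rightarrow> real \<Rightarrow> real) \<Rightarrow> bool" where
  "heat_solution T f u \<longleftrightarrow>
     continuous_on ({0..T} \<times> UNIV) (\<lambda>(t, x). u t x) \<and>
     (\<exists>ut ux uxx.
        continuous_on ({0<..T} \<times> UNIV) (\<lambda>(t, x). ut t x) \<and>
        continuous_on ({0<..T} \<times> UNIV) (\<lambda>(t, x). ux t x) \<and>
        continuous_on ({0<..T} \<times> UNIV) (\<lambda>(t, x). uxx t x) \<and>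
        (\<forall>t\<in>{0<..T}. \<forall>x.
           ((\<lambda>s. u s x) has_real_derivative ut t x) (at t within {0<..T}) \<and>
           (u t has_real_derivative ux t x) (at x) \<and>
           (ux t has_real_derivative uxx t x) (at x) \<and>
           ut t x = 1 / 2 * uxx t x)) \<and>
     (\<forall>x. u 0 x = f x)"

definition gaussian_growth :: "real \<Rightarrow> (real \<Rightarrow> real \<Rightarrow> real) \<Rightarrow> bool" where
  "gaussian_growth T u \<longleftrightarrow>
     (\<exists>a>0. \<exists>A>0. \<forall>t\<in>{0..T}. \<forall>x. \<bar>u t x\<bar> \<le> A * exp (a * x\<^sup>2))"

end

theory Submission
  imports Defs
begin

text \<open>
  An integrable random variable is determined by its expectations against \<open>cos (I + \<eta>)\<close>, where
  \<open>I\<close> runs through the finite linear combinations of the \<open>B\<^sub>s\<close>. On an \<open>n\<close>-th order integral this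
  transform is \<open>\<langle>h, \<phi>\<^sup>\<otimes>\<^sup>n\<rangle> exp (- |\<phi>|\<^sup>2 / 2) cos (\<eta> + n \<pi> / 2)\<close>, with \<open>\<phi>\<close> the step function
  representing \<open>I\<close>. Hence \<open>\<Gamma>(\<lambda>)\<close> merely rescales the transform by \<open>\<phi> \<mapsto> \<lambda> \<phi>\<close> and the Gaussian factor,
  which makes every choice in the definition of \<open>f\<^sup>\<circ>(B\<^sub>t)\<close> irrelevant, in \<open>L\<^sup>1\<close> too, without
  contractivity or orthogonality of the chaoses.

  It remains to exhibit one admissible approximating sequence. For a trigonometric sum \<open>p\<close> the
  variable \<open>\<Gamma>(1 / \<surd>2) p(\<surd>2 B\<^sub>t)\<close> is \<open>v(t, B\<^sub>t)\<close>, where \<open>v\<close> is the bounded solution of the heat equation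
  with initial value \<open>p\<close>. Choose \<open>p\<close> with \<open>|f(x) - p(x)| \<le> e + d x\<^sup>2\<close>, where \<open>e\<close> and \<open>d\<close> are small. Then the
  maximum principle for functions of Gaussian growth gives \<open>|u - v| \<le> e + d (x\<^sup>2 + t)\<close>, so
  \<open>v(t, B\<^sub>t)\<close> tends to \<open>u(t, B\<^sub>t)\<close> in \<open>L\<^sup>1\<close>.
\<close>

section \<open>Square-integrable functions\<close>

text \<open>Every \<open>SOME\<close> calls for a witness and for agreement of all witnesses.
  Agreement comes from the transform; witnesses come from the density of off-diagonal kernels and
  the completeness of L2, by way of the bound E[I_n(h)^2] <= n! |h|^2.

  The constants fit by Mehler's formula: \<Gamma>(l) sends cos(w B_t + p) to exp(-(1 - l^2) w^2 t /
  2) cos(l w B_t + p). At frequency sqrt 2 w and l = 1 / sqrt 2 the exponent is -w^2 t / 2, the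
  decay of frequency w under the heat equation.

  The quadratic error term answers an obstacle: a bounded continuous function is in general no
  uniform limit of trigonometric sums on the line, so a weight has to absorb what happens far out.
  The weight x^2 has the explicit heat evolution x^2 + t, and E[B_t^2] = t, so one kind of bound
  controls both the approximation of f(sqrt 2 B_t) and that of u(t, B_t).

  Real cosines with a free phase stand in for complex exponentials; a sine is a cosine with shifted
  phase, and products of cosines split into sums.\<close>

lemma Lp2_iff: "X \<in> Lp N 2 \<longleftrightarrow> X \<in> borel_measurable N \<and> integrable N (\<lambda>x. (X x)\<^sup>2)"
  by (simp add: Lp_def)

lemma Lp1_iff: "X \<in> Lp N 1 \<longleftrightarrow> integrable N X"
  by (auto simp: Lp_def integrable_abs_iff)

lemma integrable_mult_Lp2:
  assumes "X \<in> Lp N 2" "Y \<in> Lp N 2"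
  shows "integrable N (\<lambda>x. X x * Y x)"
proof (rule Bochner_Integration.integrable_bound)
  show "integrable N (\<lambda>x. (X x)\<^sup>2 + (Y x)\<^sup>2)" using assms by (auto simp: Lp2_iff)
  show "(\<lambda>x. X x * Y x) \<in> borel_measurable N" using assms by (auto simp: Lp2_iff)
  have "\<bar>a * b\<bar> \<le> a\<^sup>2 + b\<^sup>2" for a b :: real
    using sum_squares_bound[of a b] sum_squares_bound[of a "-b"] sum_squares_ge_zero[of a b]
    by (auto simp: abs_if power2_eq_square)
  then show "AE x in N. norm (X x * Y x) \<le> norm ((X x)\<^sup>2 + (Y x)\<^sup>2)" by simp
qed

lemma Lp2_add: "X \<in> Lp N 2 \<Longrightarrow> Y \<in> Lp N 2 \<Longrightarrow> (\<lambda>x. X x + Y x) \<in> Lp N 2"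
  using integrable_mult_Lp2[of X N Y] by (auto simp: Lp2_iff power2_sum mult.assoc)

lemma Lp2_cmult: "X \<in> Lp N 2 \<Longrightarrow> (\<lambda>x. c * X x) \<in> Lp N 2"
  by (auto simp: Lp2_iff power_mult_distrib)

lemma Lp2_diff: "X \<in> Lp N 2 \<Longrightarrow> Y \<in> Lp N 2 \<Longrightarrow> (\<lambda>x. X x - Y x) \<in> Lp N 2"
  using Lp2_add[of X N "\<lambda>x. -1 * Y x"] Lp2_cmult[of Y N "-1"] by simp

lemma Lp2_sum: "(\<And>i. i \<in> I \<Longrightarrow> X i \<in> Lp N 2) \<Longrightarrow> (\<lambda>x. \<Sum>i\<in>I. X i x) \<in> Lp N 2"
  by (induction I rule: infinite_finite_induct) (auto intro: Lp2_add simp: Lp2_iff[of "\<lambda>_. 0"])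

lemma (in finite_measure) Lp2_bounded:
  assumes [measurable]: "X \<in> borel_measurable M" and "\<And>x. x \<in> space M \<Longrightarrow> \<bar>X x\<bar> \<le> C"
  shows "X \<in> Lp M 2"
proof -
  have "integrable M (\<lambda>x. (X x)\<^sup>2)"
  proof (rule integrable_const_bound[where B = "C\<^sup>2"])
    have "(X x)\<^sup>2 \<le> C\<^sup>2" if "x \<in> space M" for x
      using power_mono[OF assms(2)[OF that] abs_ge_zero, of 2] by simp
    then show "AE x in M. norm ((X x)\<^sup>2) \<le> C\<^sup>2" by (simp add: AE_I2)
  qed measurable
  then show ?thesis by (simp add: Lp2_iff)
qed

lemma (in finite_measure) Lp2_imp_Lp1:
  assumes "X \<in> Lp M 2" shows "X \<in> Lp M 1"
proof -
  have "(\<lambda>_. 1) \<in> Lp M 2" by (auto simp: Lp2_iff)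
  from integrable_mult_Lp2[OF assms this] show ?thesis by (simp add: Lp1_iff del: One_nat_def)
qed

text \<open>Integrate the pointwise bound |y| <= e + y^2 / e, clear from the cases |y| <= e and |y|
  > e. The free parameter \<open>e\<close> takes the place of an optimised Cauchy-Schwarz
  estimate.\<close>

lemma (in finite_measure) integral_abs_le_square:
  assumes "X \<in> Lp M 2" "e > 0"
  shows "(\<integral>x. \<bar>X x\<bar> \<partial>M) \<le> e * measure M (space M) + (\<integral>x. (X x)\<^sup>2 \<partial>M) / e"
proof -
  have "\<bar>y\<bar> \<le> e + y\<^sup>2 / e" for y
  proof (cases "\<bar>y\<bar> \<le> e")
    case False
    then have "\<bar>y\<bar> * e \<le> \<bar>y\<bar> * \<bar>y\<bar>" by (intro mult_left_mono) auto
    then have "\<bar>y\<bar> \<le> y\<^sup>2 / e" using assms(2) by (simp add: field_simps power2_eq_square)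
    then show ?thesis using assms(2) by linarith
  qed (use assms(2) in \<open>simp add: add_increasing2\<close>)
  moreover have "integrable M (\<lambda>x. \<bar>X x\<bar>)"
    using Lp2_imp_Lp1[OF assms(1)] by (simp add: Lp1_iff del: One_nat_def)
  ultimately have "(\<integral>x. \<bar>X x\<bar> \<partial>M) \<le> (\<integral>x. e + (X x)\<^sup>2 / e \<partial>M)"
    using assms by (intro integral_mono) (auto simp: Lp2_iff)
  also have "\<dots> = e * measure M (space M) + (\<integral>x. (X x)\<^sup>2 \<partial>M) / e"
    using assms by (subst Bochner_Integration.integral_add) (auto simp: Lp2_iff mult.commute)
  finally show ?thesis .
qed

lemma (in finite_measure) tendsto_L1_of_L2:
  fixes Xs :: "nat \<Rightarrow> 'a \<Rightarrow> real"
  assumes Xs: "\<And>k. Xs k \<in> Lp M 2" and lim: "(\<lambda>k. \<integral>x. (Xs k x)\<^sup>2 \<partial>M) \<longlonglongrightarrow> 0"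
  shows "(\<lambda>k. \<integral>x. \<bar>Xs k x\<bar> \<partial>M) \<longlonglongrightarrow> 0"
proof (rule LIMSEQ_I)
  fix r :: real assume "r > 0"
  \<comment> \<open>The summand 1 keeps the quotient meaningful for zero total mass; with this
    \<open>e\<close> the constant term costs less than r / 2.\<close>
  define e where "e = r / (2 * (measure M (space M) + 1))"
  have e: "e > 0" using \<open>r > 0\<close> by (auto simp: e_def intro!: divide_pos_pos add_nonneg_pos)
  have m: "e * measure M (space M) < r / 2"
    using \<open>r > 0\<close> measure_nonneg[of M "space M"] by (simp add: e_def field_simps add_pos_nonneg)
  have "r / 2 * e > 0" using e \<open>r > 0\<close> by simp
  from LIMSEQ_D[OF lim this] obtain K where K: "\<And>k. k \<ge> K \<Longrightarrow> (\<integral>x. (Xs k x)\<^sup>2 \<partial>M) < r / 2 * e"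
    by (auto simp: integral_nonneg_AE)
  have "norm ((\<integral>x. \<bar>Xs k x\<bar> \<partial>M) - 0) < r" if "k \<ge> K" for k
  proof -
    have "(\<integral>x. (Xs k x)\<^sup>2 \<partial>M) / e < r / 2" using K[OF that] e by (simp add: field_simps)
    with integral_abs_le_square[OF Xs[of k] e] m have "(\<integral>x. \<bar>Xs k x\<bar> \<partial>M) < r" by linarith
    then show ?thesis by (simp add: integral_nonneg_AE)
  qed
  then show "\<exists>K. \<forall>k\<ge>K. norm ((\<integral>x. \<bar>Xs k x\<bar> \<partial>M) - 0) < r" by blast
qed

lemma (in finite_measure) tendsto_Lp2_imp_Lp1:
  assumes "tendsto_Lp M 2 Xs X" shows "tendsto_Lp M 1 Xs X"
  using assms tendsto_L1_of_L2[of "\<lambda>k x. Xs k x - X x"] Lp2_imp_Lp1 Lp2_diff[of _ M X]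
  unfolding tendsto_Lp_def by auto

text \<open>Pairing with a bounded function is continuous in L1. Transforms of random variables, and
  pairings of kernels with tensor powers of step functions, pass to limits by this estimate.\<close>

lemma tendsto_Lp1_integral_bounded:
  assumes lim: "tendsto_Lp N 1 Xs X" and [measurable]: "G \<in> borel_measurable N"
    and bound: "\<And>x. \<bar>G x\<bar> \<le> C"
  shows "(\<lambda>k. \<integral>x. Xs k x * G x \<partial>N) \<longlonglongrightarrow> (\<integral>x. X x * G x \<partial>N)"
proof -
  have int: "integrable N (Xs k)" "integrable N X" for k
    using lim by (auto simp: tendsto_Lp_def Lp1_iff simp del: One_nat_def)
  have intG: "integrable N (\<lambda>x. Y x * G x)" if "integrable N Y" for Y
  proof (rule Bochner_Integration.integrable_bound)
    show "integrable N (\<lambda>x. C * \<bar>Y x\<bar>)" using that by auto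
    show "AE x in N. norm (Y x * G x) \<le> norm (C * \<bar>Y x\<bar>)"
    proof (intro AE_I2)
      fix x
      have "\<bar>Y x\<bar> * \<bar>G x\<bar> \<le> \<bar>Y x\<bar> * C" by (intro mult_left_mono bound) auto
      also have "\<dots> \<le> \<bar>C * \<bar>Y x\<bar>\<bar>" by (simp add: mult.commute)
      finally show "norm (Y x * G x) \<le> norm (C * \<bar>Y x\<bar>)" by (simp add: abs_mult)
    qed
  qed (use that in measurable)
  have 0: "(\<lambda>k. C * (\<integral>x. \<bar>Xs k x - X x\<bar> \<partial>N)) \<longlonglongrightarrow> 0"
    using lim by (auto simp: tendsto_Lp_def intro: tendsto_mult_right_zero)
  have "(\<lambda>k. (\<integral>x. Xs k x * G x \<partial>N) - (\<integral>x. X x * G x \<partial>N)) \<longlonglongrightarrow> 0"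
  proof (rule Lim_null_comparison[OF _ 0], intro always_eventually allI)
    fix k
    have "(\<integral>x. Xs k x * G x \<partial>N) - (\<integral>x. X x * G x \<partial>N) = (\<integral>x. (Xs k x - X x) * G x \<partial>N)"
      using intG int by (simp add: left_diff_distrib)
    also have "norm \<dots> \<le> (\<integral>x. norm ((Xs k x - X x) * G x) \<partial>N)" by (rule integral_norm_bound)
    also have "\<dots> \<le> (\<integral>x. C * \<bar>Xs k x - X x\<bar> \<partial>N)"
    proof (rule integral_mono)
      show "integrable N (\<lambda>x. norm ((Xs k x - X x) * G x))" using intG[of "\<lambda>x. Xs k x - X x"] int by auto
      show "integrable N (\<lambda>x. C * \<bar>Xs k x - X x\<bar>)" using int by auto
      show "norm ((Xs k x - X x) * G x) \<le> C * \<bar>Xs k x - X x\<bar>" for x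
        using mult_left_mono[OF bound[of x] abs_ge_zero[of "Xs k x - X x"]] by (simp add: abs_mult mult.commute)
    qed
    finally show "norm ((\<integral>x. Xs k x * G x \<partial>N) - (\<integral>x. X x * G x \<partial>N)) \<le> C * (\<integral>x. \<bar>Xs k x - X x\<bar> \<partial>N)"
      by simp
  qed
  then show ?thesis by (simp add: LIM_zero_iff)
qed

text \<open>Continuity of the squared norm from |a^2 - b^2| <= (1 + 1/e) (a - b)^2 + e b^2, a
  weighted Young inequality: the last term is made small by \<open>e\<close> alone, the first one by
  convergence.\<close>

lemma tendsto_Lp2_integral_square:
  assumes lim: "tendsto_Lp N 2 Xs X"
  shows "(\<lambda>k. \<integral>x. (Xs k x)\<^sup>2 \<partial>N) \<longlonglongrightarrow> (\<integral>x. (X x)\<^sup>2 \<partial>N)"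
proof (rule LIMSEQ_I)
  fix r :: real assume "r > 0"
  have Xs: "Xs k \<in> Lp N 2" and X: "X \<in> Lp N 2" for k using lim by (auto simp: tendsto_Lp_def)
  have D: "(\<lambda>x. Xs k x - X x) \<in> Lp N 2" for k using Xs X by (rule Lp2_diff)
  define I where "I = (\<integral>x. (X x)\<^sup>2 \<partial>N)"
  have I: "I \<ge> 0" by (simp add: I_def)
  define e where "e = r / (2 * (I + 1))"
  have e: "e > 0" "e * I < r / 2" using \<open>r > 0\<close> I by (auto simp: e_def field_simps)
  have lim0: "(\<lambda>k. (1 + 1 / e) * (\<integral>x. (Xs k x - X x)\<^sup>2 \<partial>N)) \<longlonglongrightarrow> 0"
    using lim by (auto simp: tendsto_Lp_def intro: tendsto_mult_right_zero)
  have "r / 2 > 0" using \<open>r > 0\<close> by simp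
  from LIMSEQ_D[OF lim0 this] obtain K
    where K: "\<And>k. k \<ge> K \<Longrightarrow> \<bar>(1 + 1 / e) * (\<integral>x. (Xs k x - X x)\<^sup>2 \<partial>N)\<bar> < r / 2" by auto
  have "norm ((\<integral>x. (Xs k x)\<^sup>2 \<partial>N) - I) < r" if "k \<ge> K" for k
  proof -
    have pw: "\<bar>a\<^sup>2 - b\<^sup>2\<bar> \<le> (1 + 1 / e) * (a - b)\<^sup>2 + e * b\<^sup>2" for a b :: real
    proof -
      have 1: "a\<^sup>2 - b\<^sup>2 = (a - b)\<^sup>2 + 2 * (b * (a - b))" by (simp add: power2_eq_square algebra_simps)
      have sq: "sqrt e * b * ((a - b) / sqrt e) = b * (a - b)" "(sqrt e * b)\<^sup>2 = e * b\<^sup>2" "((a - b) / sqrt e)\<^sup>2 = 1 / e * (a - b)\<^sup>2"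
        using e by (auto simp: power_mult_distrib power_divide)
      have "\<bar>2 * (v * w)\<bar> \<le> v\<^sup>2 + w\<^sup>2" for v w :: real
        using sum_squares_bound[of v w] sum_squares_bound[of "-v" w] by (auto simp: abs_if)
      from this[of "sqrt e * b" "(a - b) / sqrt e"]
      have "\<bar>2 * (b * (a - b))\<bar> \<le> (sqrt e * b)\<^sup>2 + ((a - b) / sqrt e)\<^sup>2" unfolding sq(1) .
      then have "\<bar>2 * (b * (a - b))\<bar> \<le> e * b\<^sup>2 + 1 / e * (a - b)\<^sup>2" by (simp only: sq)
      moreover have "(1 + 1 / e) * (a - b)\<^sup>2 = (a - b)\<^sup>2 + 1 / e * (a - b)\<^sup>2" by (simp add: distrib_right)
      ultimately show ?thesis unfolding 1 by (smt (verit) zero_le_power2)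
    qed
    have "(\<integral>x. (Xs k x)\<^sup>2 \<partial>N) - I = (\<integral>x. (Xs k x)\<^sup>2 - (X x)\<^sup>2 \<partial>N)"
      using Xs X by (simp add: I_def Lp2_iff)
    also have "norm \<dots> \<le> (\<integral>x. norm ((Xs k x)\<^sup>2 - (X x)\<^sup>2) \<partial>N)" by (rule integral_norm_bound)
    also have "\<dots> \<le> (\<integral>x. (1 + 1 / e) * (Xs k x - X x)\<^sup>2 + e * (X x)\<^sup>2 \<partial>N)"
      using pw Xs X D by (intro integral_mono) (auto simp: Lp2_iff)
    also have "\<dots> = (1 + 1 / e) * (\<integral>x. (Xs k x - X x)\<^sup>2 \<partial>N) + e * I"
      using X D by (simp add: Lp2_iff I_def)
    finally show ?thesis using K[OF that] e(2) by linarith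
  qed
  then show "\<exists>K. \<forall>k\<ge>K. norm ((\<integral>x. (Xs k x)\<^sup>2 \<partial>N) - (\<integral>x. (X x)\<^sup>2 \<partial>N)) < r" unfolding I_def by blast
qed

lemma integral_square_add_le:
  assumes "X \<in> Lp N 2" "Y \<in> Lp N 2"
  shows "(\<integral>x. (X x + Y x)\<^sup>2 \<partial>N) \<le> 2 * (\<integral>x. (X x)\<^sup>2 \<partial>N) + 2 * (\<integral>x. (Y x)\<^sup>2 \<partial>N)"
proof -
  have "(\<integral>x. (X x + Y x)\<^sup>2 \<partial>N) \<le> (\<integral>x. 2 * (X x)\<^sup>2 + 2 * (Y x)\<^sup>2 \<partial>N)"
  proof (rule integral_mono)
    show "(X x + Y x)\<^sup>2 \<le> 2 * (X x)\<^sup>2 + 2 * (Y x)\<^sup>2" for x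
      using sum_squares_bound[of "X x" "Y x"] by (simp add: power2_sum)
  qed (use assms Lp2_add[OF assms] in \<open>auto simp: Lp2_iff\<close>)
  then show ?thesis using assms by (simp add: Lp2_iff)
qed

text \<open>Minkowski's inequality in squared form. Cauchy-Schwarz for sqrt(b_i) and X_i / sqrt(b_i)
  gives the pointwise bound; the integral of X_i^2 / b_i is then at most b_i.\<close>

lemma integral_square_sum_le:
  assumes X: "\<And>i. i \<in> I \<Longrightarrow> X i \<in> Lp N 2" and b: "\<And>i. i \<in> I \<Longrightarrow> (\<integral>x. (X i x)\<^sup>2 \<partial>N) \<le> (b i)\<^sup>2"
    and pos: "\<And>i. i \<in> I \<Longrightarrow> b i > 0"
  shows "(\<integral>x. (\<Sum>i\<in>I. X i x)\<^sup>2 \<partial>N) \<le> (\<Sum>i\<in>I. b i)\<^sup>2"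
proof -
  have pw: "(\<Sum>i\<in>I. X i x)\<^sup>2 \<le> (\<Sum>i\<in>I. b i) * (\<Sum>i\<in>I. (X i x)\<^sup>2 / b i)" for x
  proof -
    have "(\<Sum>i\<in>I. X i x) = (\<Sum>i\<in>I. sqrt (b i) * (X i x / sqrt (b i)))"
    proof (rule sum.cong[OF refl])
      fix i assume "i \<in> I"
      then have "sqrt (b i) \<noteq> 0" using pos[of i] by simp
      then show "X i x = sqrt (b i) * (X i x / sqrt (b i))" by simp
    qed
    also have "\<dots>\<^sup>2 \<le> (\<Sum>i\<in>I. (sqrt (b i))\<^sup>2) * (\<Sum>i\<in>I. (X i x / sqrt (b i))\<^sup>2)"
      by (rule Cauchy_Schwarz_ineq_sum)
    also have "(\<Sum>i\<in>I. (sqrt (b i))\<^sup>2) = (\<Sum>i\<in>I. b i)"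
      using pos by (intro sum.cong) (auto intro: less_imp_le)
    also have "(\<Sum>i\<in>I. (X i x / sqrt (b i))\<^sup>2) = (\<Sum>i\<in>I. (X i x)\<^sup>2 / b i)"
    proof (rule sum.cong[OF refl])
      fix i assume "i \<in> I"
      then have "(sqrt (b i))\<^sup>2 = b i" using pos[of i] by simp
      then show "(X i x / sqrt (b i))\<^sup>2 = (X i x)\<^sup>2 / b i" by (simp only: power_divide)
    qed
    finally show ?thesis .
  qed
  have X2: "integrable N (\<lambda>x. (X i x)\<^sup>2)" if "i \<in> I" for i using X[OF that] by (simp add: Lp2_iff)
  have "(\<integral>x. (\<Sum>i\<in>I. X i x)\<^sup>2 \<partial>N) \<le> (\<integral>x. (\<Sum>i\<in>I. b i) * (\<Sum>i\<in>I. (X i x)\<^sup>2 / b i) \<partial>N)"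
  proof (rule integral_mono[OF _ _ pw])
    show "integrable N (\<lambda>x. (\<Sum>i\<in>I. X i x)\<^sup>2)" using Lp2_sum[of I X N] X by (simp add: Lp2_iff)
    show "integrable N (\<lambda>x. (\<Sum>i\<in>I. b i) * (\<Sum>i\<in>I. (X i x)\<^sup>2 / b i))"
      by (intro integrable_mult_right Bochner_Integration.integrable_sum integrable_divide X2)
  qed
  also have "\<dots> = (\<Sum>i\<in>I. b i) * (\<Sum>i\<in>I. (\<integral>x. (X i x)\<^sup>2 \<partial>N) / b i)"
    using X2 by (simp add: Bochner_Integration.integral_sum)
  also have "\<dots> \<le> (\<Sum>i\<in>I. b i) * (\<Sum>i\<in>I. b i)"
  proof (intro mult_left_mono sum_mono sum_nonneg)
    fix i assume "i \<in> I"
    then show "(\<integral>x. (X i x)\<^sup>2 \<partial>N) / b i \<le> b i"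
      using b[of i] pos[of i] by (simp add: pos_divide_le_eq power2_eq_square)
  qed (use pos in \<open>auto intro: less_imp_le\<close>)
  finally show ?thesis by (simp add: power2_eq_square)
qed

text \<open>Riesz-Fischer. On a finite measure an L2-Cauchy sequence is L1-Cauchy, so a subsequence
  converges almost everywhere, and Fatou's lemma carries the Cauchy estimate over to its
  limit.\<close>

lemma (in finite_measure) complete_L2:
  assumes X: "\<And>k. X k \<in> Lp M 2"
    and Cauchy: "\<And>e. e > 0 \<Longrightarrow> \<exists>K. \<forall>m\<ge>K. \<forall>n\<ge>K. (\<integral>x. (X m x - X n x)\<^sup>2 \<partial>M) < e"
  obtains Y where "tendsto_Lp M 2 X Y"
proof -
  note Lp1 = Lp2_imp_Lp1[unfolded Lp1_iff]
  have D: "(\<lambda>x. X m x - X n x) \<in> Lp M 2" for m n by (intro Lp2_diff X)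
  have [measurable]: "X k \<in> borel_measurable M" for k using X[of k] by (simp add: Lp2_iff)
  have L1: "\<exists>K. \<forall>i\<ge>K. \<forall>j\<ge>K. (LINT x|M. norm (X i x - X j x)) < e" if "e > 0" for e
  proof -
    define c where "c = e / (2 * (measure M (space M) + 1))"
    have c: "c > 0" using that by (auto simp: c_def intro!: divide_pos_pos add_nonneg_pos)
    have m: "c * measure M (space M) < e / 2"
      using that measure_nonneg[of M "space M"] by (simp add: c_def field_simps add_pos_nonneg)
    from Cauchy[of "c * (e / 2)"] c that obtain K
      where K: "\<And>m n. m \<ge> K \<Longrightarrow> n \<ge> K \<Longrightarrow> (\<integral>x. (X m x - X n x)\<^sup>2 \<partial>M) < c * (e / 2)" by auto
    have "(LINT x|M. norm (X i x - X j x)) < e" if "i \<ge> K" "j \<ge> K" for i j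
    proof -
      have "(\<integral>x. (X i x - X j x)\<^sup>2 \<partial>M) / c < e / 2" using K[OF that] c by (simp add: field_simps)
      then have "(\<integral>x. \<bar>X i x - X j x\<bar> \<partial>M) < e" using integral_abs_le_square[OF D[of i j] c] m by linarith
      then show ?thesis by simp
    qed
    then show ?thesis by blast
  qed
  obtain r where r: "strict_mono r" "AE x in M. Cauchy (\<lambda>i. X (r i) x)"
    by (rule cauchy_L1_AE_cauchy_subseq[of M X, OF Lp1[OF X]]) (use L1 in \<open>blast+\<close>)
  define Y where "Y x = lim (\<lambda>i. X (r i) x)" for x
  have [measurable]: "Y \<in> borel_measurable M" unfolding Y_def by measurable
  have conv: "AE x in M. (\<lambda>i. X (r i) x) \<longlonglongrightarrow> Y x"
    using r(2) by eventually_elim (metis Y_def Cauchy_convergent convergent_LIMSEQ_iff)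
  have est: "integrable M (\<lambda>x. (X n x - Y x)\<^sup>2) \<and> (\<integral>x. (X n x - Y x)\<^sup>2 \<partial>M) \<le> e"
    if "e > 0" and K: "\<forall>m\<ge>K. (\<integral>x. (X n x - X m x)\<^sup>2 \<partial>M) < e" for e K n
  proof -
    have "(\<integral>\<^sup>+x. ennreal ((X n x - Y x)\<^sup>2) \<partial>M) \<le> (\<integral>\<^sup>+x. liminf (\<lambda>i. ennreal ((X n x - X (r i) x)\<^sup>2)) \<partial>M)"
    proof (rule nn_integral_mono_AE)
      show "AE x in M. ennreal ((X n x - Y x)\<^sup>2) \<le> liminf (\<lambda>i. ennreal ((X n x - X (r i) x)\<^sup>2))"
        using conv
      proof eventually_elim
        case (elim x)
        then have "(\<lambda>i. ennreal ((X n x - X (r i) x)\<^sup>2)) \<longlonglongrightarrow> ennreal ((X n x - Y x)\<^sup>2)"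
          by (intro tendsto_intros)
        then have "liminf (\<lambda>i. ennreal ((X n x - X (r i) x)\<^sup>2)) = ennreal ((X n x - Y x)\<^sup>2)"
          by (intro lim_imp_Liminf) simp_all
        then show ?case by simp
      qed
    qed
    also have "\<dots> \<le> liminf (\<lambda>i. \<integral>\<^sup>+x. ennreal ((X n x - X (r i) x)\<^sup>2) \<partial>M)"
      by (rule nn_integral_liminf) measurable
    also have "\<dots> \<le> ennreal e"
    proof (rule Liminf_le)
      have "(\<integral>\<^sup>+x. ennreal ((X n x - X (r i) x)\<^sup>2) \<partial>M) \<le> ennreal e" if "i \<ge> K" for i
      proof -
        have "r i \<ge> K" using that seq_suble[OF r(1), of i] by linarith
        then show ?thesis using K D[of n "r i"]
          by (subst nn_integral_eq_integral) (auto simp: Lp2_iff intro!: ennreal_leI intro: less_imp_le)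
      qed
      then show "\<forall>\<^sub>F i in sequentially. (\<integral>\<^sup>+x. ennreal ((X n x - X (r i) x)\<^sup>2) \<partial>M) \<le> ennreal e"
        by (auto simp: eventually_sequentially)
    qed simp
    finally have *: "(\<integral>\<^sup>+x. ennreal ((X n x - Y x)\<^sup>2) \<partial>M) \<le> ennreal e" .
    then have int: "integrable M (\<lambda>x. (X n x - Y x)\<^sup>2)"
      by (intro integrableI_nonneg) (auto simp: le_less_trans)
    with * show ?thesis using that(1) by (simp add: nn_integral_eq_integral ennreal_le_iff less_imp_le)
  qed
  have DY: "(\<lambda>x. X n x - Y x) \<in> Lp M 2" if "\<forall>m\<ge>K. (\<integral>x. (X n x - X m x)\<^sup>2 \<partial>M) < 1" for n K
    using est[OF zero_less_one that] by (simp add: Lp2_iff)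
  obtain K1 where K1: "\<And>m n. m \<ge> K1 \<Longrightarrow> n \<ge> K1 \<Longrightarrow> (\<integral>x. (X m x - X n x)\<^sup>2 \<partial>M) < 1"
    using Cauchy[OF zero_less_one] by blast
  have "(\<lambda>x. X K1 x - Y x) \<in> Lp M 2" using K1 by (intro DY) auto
  from Lp2_diff[OF X[of K1] this] have Y: "Y \<in> Lp M 2" by simp
  have "(\<lambda>n. \<integral>x. (X n x - Y x)\<^sup>2 \<partial>M) \<longlonglongrightarrow> 0"
  proof (rule LIMSEQ_I)
    fix e :: real assume "e > 0"
    then have "e / 2 > 0" by simp
    from Cauchy[OF this] obtain K where "\<And>m n. m \<ge> K \<Longrightarrow> n \<ge> K \<Longrightarrow> (\<integral>x. (X m x - X n x)\<^sup>2 \<partial>M) < e / 2"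
      by blast
    then have "(\<integral>x. (X n x - Y x)\<^sup>2 \<partial>M) \<le> e / 2" if "n \<ge> K" for n
      using est[OF \<open>e / 2 > 0\<close>, of K n] that by auto
    then have "norm ((\<integral>x. (X n x - Y x)\<^sup>2 \<partial>M) - 0) < e" if "n \<ge> K" for n
      using that \<open>e > 0\<close> by fastforce
    then show "\<exists>K. \<forall>n\<ge>K. norm ((\<integral>x. (X n x - Y x)\<^sup>2 \<partial>M) - 0) < e" by blast
  qed
  then have "tendsto_Lp M 2 X Y" using X Y by (simp add: tendsto_Lp_def)
  then show ?thesis by (rule that)
qed

lemma tendsto_Lp_cong_AE:
  assumes "tendsto_Lp N p Xs X" "\<And>k. AE x in N. Xs k x = Ys k x" "AE x in N. X x = Y x"
    "\<And>k. Ys k \<in> borel_measurable N" "Y \<in> borel_measurable N"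
  shows "tendsto_Lp N p Ys Y"
proof -
  have [measurable]: "Xs k \<in> borel_measurable N" "X \<in> borel_measurable N" 
    "Ys k \<in> borel_measurable N" "Y \<in> borel_measurable N" for k
    using assms by (auto simp: tendsto_Lp_def Lp_def)
  have 1: "Z' \<in> Lp N p" if "Z \<in> Lp N p" "AE x in N. Z x = Z' x" "Z' \<in> borel_measurable N" for Z Z'
  proof -
    have [measurable]: "Z \<in> borel_measurable N" "Z' \<in> borel_measurable N" using that by (auto simp: Lp_def)
    have "integrable N (\<lambda>x. \<bar>Z' x\<bar> ^ p) \<longleftrightarrow> integrable N (\<lambda>x. \<bar>Z x\<bar> ^ p)"
      using that(2) by (intro integrable_cong_AE) (auto elim: eventually_mono)
    then show ?thesis using that by (simp add: Lp_def)
  qed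
  have "(\<integral>x. \<bar>Ys k x - Y x\<bar> ^ p \<partial>N) = (\<integral>x. \<bar>Xs k x - X x\<bar> ^ p \<partial>N)" for k
    using assms(2)[of k] assms(3) by (intro integral_cong_AE) auto
  moreover have "Ys k \<in> Lp N p" for k
    by (rule 1[of "Xs k"]) (use assms in \<open>auto simp: tendsto_Lp_def\<close>)
  moreover have "Y \<in> Lp N p"
    by (rule 1[of X]) (use assms in \<open>auto simp: tendsto_Lp_def\<close>)
  ultimately show ?thesis using assms(1) unfolding tendsto_Lp_def by simp
qed

section \<open>Uniqueness for the heat equation\<close>

text \<open>If g'' were positive, g' would be positive immediately to the right of the critical
  point, and the mean value theorem would give a larger value there.\<close>

lemma second_derivative_at_max:
  fixes g g' :: "real \<Rightarrow> real"
  assumes "0 < d" and max: "\<And>y. \<bar>y - x\<bar> < d \<Longrightarrow> g y \<le> g x"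
    and g': "\<And>y. (g has_real_derivative g' y) (at y)"
    and g'': "(g' has_real_derivative g'') (at x)"
  shows "g'' \<le> 0"
proof (rule ccontr)
  assume "\<not> g'' \<le> 0"
  then have pos: "0 < g''" by simp
  have 0: "g' x = 0"
    by (rule DERIV_local_max[OF g' \<open>0 < d\<close>]) (use max in \<open>auto simp: abs_minus_commute\<close>)
  obtain e where "0 < e" and e: "\<And>h. 0 < h \<Longrightarrow> h < e \<Longrightarrow> g' x < g' (x + h)"
    using DERIV_pos_inc_right[OF g'' pos] by auto
  define h where "h = min d e / 2"
  have h: "0 < h" "h < d" "h < e" using \<open>0 < d\<close> \<open>0 < e\<close> by (auto simp: h_def)
  obtain z where z: "x < z" "z < x + h" "g (x + h) - g x = (x + h - x) * g' z"
    using MVT2[of x "x + h" g g'] g' h by auto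
  have "0 < g' z" using e[of "z - x"] z h 0 by auto
  then have "0 < h * g' z" using h by simp
  then have "g x < g (x + h)" using z by simp
  moreover have "g (x + h) \<le> g x" using max[of "x + h"] h by simp
  ultimately show False by simp
qed

text \<open>Used for the barrier of the comparison argument: \<open>s\<close> is the time left until
  its blow-up and \<open>c\<close> the square root of that time, both constant in
  \<open>z\<close>.\<close>

lemma heat_barrier_space_derivative:
  fixes s z c :: real
  assumes "s > 0" "c \<noteq> 0"
  shows "((\<lambda>z. exp (z\<^sup>2 / (2 * s)) / c) has_real_derivative exp (z\<^sup>2 / (2 * s)) / c * (z / s)) (at z)"
  using assms by (auto intro!: derivative_eq_intros simp: field_simps)

text \<open>Tychonoff's argument on a short time strip. The barrier \<open>h\<close> is a positive
  solution of the heat equation that blows up at time \<open>\<tau>\<close>; up to a constant it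
  grows at least like exp(2 a x^2) on the strip, faster than \<open>w\<close>. Hence w - \<epsilon>
  h - \<epsilon> (t - s) can be positive only on a bounded set, and its last term makes the
  contradiction at a maximum strict.\<close>

lemma heat_comparison_step:
  fixes w wt wx wxx :: "real \<Rightarrow> real \<Rightarrow> real"
  assumes cont: "continuous_on ({0..T} \<times> UNIV) (\<lambda>(t, x). w t x)"
    and dt: "\<And>t x. t \<in> {0<..T} \<Longrightarrow> ((\<lambda>s. w s x) has_real_derivative wt t x) (at t within {0<..T})"
    and dx: "\<And>t x. t \<in> {0<..T} \<Longrightarrow> (w t has_real_derivative wx t x) (at x)"
    and dxx: "\<And>t x. t \<in> {0<..T} \<Longrightarrow> (wx t has_real_derivative wxx t x) (at x)"
    and heat: "\<And>t x. t \<in> {0<..T} \<Longrightarrow> wt t x = 1 / 2 * wxx t x"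
    and growth: "\<And>t x. t \<in> {0..T} \<Longrightarrow> w t x \<le> A * exp (a * x\<^sup>2)"
    and "a > 0" "A > 0"
    and s: "0 \<le> s" and init: "\<And>x. w s x \<le> 0"
    and t: "s \<le> t" "t \<le> T" "t \<le> s + 1 / (8 * a)"
  shows "w t x \<le> 0"
proof -
  \<comment> \<open>The strip ends at \<open>s + \<delta>\<close>, halfway to the blow-up time, and
    1 / (4 \<delta>) = 2 a is the growth rate of the barrier.\<close>
  define \<delta> where "\<delta> = 1 / (8 * a)"
  define \<tau> where "\<tau> = s + 2 * \<delta>"
  define h where "h t x = exp (x\<^sup>2 / (2 * (\<tau> - t))) / sqrt (\<tau> - t)" for t x :: real
  have \<delta>: "\<delta> > 0" using \<open>a > 0\<close> by (simp add: \<delta>_def)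
  have hpos: "h t x > 0" if "t < \<tau>" for t x using that by (simp add: h_def)
  have key: "w t x \<le> \<epsilon> * h t x + \<epsilon> * (t - s)" if \<epsilon>: "\<epsilon> > 0" for \<epsilon>
  proof (rule ccontr)
    assume neg: "\<not> ?thesis"
    define g where "g t x = w t x - \<epsilon> * h t x - \<epsilon> * (t - s)" for t x
    \<comment> \<open>A lower bound for the prefactor \<epsilon> / sqrt(\<tau> - r), because \<tau>
      - r <= 2 \<delta> on the strip.\<close>
    define c where "c = \<epsilon> / sqrt (2 * \<delta>)"
    have c: "c > 0" using \<epsilon> \<delta> by (simp add: c_def)
    \<comment> \<open>Where a y^2 >= ln(A / c), the lower bound c exp(2 a y^2) of the barrier term
      dominates A exp(a y^2). The maximum and the added 1 put the given \<open>x\<close> strictly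
      inside.\<close>
    define R where "R = max \<bar>x\<bar> (sqrt (\<bar>ln (A / c)\<bar> / a)) + 1"
    have outside: "g r y \<le> 0" if r: "s \<le> r" "r \<le> T" "r \<le> s + \<delta>" and y: "\<bar>y\<bar> \<ge> R" for r y
    proof -
      have "sqrt (\<bar>ln (A / c)\<bar> / a) \<le> \<bar>y\<bar>" using y by (simp add: R_def)
      then have "\<bar>ln (A / c)\<bar> / a \<le> y\<^sup>2"
        by (metis abs_ge_zero sqrt_le_D real_sqrt_abs real_sqrt_le_iff)
      then have "ln (A / c) \<le> a * y\<^sup>2" using \<open>a > 0\<close> by (simp add: field_simps)
      then have "A / c \<le> exp (a * y\<^sup>2)" using \<open>A > 0\<close> c
        by (metis divide_pos_pos exp_le_cancel_iff exp_ln)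
      then have "A * exp (a * y\<^sup>2) \<le> c * exp (a * y\<^sup>2) * exp (a * y\<^sup>2)"
        using c by (simp add: field_simps)
      also have "\<dots> = \<epsilon> * (exp (2 * a * y\<^sup>2) / sqrt (2 * \<delta>))"
        by (simp add: c_def flip: exp_add)
      also have "\<dots> \<le> \<epsilon> * h r y"
      proof -
        have 1: "\<tau> - r > 0" "\<tau> - r \<le> 2 * \<delta>" using r \<delta> by (auto simp: \<tau>_def)
        have "2 * a * y\<^sup>2 = y\<^sup>2 / (2 * (2 * \<delta>))" using \<open>a > 0\<close> by (simp add: \<delta>_def)
        also have "\<dots> \<le> y\<^sup>2 / (2 * (\<tau> - r))"
          using 1 by (intro divide_left_mono) auto
        finally have "exp (2 * a * y\<^sup>2) / sqrt (2 * \<delta>) \<le> h r y"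
          unfolding h_def using 1 by (intro frac_le) auto
        then show ?thesis using \<epsilon> by (intro mult_left_mono) auto
      qed
      finally have "w r y \<le> \<epsilon> * h r y" using growth[of r y] r s by auto
      moreover have "0 \<le> \<epsilon> * (r - s)" using \<epsilon> r by simp
      ultimately show ?thesis by (simp add: g_def)
    qed
    \<comment> \<open>The time range stays at distance at least \<delta> from the blow-up, so
      \<open>g\<close> is continuous on \<open>K\<close>.\<close>
    define K where "K = {s..min T (s + \<delta>)} \<times> {-R..R}"
    have "compact K" unfolding K_def by (intro compact_Times compact_Icc)
    have "continuous_on K (\<lambda>(t, x). w t x)"
      by (rule continuous_on_subset[OF cont]) (use s in \<open>auto simp: K_def\<close>)
    then have "continuous_on K (\<lambda>p. w (fst p) (snd p))" by (simp add: case_prod_unfold)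
    moreover have "\<And>p. p \<in> K \<Longrightarrow> \<tau> - fst p > 0" using \<delta> by (auto simp: K_def \<tau>_def)
    ultimately have contg: "continuous_on K (\<lambda>p. g (fst p) (snd p))"
      unfolding g_def h_def by (intro continuous_intros) (fastforce simp: less_le)+
    have txK: "(t, x) \<in> K" using t unfolding K_def R_def \<delta>_def by auto
    obtain p where p: "p \<in> K" and pmax: "\<And>q. q \<in> K \<Longrightarrow> g (fst q) (snd q) \<le> g (fst p) (snd p)"
      using continuous_attains_sup[OF \<open>compact K\<close> _ contg] txK by blast
    obtain r y where ry: "p = (r, y)" by force
    have "g t x > 0" using neg by (simp add: g_def)
    then have gpos: "g r y > 0" using pmax[OF txK] by (simp add: ry)
    have rK: "s \<le> r" "r \<le> T" "r \<le> s + \<delta>" using p by (auto simp: K_def ry)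
    have "\<bar>y\<bar> < R" using outside[OF rK, of y] gpos by (meson linorder_not_le)
    \<comment> \<open>On the initial line \<open>w\<close> is nonpositive and the barrier positive,
      so the positive maximum lies at a later time.\<close>
    have "r \<noteq> s"
    proof
      assume "r = s"
      then have "g r y < 0" using init[of y] mult_pos_pos[OF \<epsilon> hpos[of s y]] \<delta> by (simp add: g_def \<tau>_def)
      then show False using gpos by simp
    qed
    then have r: "s < r" "r \<in> {0<..T}" "r < \<tau>" using rK s \<delta> by (auto simp: \<tau>_def)
    define ht where "ht = h r y * (y\<^sup>2 / (2 * (\<tau> - r)\<^sup>2) + 1 / (2 * (\<tau> - r)))"
    \<comment> \<open>Writing the remaining time as q^2 turns the derivative identities into
      rational ones in \<open>q\<close>.\<close>
    define q where "q = sqrt (\<tau> - r)"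
    have q: "q > 0" "\<tau> - r = q\<^sup>2" using r by (auto simp: q_def)
    have d1: "((\<lambda>r. y\<^sup>2 / (2 * (\<tau> - r))) has_real_derivative y\<^sup>2 / (2 * (\<tau> - r)\<^sup>2)) (at r within {0<..T})"
    proof (rule DERIV_cong)
      show "((\<lambda>r. y\<^sup>2 / (2 * (\<tau> - r))) has_real_derivative
          (0 * (2 * (\<tau> - r)) - y\<^sup>2 * (2 * (0 - 1))) / ((2 * (\<tau> - r)) * (2 * (\<tau> - r)))) (at r within {0<..T})"
        using r by (intro DERIV_divide DERIV_const DERIV_cmult DERIV_diff DERIV_ident) auto
      show "(0 * (2 * (\<tau> - r)) - y\<^sup>2 * (2 * (0 - 1))) / ((2 * (\<tau> - r)) * (2 * (\<tau> - r))) = y\<^sup>2 / (2 * (\<tau> - r)\<^sup>2)"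
        unfolding q(2) using q(1) by (simp add: field_simps power2_eq_square)
    qed
    have d2: "((\<lambda>r. sqrt (\<tau> - r)) has_real_derivative - 1 / (2 * q)) (at r within {0<..T})"
      using r by (auto intro!: derivative_eq_intros simp: field_simps q_def)
    have dht: "((\<lambda>r. h r y) has_real_derivative ht) (at r within {0<..T})"
      unfolding h_def
    proof (rule DERIV_cong[OF DERIV_divide[OF DERIV_chain2[OF DERIV_exp d1] d2]])
      show "sqrt (\<tau> - r) \<noteq> 0" using r by simp
      show "(exp (y\<^sup>2 / (2 * (\<tau> - r))) * (y\<^sup>2 / (2 * (\<tau> - r)\<^sup>2)) * sqrt (\<tau> - r) -
          exp (y\<^sup>2 / (2 * (\<tau> - r))) * (- 1 / (2 * q))) / (sqrt (\<tau> - r) * sqrt (\<tau> - r)) = ht"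
        unfolding ht_def h_def q_def[symmetric] unfolding q(2) using q(1)
        by (simp add: field_simps power2_eq_square)
    qed
    have dhx: "(h r has_real_derivative h r z * (z / (\<tau> - r))) (at z)" for z
      unfolding h_def using r by (intro heat_barrier_space_derivative) auto
    have dhxx: "((\<lambda>z. h r z * (z / (\<tau> - r))) has_real_derivative 2 * ht) (at y)"
    proof (rule DERIV_cong[OF DERIV_mult[OF dhx DERIV_cdivide[OF DERIV_ident]]])
      show "h r y * (y / (\<tau> - r)) * (y / (\<tau> - r)) + 1 / (\<tau> - r) * h r y = 2 * ht"
        unfolding ht_def q(2) using q(1) by (simp add: field_simps power2_eq_square)
    qed
    have dgt: "((\<lambda>r. g r y) has_real_derivative wt r y - \<epsilon> * ht - \<epsilon>) (at r within {0<..T})"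
      unfolding g_def by (auto intro!: derivative_eq_intros dht dt r)
    have "wxx r y - \<epsilon> * (2 * ht) \<le> 0"
    proof (rule second_derivative_at_max[where g = "g r" and x = y and d = "R - \<bar>y\<bar>"])
      show "0 < R - \<bar>y\<bar>" using \<open>\<bar>y\<bar> < R\<close> by simp
      show "g r z \<le> g r y" if z: "\<bar>z - y\<bar> < R - \<bar>y\<bar>" for z
      proof -
        have "- R \<le> z \<and> z \<le> R" using z by linarith
        then show ?thesis using pmax[of "(r, z)"] rK by (auto simp: K_def ry)
      qed
      show "(g r has_real_derivative wx r z - \<epsilon> * (h r z * (z / (\<tau> - r)))) (at z)" for z
        unfolding g_def by (rule derivative_eq_intros dhx dx r refl | simp)+
      show "((\<lambda>z. wx r z - \<epsilon> * (h r z * (z / (\<tau> - r)))) has_real_derivative wxx r y - \<epsilon> * (2 * ht)) (at y)"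
        by (rule derivative_eq_intros dhxx dxx r refl | simp)+
    qed
    \<comment> \<open>At the maximum the second space derivative of \<open>g\<close> is at most
      zero. Since \<open>w\<close> and \<open>h\<close> solve the heat equation, the time derivative
      of \<open>g\<close> is at most -\<epsilon>.\<close>
    then have neg: "wt r y - \<epsilon> * ht - \<epsilon> < 0" using heat[OF r(2), of y] \<epsilon> by simp
    \<comment> \<open>A negative time derivative from the left gives larger values just before
      \<open>r\<close>, also when r = T; this contradicts maximality.\<close>
    obtain d where d: "d > 0" "\<And>k. 0 < k \<Longrightarrow> r - k \<in> {0<..T} \<Longrightarrow> k < d \<Longrightarrow> g r y < g (r - k) y"
      using has_real_derivative_neg_dec_left[OF dgt neg] by auto
    define k where "k = min d (r - s) / 2"
    have k: "0 < k" "k < d" "k < r - s" using d r by (auto simp: k_def)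
    have "g r y < g (r - k) y" using d(2)[of k] k s r by auto
    moreover
    have y: "- R \<le> y \<and> y \<le> R" using \<open>\<bar>y\<bar> < R\<close> by linarith
    have "g (r - k) y \<le> g r y"
      using pmax[of "(r - k, y)"] k rK y by (auto simp: K_def ry)
    ultimately show False by simp
  qed
  \<comment> \<open>The bound holds for every positive \<epsilon>; letting \<epsilon> tend to 0
    removes the barrier.\<close>
  have lim: "((\<lambda>\<epsilon>. \<epsilon> * h t x + \<epsilon> * (t - s)) \<longlongrightarrow> 0 * h t x + 0 * (t - s)) (at_right 0)"
    by (intro tendsto_intros)
  have "eventually (\<lambda>\<epsilon>. w t x \<le> \<epsilon> * h t x + \<epsilon> * (t - s)) (at_right 0)"
    using key by (auto simp: eventually_at_right_less intro: eventually_mono[OF eventually_at_right_less])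
  from tendsto_lowerbound[OF lim this] show ?thesis by simp
qed

text \<open>The strip length 1 / (8 a) depends only on the growth rate, so finitely many strips
  reach any \<open>t\<close>; the end of one strip supplies the initial condition of the
  next.\<close>

lemma heat_comparison:
  fixes w wt wx wxx :: "real \<Rightarrow> real \<Rightarrow> real"
  assumes cont: "continuous_on ({0..T} \<times> UNIV) (\<lambda>(t, x). w t x)"
    and dt: "\<And>t x. t \<in> {0<..T} \<Longrightarrow> ((\<lambda>s. w s x) has_real_derivative wt t x) (at t within {0<..T})"
    and dx: "\<And>t x. t \<in> {0<..T} \<Longrightarrow> (w t has_real_derivative wx t x) (at x)"
    and dxx: "\<And>t x. t \<in> {0<..T} \<Longrightarrow> (wx t has_real_derivative wxx t x) (at x)"
    and heat: "\<And>t x. t \<in> {0<..T} \<Longrightarrow> wt t x = 1 / 2 * wxx t x"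
    and growth: "\<And>t x. t \<in> {0..T} \<Longrightarrow> w t x \<le> A * exp (a * x\<^sup>2)"
    and "a > 0" "A > 0"
    and init: "\<And>x. w 0 x \<le> 0"
    and "t \<in> {0..T}"
  shows "w t x \<le> 0"
proof -
  have *: "0 \<le> t \<Longrightarrow> t \<le> T \<Longrightarrow> t \<le> real n * (1 / (8 * a)) \<Longrightarrow> w t x \<le> 0" for n t x
  proof (induction n arbitrary: t x)
    case 0
    then show ?case using init[of x] by simp
  next
    case (Suc n)
    define s where "s = min t (real n * (1 / (8 * a)))"
    have s: "0 \<le> s" "s \<le> t" "s \<le> T" "t \<le> s + 1 / (8 * a)"
      using Suc.prems \<open>a > 0\<close> by (auto simp: s_def min_def algebra_simps add_divide_distrib)
    have init': "w s y \<le> 0" for y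
      by (rule Suc.IH) (use s in \<open>auto simp: s_def\<close>)
    show ?case
      by (rule heat_comparison_step[OF cont dt dx dxx heat growth \<open>a > 0\<close> \<open>A > 0\<close> s(1) init' s(2) Suc.prems(2) s(4)])
  qed
  obtain n :: nat where "t / (1 / (8 * a)) \<le> real n" using real_arch_simple by blast
  then have "t \<le> real n * (1 / (8 * a))" using \<open>a > 0\<close> by (simp add: field_simps)
  then show ?thesis using * assms(10) by auto
qed

section \<open>Approximation by trigonometric sums\<close>

definition trig_sum :: "(real \<times> real \<times> real) list \<Rightarrow> real \<Rightarrow> real" where
  "trig_sum L x = (\<Sum>(a, w, p)\<leftarrow>L. a * cos (w * x + p))"

lemma trig_sum_append: "trig_sum (L @ L') x = trig_sum L x + trig_sum L' x"
  by (simp add: trig_sum_def)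

text \<open>The product-to-sum formula replaces each mode by two of half the amplitude. The phase in
  each triple keeps the class closed without separate sine terms.\<close>

lemma trig_sum_mult_cos:
  "trig_sum (concat (map (\<lambda>(a, w, p). [(a / 2, w + b, p + c), (a / 2, w - b, p - c)]) L)) x =
    trig_sum L x * cos (b * x + c)"
proof (induction L)
  case (Cons q L)
  obtain a w p where q: "q = (a, w, p)" by (cases q)
  have "cos (w * x + p) * cos (b * x + c) =
      (cos ((w + b) * x + (p + c)) + cos ((w - b) * x + (p - c))) / 2"
    by (subst cos_times_cos) (simp add: algebra_simps)
  then have "a * (cos (w * x + p) * cos (b * x + c)) =
      a / 2 * cos ((w + b) * x + (p + c)) + a / 2 * cos ((w - b) * x + (p - c))"
    by (simp only: times_divide_eq_right times_divide_eq_left distrib_left add_divide_distrib)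
  with Cons show ?case unfolding q by (simp add: trig_sum_def distrib_right mult.assoc)
qed (simp add: trig_sum_def)

lemma trig_sum_cos_power: "\<exists>L. \<forall>x. trig_sum L x = a * cos (b * x + c) ^ n"
proof (induction n)
  case 0
  have "trig_sum [(a, 0, 0)] x = a * cos (b * x + c) ^ 0" for x by (simp add: trig_sum_def)
  then show ?case by blast
next
  case (Suc n)
  then obtain L where "\<forall>x. trig_sum L x = a * cos (b * x + c) ^ n" by blast
  then show ?case
    using trig_sum_mult_cos[of b c L]
    by (intro exI[of _ "concat (map (\<lambda>(a, w, p). [(a / 2, w + b, p + c), (a / 2, w - b, p - c)]) L)"])
      (simp add: mult.assoc mult.commute)
qed

lemma trig_sum_polynomial_cos:
  "\<exists>L. \<forall>x. trig_sum L x = (\<Sum>i\<le>(n::nat). a i * cos (b * x + c) ^ i)"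
proof (induction n)
  case 0
  then show ?case using trig_sum_cos_power[of "a 0" b c 0] by simp
next
  case (Suc n)
  then obtain L where L: "\<forall>x. trig_sum L x = (\<Sum>i\<le>n. a i * cos (b * x + c) ^ i)" by blast
  obtain L' where L': "\<forall>x. trig_sum L' x = a (Suc n) * cos (b * x + c) ^ Suc n"
    using trig_sum_cos_power by blast
  show ?case by (intro exI[of _ "L @ L'"]) (simp add: trig_sum_append L L')
qed

text \<open>
  Reflecting \<open>f\<close> at the end points of \<open>[-r, r]\<close> turns it into a continuous function of a cosine, so
  that a polynomial approximation on \<open>[-1, 1]\<close> is uniformly bounded on the whole line.
\<close>

lemma trig_sum_approximation:
  fixes f :: "real \<Rightarrow> real"
  assumes f: "continuous_on UNIV f" and C: "\<And>x. \<bar>f x\<bar> \<le> C" and "r > 0" "e > 0" "e \<le> 1"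
  obtains L where "\<And>x. \<bar>f x - trig_sum L x\<bar> \<le> e + (2 * C + 1) * x\<^sup>2 / r\<^sup>2"
proof -
  \<comment> \<open>\<open>P\<close> is \<open>f\<close> on [-r, r] read through y = cos(pi (x + r)
    / (2 r)).\<close>
  define P where "P y = f (2 * r / pi * arccos y - r)" for y
  have contP: "continuous_on {-1..1} P"
    unfolding P_def by (intro continuous_on_compose2[OF f] continuous_intros continuous_on_arccos') auto
  obtain Q where Q: "real_polynomial_function Q" "\<And>y. y \<in> {-1..1} \<Longrightarrow> \<bar>P y - Q y\<bar> < e"
    using Stone_Weierstrass_real_polynomial_function[OF compact_Icc contP \<open>e > 0\<close>] by blast
  obtain a n where Qa: "Q = (\<lambda>y. \<Sum>i\<le>n. a i * y ^ i)"
    using Q(1) by (auto simp: real_polynomial_function_iff_sum)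
  \<comment> \<open>With this frequency b x + pi / 2 runs through [0, pi], the range of arccos, as
    \<open>x\<close> runs through [-r, r].\<close>
  define b where "b = pi / (2 * r)"
  obtain L where L: "\<And>x. trig_sum L x = Q (cos (b * x + pi / 2))"
    using trig_sum_polynomial_cos[of a b "pi / 2" n] unfolding Qa by blast
  have cosI: "cos y \<in> {-1..1}" for y :: real by simp
  have C0: "C \<ge> 0" using C[of 0] by linarith
  have "\<bar>f x - trig_sum L x\<bar> \<le> e + (2 * C + 1) * x\<^sup>2 / r\<^sup>2" for x
  proof (cases "\<bar>x\<bar> \<le> r")
    case True
    have arg: "b * x + pi / 2 = pi * ((x + r) / (2 * r))" using \<open>r > 0\<close> by (simp add: b_def field_simps)
    have "0 \<le> (x + r) / (2 * r)" "(x + r) / (2 * r) \<le> 1" using True \<open>r > 0\<close> by auto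
    then have "0 \<le> b * x + pi / 2" "b * x + pi / 2 \<le> pi"
      unfolding arg using mult_nonneg_nonneg[of pi "(x + r) / (2 * r)"] mult_left_le[of "(x + r) / (2 * r)" pi]
      by (simp_all only: pi_ge_zero)
    then have "arccos (cos (b * x + pi / 2)) = b * x + pi / 2" by (rule arccos_cos)
    moreover have "2 * r / pi * (b * x + pi / 2) - r = x" using \<open>r > 0\<close> by (simp add: b_def field_simps)
    ultimately have "P (cos (b * x + pi / 2)) = f x" by (simp add: P_def)
    then have "\<bar>f x - trig_sum L x\<bar> \<le> e" using Q(2)[OF cosI, of "b * x + pi / 2"] by (simp add: L)
    moreover have "0 \<le> (2 * C + 1) * x\<^sup>2 / r\<^sup>2" using C0 by simp
    ultimately show ?thesis by linarith
  next
    case False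
    \<comment> \<open>Outside the interval the two functions are merely bounded; since x^2 / r^2 >=
      1 there, the quadratic term absorbs their difference.\<close>
    have "\<bar>trig_sum L x\<bar> \<le> C + e"
      using Q(2)[OF cosI, of "b * x + pi / 2"] C[of "2 * r / pi * arccos (cos (b * x + pi / 2)) - r"]
      by (simp add: L P_def)
    then have "\<bar>f x - trig_sum L x\<bar> \<le> 2 * C + e" using C[of x] by linarith
    also have "\<dots> \<le> e + (2 * C + 1) * 1" using \<open>e \<le> 1\<close> by simp
    also have "\<dots> \<le> e + (2 * C + 1) * (x\<^sup>2 / r\<^sup>2)"
    proof -
      have "r\<^sup>2 \<le> x\<^sup>2" using False \<open>r > 0\<close> by (metis abs_ge_zero less_eq_real_def linorder_not_less power2_abs power_mono)
      then have "1 \<le> x\<^sup>2 / r\<^sup>2" using \<open>r > 0\<close> by simp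
      then show ?thesis using C0 by (intro add_left_mono mult_left_mono) auto
    qed
    finally show ?thesis by simp
  qed
  then show ?thesis by (rule that)
qed

section \<open>Wick's formula for Brownian increments\<close>

lemma sum_mult_indicator_singleton:
  fixes g :: "'b \<Rightarrow> real"
  assumes "finite S" "b \<in> S"
  shows "(\<Sum>s\<in>S. g s * indicat_real {b} s) = g b" "(\<Sum>s\<in>S. indicat_real {b} s * g s) = g b"
  using assms by (simp_all add: indicator_def if_distrib sum.delta cong: if_cong)

lemma abs_cos_diff_le: "\<bar>cos u - cos v\<bar> \<le> \<bar>u - v\<bar>" for u v :: real
proof -
  have "cos u - cos v = 2 * sin ((u + v) / 2) * sin ((v - u) / 2)" by (rule cos_diff_cos)
  then have "\<bar>cos u - cos v\<bar> = 2 * (\<bar>sin ((u + v) / 2)\<bar> * \<bar>sin ((v - u) / 2)\<bar>)"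
    by (simp add: abs_mult)
  also have "\<dots> \<le> 2 * (1 * \<bar>(v - u) / 2\<bar>)"
    by (intro mult_left_mono mult_mono abs_sin_x_le_abs_x) auto
  also have "\<dots> = \<bar>u - v\<bar>" by (simp add: abs_minus_commute)
  finally show ?thesis .
qed

text \<open>Unlike square-integrability, this property is stable under products, which is what
  multiplying several increments requires.\<close>

definition all_moments :: "'a measure \<Rightarrow> ('a \<Rightarrow> real) \<Rightarrow> bool" where
  "all_moments M X \<longleftrightarrow> X \<in> borel_measurable M \<and> (\<forall>p. integrable M (\<lambda>x. \<bar>X x\<bar> ^ p))"

lemma all_moments_integrable: "all_moments M X \<Longrightarrow> integrable M X"
  unfolding all_moments_def by (elim conjE allE[of _ 1]) (simp add: integrable_abs_iff)

lemma all_moments_Lp: "all_moments M X \<Longrightarrow> X \<in> Lp M p"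
  by (simp add: all_moments_def Lp_def)

lemma (in finite_measure) all_moments_const: "all_moments M (\<lambda>_. c)"
  by (simp add: all_moments_def)

text \<open>Every power of |X| and of |Y| is square-integrable, so |X|^p |Y|^p is integrable as a
  product of two L2 functions.\<close>

lemma all_moments_mult:
  assumes X: "all_moments M X" and Y: "all_moments M Y"
  shows "all_moments M (\<lambda>x. X x * Y x)"
  unfolding all_moments_def
proof safe
  have [measurable]: "X \<in> borel_measurable M" "Y \<in> borel_measurable M"
    using X Y by (auto simp: all_moments_def)
  show "(\<lambda>x. X x * Y x) \<in> borel_measurable M" by measurable
  fix p
  have "(\<lambda>x. \<bar>X x\<bar> ^ p) \<in> Lp M 2" "(\<lambda>x. \<bar>Y x\<bar> ^ p) \<in> Lp M 2"
    using X Y by (auto simp: Lp2_iff all_moments_def simp flip: power_mult)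
  from integrable_mult_Lp2[OF this] show "integrable M (\<lambda>x. \<bar>X x * Y x\<bar> ^ p)"
    by (simp add: abs_mult power_mult_distrib)
qed

lemma (in finite_measure) all_moments_prod:
  "(\<And>i. i \<in> I \<Longrightarrow> all_moments M (X i)) \<Longrightarrow> all_moments M (\<lambda>x. \<Prod>i\<in>I. X i x)"
  by (induction I rule: infinite_finite_induct) (auto intro: all_moments_mult all_moments_const)

section \<open>Moments and characteristic functions of Brownian increments\<close>

locale brownian = prob_space M for M :: "'a measure" +
  fixes B :: "real \<Rightarrow> 'a \<Rightarrow> real" and T :: real
  assumes T_pos: "T > 0" and bm: "brownian_motion M T B"
begin

lemma B_measurable: "t \<in> {0..T} \<Longrightarrow> B t \<in> borel_measurable M"
  using bm by (simp add: brownian_motion_def)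

lemma B_zero: "AE \<omega> in M. B 0 \<omega> = 0"
  using bm by (simp add: brownian_motion_def)

lemma increment_distributed:
  "0 \<le> s \<Longrightarrow> s < t \<Longrightarrow> t \<le> T \<Longrightarrow>
    distributed M lborel (\<lambda>\<omega>. B t \<omega> - B s \<omega>) (normal_density 0 (sqrt (t - s)))"
  using bm by (simp add: brownian_motion_def)

lemma increments_indep:
  "0 \<le> \<tau> 0 \<Longrightarrow> strict_mono_on {..n} \<tau> \<Longrightarrow> \<tau> n \<le> T \<Longrightarrow>
    indep_vars (\<lambda>_. borel) (\<lambda>i \<omega>. B (\<tau> (Suc i)) \<omega> - B (\<tau> i) \<omega>) {..<n}"
  using bm by (simp add: brownian_motion_def)

lemma increment_all_moments:
  assumes "0 \<le> s" "s \<le> t" "t \<le> T"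
  shows "all_moments M (\<lambda>\<omega>. B t \<omega> - B s \<omega>)"
proof (cases "s = t")
  case False
  then have D: "distributed M lborel (\<lambda>\<omega>. B t \<omega> - B s \<omega>) (normal_density 0 (sqrt (t - s)))"
    using assms by (intro increment_distributed) auto
  have "integrable M (\<lambda>\<omega>. \<bar>B t \<omega> - B s \<omega>\<bar> ^ p)" for p
    using distributed_integrable[OF D, of "\<lambda>x. \<bar>x\<bar> ^ p"] integrable_normal_moment_abs[of "sqrt (t - s)" 0 p]
      False assms by simp
  moreover have "B t \<in> borel_measurable M" "B s \<in> borel_measurable M"
    using assms by (auto intro: B_measurable)
  ultimately show ?thesis by (auto simp: all_moments_def)
qed (simp add: all_moments_const)

lemma B_all_moments:
  assumes "t \<in> {0..T}"
  shows "all_moments M (B t)"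
proof -
  have [measurable]: "B t \<in> borel_measurable M" "B 0 \<in> borel_measurable M"
    using assms T_pos by (auto intro: B_measurable)
  have "integrable M (\<lambda>\<omega>. \<bar>B t \<omega>\<bar> ^ p) \<longleftrightarrow> integrable M (\<lambda>\<omega>. \<bar>B t \<omega> - B 0 \<omega>\<bar> ^ p)" for p
    using B_zero by (intro integrable_cong_AE) (auto elim: eventually_mono)
  then show ?thesis using increment_all_moments[of 0 t] assms by (simp add: all_moments_def)
qed

lemma increment_variance:
  assumes "0 \<le> s" "s \<le> t" "t \<le> T"
  shows "expectation (\<lambda>\<omega>. B t \<omega> - B s \<omega>) = 0" "expectation (\<lambda>\<omega>. (B t \<omega> - B s \<omega>)\<^sup>2) = t - s"
proof -
  have "expectation (\<lambda>\<omega>. B t \<omega> - B s \<omega>) = 0 \<and> expectation (\<lambda>\<omega>. (B t \<omega> - B s \<omega>)\<^sup>2) = t - s"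
  proof (cases "s = t")
    case False
    then have D: "distributed M lborel (\<lambda>\<omega>. B t \<omega> - B s \<omega>) (normal_density 0 (sqrt (t - s)))"
      and pos: "sqrt (t - s) > 0"
      using assms by (auto intro: increment_distributed)
    have 0: "expectation (\<lambda>\<omega>. B t \<omega> - B s \<omega>) = 0" by (rule normal_distributed_expectation[OF pos D])
    have "variance (\<lambda>\<omega>. B t \<omega> - B s \<omega>) = (sqrt (t - s))\<^sup>2" by (rule normal_distributed_variance[OF pos D])
    with 0 assms show ?thesis by simp
  qed simp
  then show "expectation (\<lambda>\<omega>. B t \<omega> - B s \<omega>) = 0" "expectation (\<lambda>\<omega>. (B t \<omega> - B s \<omega>)\<^sup>2) = t - s" by auto
qed

lemma B_second_moment:
  assumes "t \<in> {0..T}"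
  shows "expectation (\<lambda>\<omega>. (B t \<omega>)\<^sup>2) = t"
proof -
  have [measurable]: "B t \<in> borel_measurable M" "B 0 \<in> borel_measurable M"
    using assms T_pos by (auto intro: B_measurable)
  have "expectation (\<lambda>\<omega>. (B t \<omega>)\<^sup>2) = expectation (\<lambda>\<omega>. (B t \<omega> - B 0 \<omega>)\<^sup>2)"
    using B_zero by (intro integral_cong_AE) (auto elim: eventually_mono)
  then show ?thesis using increment_variance[of 0 t] assms by simp
qed

text \<open>Dividing by the standard deviation \<sigma> reduces the claim to the standard normal
  characteristic function at r c \<sigma>.\<close>

lemma char_increment:
  assumes "0 \<le> s" "s < t" "t \<le> T"
  shows "char (distr M borel (\<lambda>\<omega>. c * (B t \<omega> - B s \<omega>))) r = of_real (exp (- ((r * c)\<^sup>2 * (t - s)) / 2))"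
proof -
  let ?X = "\<lambda>\<omega>. B t \<omega> - B s \<omega>"
  define \<sigma> where "\<sigma> = sqrt (t - s)"
  have \<sigma>: "\<sigma> > 0" "\<sigma>\<^sup>2 = t - s" using assms by (auto simp: \<sigma>_def)
  have [measurable]: "B t \<in> borel_measurable M" "B s \<in> borel_measurable M"
    using assms by (auto intro!: B_measurable)
  have "distributed M lborel (\<lambda>\<omega>. (?X \<omega> - 0) / \<sigma>) std_normal_density"
    using increment_distributed[OF assms] normal_standard_normal_convert[OF \<sigma>(1), of ?X 0]
    by (simp add: \<sigma>_def)
  then have "distr M lborel (\<lambda>\<omega>. ?X \<omega> / \<sigma>) = std_normal_distribution"
    by (simp add: distributed_def)
  moreover have "distr M lborel (\<lambda>\<omega>. ?X \<omega> / \<sigma>) = distr M borel (\<lambda>\<omega>. ?X \<omega> / \<sigma>)"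
    by (intro distr_cong) auto
  ultimately have *: "distr M borel (\<lambda>\<omega>. ?X \<omega> / \<sigma>) = std_normal_distribution" by simp
  have "char (distr M borel (\<lambda>\<omega>. c * ?X \<omega>)) r = (CLINT \<omega>|M. iexp (r * (c * ?X \<omega>)))"
    by (simp add: char_def integral_distr)
  also have "\<dots> = (CLINT \<omega>|M. iexp ((r * c * \<sigma>) * (?X \<omega> / \<sigma>)))"
  proof -
    have "r * (c * x) = (r * c * \<sigma>) * (x / \<sigma>)" for x using \<sigma>(1) by simp
    then show ?thesis by presburger
  qed
  also have "\<dots> = char (distr M borel (\<lambda>\<omega>. ?X \<omega> / \<sigma>)) (r * c * \<sigma>)"
    unfolding char_def by (rule integral_distr[symmetric]) measurable
  also have "\<dots> = of_real (exp (- ((r * c)\<^sup>2 * (t - s)) / 2))"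
    unfolding * char_std_normal_distribution \<sigma>(2)[symmetric] by (simp add: power_mult_distrib)
  finally show ?thesis .
qed

text \<open>Independence factorises the characteristic function of the weighted sum at 1.
  Multiplying by exp(i \<eta>) before taking the real part brings in the phase.\<close>

lemma integral_cos_grid:
  assumes "0 \<le> \<tau> 0" "strict_mono_on {..n} \<tau>" "\<tau> n \<le> T"
  shows "expectation (\<lambda>\<omega>. cos ((\<Sum>k<n. \<rho> k * (B (\<tau> (Suc k)) \<omega> - B (\<tau> k) \<omega>)) + \<eta>)) =
    exp (- (\<Sum>k<n. (\<rho> k)\<^sup>2 * (\<tau> (Suc k) - \<tau> k)) / 2) * cos \<eta>"
proof -
  let ?D = "\<lambda>k \<omega>. B (\<tau> (Suc k)) \<omega> - B (\<tau> k) \<omega>"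
  let ?X = "\<lambda>\<omega>. \<Sum>k<n. \<rho> k * ?D k \<omega>"
  have mono: "\<tau> i \<le> \<tau> j" if "i \<le> j" "j \<le> n" for i j
    using strict_mono_onD[OF assms(2), of i j] that by (cases "i = j") auto
  have range: "\<tau> i \<in> {0..T}" if "i \<le> n" for i using mono[of 0 i] mono[of i n] that assms by auto
  have less: "\<tau> k < \<tau> (Suc k)" if "k < n" for k
    using strict_mono_onD[OF assms(2), of k "Suc k"] that by auto
  have meas: "?D k \<in> borel_measurable M" if "k < n" for k
    using that by (intro borel_measurable_diff B_measurable range) auto
  then have measX [measurable]: "?X \<in> borel_measurable M"
    by (intro borel_measurable_sum borel_measurable_times) auto
  have measXc: "(\<lambda>\<omega>. complex_of_real (?X \<omega>)) \<in> borel_measurable M"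
    by (rule measurable_compose[OF measX]) measurable
  have "indep_vars (\<lambda>_. borel) (\<lambda>k \<omega>. \<rho> k * ?D k \<omega>) {..<n}"
    by (rule indep_vars_compose2[OF increments_indep[OF assms]]) simp
  from char_distr_sum[OF this, of 1]
  have "char (distr M borel ?X) 1 = (\<Prod>k<n. char (distr M borel (\<lambda>\<omega>. \<rho> k * ?D k \<omega>)) 1)" .
  also have "\<dots> = (\<Prod>k<n. of_real (exp (- ((\<rho> k)\<^sup>2 * (\<tau> (Suc k) - \<tau> k)) / 2)))"
    using range less by (intro prod.cong refl) (auto simp: char_increment)
  also have "\<dots> = of_real (exp (- (\<Sum>k<n. (\<rho> k)\<^sup>2 * (\<tau> (Suc k) - \<tau> k)) / 2))"
    by (simp add: exp_sum sum_divide_distrib flip: sum_negf of_real_prod)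
  finally have "(CLINT \<omega>|M. iexp (?X \<omega>)) = of_real (exp (- (\<Sum>k<n. (\<rho> k)\<^sup>2 * (\<tau> (Suc k) - \<tau> k)) / 2))"
    by (simp add: char_def integral_distr)
  then have "(CLINT \<omega>|M. iexp \<eta> * iexp (?X \<omega>)) =
      iexp \<eta> * of_real (exp (- (\<Sum>k<n. (\<rho> k)\<^sup>2 * (\<tau> (Suc k) - \<tau> k)) / 2))"
    by simp
  then have "Re (CLINT \<omega>|M. iexp \<eta> * iexp (?X \<omega>)) =
      Re (iexp \<eta> * of_real (exp (- (\<Sum>k<n. (\<rho> k)\<^sup>2 * (\<tau> (Suc k) - \<tau> k)) / 2)))"
    by (rule arg_cong)
  also have "Re (CLINT \<omega>|M. iexp \<eta> * iexp (?X \<omega>)) = (\<integral>\<omega>. Re (iexp \<eta> * iexp (?X \<omega>)) \<partial>M)"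
    by (rule integral_Re[symmetric])
      (intro integrable_mult_right integrable_iexp measXc Im_complex_of_real)
  also have "\<dots> = (\<integral>\<omega>. cos (?X \<omega> + \<eta>) \<partial>M)"
    by (intro Bochner_Integration.integral_cong refl) (simp add: Re_exp Im_exp cos_add mult.commute)
  also have "Re (iexp \<eta> * of_real (exp (- (\<Sum>k<n. (\<rho> k)\<^sup>2 * (\<tau> (Suc k) - \<tau> k)) / 2))) =
      exp (- (\<Sum>k<n. (\<rho> k)\<^sup>2 * (\<tau> (Suc k) - \<tau> k)) / 2) * cos \<eta>"
    by (simp add: Re_exp)
  finally show ?thesis .
qed

section \<open>Finite linear combinations of Brownian values\<close>

definition lin :: "real set \<Rightarrow> (real \<Rightarrow> real) \<Rightarrow> 'a \<Rightarrow> real" where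
  "lin S \<theta> \<omega> = (\<Sum>s\<in>S. \<theta> s * B s \<omega>)"

text \<open>The variance of \<open>lin S \<theta>\<close>; equivalently, the squared norm of the
  step function \<phi>, the sum of \<theta>_s 1_[0,s] over s in S, which represents it.\<close>

definition cov :: "real set \<Rightarrow> (real \<Rightarrow> real) \<Rightarrow> real" where
  "cov S \<theta> = (\<Sum>s\<in>S. \<Sum>r\<in>S. \<theta> s * \<theta> r * min s r)"

text \<open>The inner product of the representing step function with the indicator of ]a, b], for
  nonnegative times and a <= b.\<close>

definition ip :: "real set \<Rightarrow> (real \<Rightarrow> real) \<Rightarrow> real \<Rightarrow> real \<Rightarrow> real" where
  "ip S \<theta> a b = (\<Sum>s\<in>S. \<theta> s * (min s b - min s a))"

lemma lin_measurable: "S \<subseteq> {0..T} \<Longrightarrow> lin S \<theta> \<in> borel_measurable M"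
  unfolding lin_def by (intro borel_measurable_sum borel_measurable_times B_measurable) auto

lemma cov_scale: "cov S (\<lambda>s. l * \<theta> s) = l\<^sup>2 * cov S \<theta>"
  by (simp add: cov_def sum_distrib_left power2_eq_square mult_ac)

text \<open>Sorting the times, with 0 added, expresses \<open>lin\<close> through independent
  increments by Abel summation; the grid formula then applies, and its exponent is recognised as
  \<open>cov\<close>.\<close>

lemma integral_cos_lin:
  assumes "finite S" "S \<subseteq> {0..T}"
  shows "expectation (\<lambda>\<omega>. cos (lin S \<theta> \<omega> + \<eta>)) = exp (- cov S \<theta> / 2) * cos \<eta>"
proof -
  \<comment> \<open>Time 0 gives the grid a starting point at which \<open>B\<close> vanishes almost
    surely; \<open>\<theta>'\<close> is zero there unless 0 already belongs to
    \<open>S\<close>.\<close>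
  define S' where "S' = insert 0 S"
  define \<theta>' where "\<theta>' s = (if s \<in> S then \<theta> s else 0)" for s
  have S': "finite S'" "S' \<subseteq> {0..T}" "S \<subseteq> S'" using assms T_pos by (auto simp: S'_def)
  have lin': "lin S \<theta> \<omega> = (\<Sum>s\<in>S'. \<theta>' s * B s \<omega>)" for \<omega>
    unfolding lin_def by (rule sum.mono_neutral_cong_left) (use S' in \<open>auto simp: \<theta>'_def\<close>)
  have cov': "cov S \<theta> = (\<Sum>s\<in>S'. \<Sum>r\<in>S'. \<theta>' s * \<theta>' r * min s r)"
    unfolding cov_def
    by (rule sum.mono_neutral_cong_left; (intro ballI sum.mono_neutral_cong_left)?)
      (use S' in \<open>auto simp: \<theta>'_def\<close>)
  define xs where "xs = sorted_list_of_set S'"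
  define n where "n = length xs - 1"
  define \<tau> where "\<tau> k = xs ! k" for k
  have xs: "set xs = S'" "distinct xs" "sorted_wrt (<) xs"
    using S'(1) by (auto simp: xs_def)
  have len: "length xs = Suc n" using xs(1) by (cases xs) (auto simp: n_def S'_def)
  have smono: "strict_mono_on {..n} \<tau>"
    using sorted_wrt_nth_less[OF xs(3)] len by (intro strict_mono_onI) (auto simp: \<tau>_def)
  have bij: "bij_betw \<tau> {..n} S'"
    using bij_betw_nth[OF xs(2), of "{..n}" S'] xs(1) len unfolding \<tau>_def
    by (simp add: lessThan_Suc_atMost)
  then have inS': "\<tau> k \<in> S'" if "k \<le> n" for k using that by (auto simp: bij_betw_def)
  have mono: "\<tau> i \<le> \<tau> j" if "i \<le> j" "j \<le> n" for i j
    using strict_mono_onD[OF smono, of i j] that by (cases "i = j") auto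
  have "0 \<in> \<tau> ` {..n}" using bij by (auto simp: bij_betw_def S'_def)
  then obtain k where "k \<le> n" "\<tau> k = 0" by auto
  then have \<tau>0: "\<tau> 0 = 0" using mono[of 0 k] inS'[of 0] S'(2) by auto
  have \<tau>n: "\<tau> n \<le> T" using inS'[of n] S'(2) by auto
  \<comment> \<open>The increment over the j-th grid interval is part of the value at each later
    grid point, so its coefficient is the sum of theirs.\<close>
  define \<rho> where "\<rho> j = (\<Sum>k\<in>{..n}. \<theta>' (\<tau> k) * of_bool (j < k))" for j
  have rearr: "(\<Sum>k\<in>{..n}. \<theta>' (\<tau> k) * (\<Sum>j<n. x j * of_bool (j < k))) = (\<Sum>j<n. \<rho> j * x j)" for x :: "nat \<Rightarrow> real"
    unfolding \<rho>_def sum_distrib_left sum_distrib_right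
    by (subst sum.swap) (simp add: mult_ac)
  have tele: "(\<Sum>j<n. (g (\<tau> (Suc j)) - g (\<tau> j)) * of_bool (j < k)) = g (\<tau> k) - g (\<tau> 0)"
    if "k \<le> n" for g :: "real \<Rightarrow> real" and k
  proof -
    have "(\<Sum>j<n. (g (\<tau> (Suc j)) - g (\<tau> j)) * of_bool (j < k)) = (\<Sum>j<k. g (\<tau> (Suc j)) - g (\<tau> j))"
      by (rule sum.mono_neutral_cong_right) (use that in auto)
    also have "\<dots> = g (\<tau> k) - g (\<tau> 0)" by (rule sum_lessThan_telescope)
    finally show ?thesis .
  qed
  have "AE \<omega> in M. lin S \<theta> \<omega> = (\<Sum>j<n. \<rho> j * (B (\<tau> (Suc j)) \<omega> - B (\<tau> j) \<omega>))"
    using B_zero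
  proof eventually_elim
    case (elim \<omega>)
    have "lin S \<theta> \<omega> = (\<Sum>k\<in>{..n}. \<theta>' (\<tau> k) * B (\<tau> k) \<omega>)"
      unfolding lin' by (rule sum.reindex_bij_betw[OF bij, symmetric])
    also have "\<dots> = (\<Sum>k\<in>{..n}. \<theta>' (\<tau> k) * (\<Sum>j<n. (B (\<tau> (Suc j)) \<omega> - B (\<tau> j) \<omega>) * of_bool (j < k)))"
      using tele[of _ "\<lambda>t. B t \<omega>"] elim \<tau>0 by (intro sum.cong refl) auto
    also have "\<dots> = (\<Sum>j<n. \<rho> j * (B (\<tau> (Suc j)) \<omega> - B (\<tau> j) \<omega>))" by (rule rearr)
    finally show ?case .
  qed
  then have "expectation (\<lambda>\<omega>. cos (lin S \<theta> \<omega> + \<eta>)) =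
      expectation (\<lambda>\<omega>. cos ((\<Sum>j<n. \<rho> j * (B (\<tau> (Suc j)) \<omega> - B (\<tau> j) \<omega>)) + \<eta>))"
  proof (intro integral_cong_AE)
    have [measurable]: "lin S \<theta> \<in> borel_measurable M" by (rule lin_measurable[OF assms(2)])
    have "B (\<tau> k) \<in> borel_measurable M" if "k \<le> n" for k
      using inS'[OF that] S'(2) by (intro B_measurable) auto
    then have [measurable]: "(\<lambda>\<omega>. \<Sum>j<n. \<rho> j * (B (\<tau> (Suc j)) \<omega> - B (\<tau> j) \<omega>)) \<in> borel_measurable M"
      by (intro borel_measurable_sum borel_measurable_times borel_measurable_diff) auto
    show "(\<lambda>\<omega>. cos (lin S \<theta> \<omega> + \<eta>)) \<in> borel_measurable M" by measurable
    show "(\<lambda>\<omega>. cos ((\<Sum>j<n. \<rho> j * (B (\<tau> (Suc j)) \<omega> - B (\<tau> j) \<omega>)) + \<eta>)) \<in> borel_measurable M"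
      by measurable
  qed (auto elim!: eventually_mono)
  also have "\<dots> = exp (- (\<Sum>j<n. (\<rho> j)\<^sup>2 * (\<tau> (Suc j) - \<tau> j)) / 2) * cos \<eta>"
    using \<tau>0 smono \<tau>n by (intro integral_cos_grid) auto
  also have "(\<Sum>j<n. (\<rho> j)\<^sup>2 * (\<tau> (Suc j) - \<tau> j)) = cov S \<theta>"
  proof -
    \<comment> \<open>The steps before both \<open>k\<close> and \<open>l\<close> add up to the
      earlier of the two times; this turns the covariance into a diagonal form in the
      increments.\<close>
    have min: "(\<Sum>j<n. (\<tau> (Suc j) - \<tau> j) * of_bool (j < k) * of_bool (j < l)) = min (\<tau> k) (\<tau> l)"
      if "k \<le> n" "l \<le> n" for k l
    proof -
      have "(\<Sum>j<n. (\<tau> (Suc j) - \<tau> j) * of_bool (j < k) * of_bool (j < l)) =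
          (\<Sum>j<n. (\<tau> (Suc j) - \<tau> j) * of_bool (j < min k l))"
        by (intro sum.cong refl) auto
      also have "\<dots> = \<tau> (min k l)" using tele[of "min k l" "\<lambda>t. t"] that \<tau>0 by simp
      also have "\<dots> = min (\<tau> k) (\<tau> l)" using mono[of k l] mono[of l k] that by (auto simp: min_def)
      finally show ?thesis .
    qed
    have "cov S \<theta> = (\<Sum>k\<in>{..n}. \<Sum>l\<in>{..n}. \<theta>' (\<tau> k) * \<theta>' (\<tau> l) * min (\<tau> k) (\<tau> l))"
      unfolding cov' by (simp add: sum.reindex_bij_betw[OF bij, symmetric])
    also have "\<dots> = (\<Sum>k\<in>{..n}. \<Sum>l\<in>{..n}. \<theta>' (\<tau> k) * \<theta>' (\<tau> l) *
        (\<Sum>j<n. (\<tau> (Suc j) - \<tau> j) * of_bool (j < k) * of_bool (j < l)))"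
      by (intro sum.cong refl arg_cong2[where f = "(*)"] min[symmetric]) auto
    also have "\<dots> = (\<Sum>k\<in>{..n}. \<theta>' (\<tau> k) * (\<Sum>j<n. (\<tau> (Suc j) - \<tau> j) * of_bool (j < k) *
        (\<Sum>l\<in>{..n}. \<theta>' (\<tau> l) * of_bool (j < l))))"
      unfolding sum_distrib_left
      by (rule sum.cong[OF refl], subst sum.swap) (simp add: mult_ac)
    also have "\<dots> = (\<Sum>k\<in>{..n}. \<theta>' (\<tau> k) * (\<Sum>j<n. ((\<tau> (Suc j) - \<tau> j) * \<rho> j) * of_bool (j < k)))"
      unfolding \<rho>_def by (simp add: mult_ac)
    also have "\<dots> = (\<Sum>j<n. \<rho> j * ((\<tau> (Suc j) - \<tau> j) * \<rho> j))" by (rule rearr)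
    finally show ?thesis by (simp add: power2_eq_square mult_ac)
  qed
  finally show ?thesis .
qed


text \<open>The change of coefficients adds x times the indicator of ]a', b'] to the step function.
  That interval is disjoint from ]a, b], so the inner product does not see it.\<close>

lemma ip_shift:
  assumes "finite S" "a' \<in> S" "b' \<in> S" "a \<le> b" "a' \<le> b'" "b \<le> a' \<or> b' \<le> a"
  shows "ip S (\<lambda>s. \<theta> s + x * (indicat_real {b'} s - indicat_real {a'} s)) a b = ip S \<theta> a b"
proof -
  have "ip S (\<lambda>s. \<theta> s + x * (indicat_real {b'} s - indicat_real {a'} s)) a b =
    ip S \<theta> a b + x * ((\<Sum>s\<in>S. indicat_real {b'} s * (min s b - min s a)) -
      (\<Sum>s\<in>S. indicat_real {a'} s * (min s b - min s a)))"
    by (simp add: ip_def sum_distrib_left sum.distrib algebra_simps sum_subtractf)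
  also have "\<dots> = ip S \<theta> a b"
    unfolding sum_mult_indicator_singleton(2)[OF assms(1,2)] sum_mult_indicator_singleton(2)[OF assms(1,3)]
    using assms(4-6) by (auto simp: min_def)
  finally show ?thesis .
qed

lemma lin_shift:
  assumes "finite S" "a \<in> S" "b \<in> S"
  shows "lin S (\<lambda>s. \<theta> s + x * (indicat_real {b} s - indicat_real {a} s)) \<omega> =
    lin S \<theta> \<omega> + x * (B b \<omega> - B a \<omega>)"
proof -
  have "lin S (\<lambda>s. \<theta> s + x * (indicat_real {b} s - indicat_real {a} s)) \<omega> =
    lin S \<theta> \<omega> + x * ((\<Sum>s\<in>S. indicat_real {b} s * B s \<omega>) - (\<Sum>s\<in>S. indicat_real {a} s * B s \<omega>))"
    by (simp add: lin_def sum_distrib_left sum.distrib algebra_simps sum_subtractf)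
  then show ?thesis using assms by (simp only: sum_mult_indicator_singleton)
qed

lemma cov_add:
  "cov S (\<lambda>s. \<theta> s + x * \<delta> s) =
    cov S \<theta> + 2 * x * (\<Sum>s\<in>S. \<theta> s * (\<Sum>r\<in>S. \<delta> r * min s r)) + x\<^sup>2 * cov S \<delta>"
proof -
  have sym: "(\<Sum>s\<in>S. \<Sum>r\<in>S. \<delta> s * \<theta> r * min s r) = (\<Sum>s\<in>S. \<Sum>r\<in>S. \<theta> s * \<delta> r * min s r)"
    by (subst sum.swap) (simp add: mult_ac min.commute)
  have "cov S (\<lambda>s. \<theta> s + x * \<delta> s) = (\<Sum>s\<in>S. \<Sum>r\<in>S. \<theta> s * \<theta> r * min s r +
      x * (\<theta> s * \<delta> r * min s r) + x * (\<delta> s * \<theta> r * min s r) + x\<^sup>2 * (\<delta> s * \<delta> r * min s r))"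
    unfolding cov_def by (intro sum.cong refl) (simp add: algebra_simps power2_eq_square)
  also have "\<dots> = cov S \<theta> + x * (\<Sum>s\<in>S. \<Sum>r\<in>S. \<theta> s * \<delta> r * min s r) +
      x * (\<Sum>s\<in>S. \<Sum>r\<in>S. \<delta> s * \<theta> r * min s r) + x\<^sup>2 * cov S \<delta>"
    by (simp add: cov_def sum.distrib sum_distrib_left)
  finally show ?thesis unfolding sym by (simp add: sum_distrib_left mult.assoc)
qed

text \<open>This expands the squared norm of \<phi> + x 1_]a,b]: the cross term is an inner product
  \<open>ip\<close>, and the last term is the length of the interval.\<close>

lemma cov_shift:
  assumes "finite S" "a \<in> S" "b \<in> S" "a \<le> b"
  shows "cov S (\<lambda>s. \<theta> s + x * (indicat_real {b} s - indicat_real {a} s)) =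
    cov S \<theta> + 2 * x * ip S \<theta> a b + x\<^sup>2 * (b - a)"
proof -
  have inner: "(\<Sum>r\<in>S. (indicat_real {b} r - indicat_real {a} r) * g r) = g b - g a" for g
    using assms by (simp only: left_diff_distrib sum_subtractf sum_mult_indicator_singleton)
  have "cov S (\<lambda>s. indicat_real {b} s - indicat_real {a} s) =
      (\<Sum>s\<in>S. (indicat_real {b} s - indicat_real {a} s) *
        (\<Sum>r\<in>S. (indicat_real {b} r - indicat_real {a} r) * min s r))"
    by (simp add: cov_def sum_distrib_left mult.assoc)
  also have "\<dots> = b - a" unfolding inner using assms(4) by (simp add: min_def)
  finally show ?thesis unfolding cov_add inner by (simp add: ip_def)
qed

text \<open>
  Wick's formula against the characteristic functional, obtained by differentiating the latter in the
  direction of one increment at a time.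
\<close>

lemma integral_prod_increments_cos:
  assumes "finite S" "S \<subseteq> {0..T}" "finite J"
    and "\<And>j. j \<in> J \<Longrightarrow> a j \<in> S \<and> b j \<in> S \<and> a j \<le> b j"
    and "\<And>i j. i \<in> J \<Longrightarrow> j \<in> J \<Longrightarrow> i \<noteq> j \<Longrightarrow> b i \<le> a j \<or> b j \<le> a i"
  shows "expectation (\<lambda>\<omega>. (\<Prod>j\<in>J. B (b j) \<omega> - B (a j) \<omega>) * cos (lin S \<theta> \<omega> + \<eta>)) =
    (\<Prod>j\<in>J. ip S \<theta> (a j) (b j)) * exp (- cov S \<theta> / 2) * cos (\<eta> + real (card J) * (pi / 2))"
  using assms(3,4,5)
proof (induction J arbitrary: \<theta> \<eta> rule: finite_induct)
  case empty
  then show ?case using integral_cos_lin[OF assms(1,2)] by simp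
next
  case (insert k J)
  let ?P = "\<lambda>\<omega>. \<Prod>j\<in>J. B (b j) \<omega> - B (a j) \<omega>"
  let ?D = "\<lambda>\<omega>. B (b k) \<omega> - B (a k) \<omega>"
  \<comment> \<open>The direction of differentiation: \<open>x\<close> times the increment indexed
    by \<open>k\<close> is added to the linear functional.\<close>
  define \<theta>' where "\<theta>' x = (\<lambda>s. \<theta> s + x * (indicat_real {b k} s - indicat_real {a k} s))" for x
  \<comment> \<open>Differentiating the cosine advances its phase by pi / 2, so starting from \<eta>
    - pi / 2 the derivative carries the phase \<eta>.\<close>
  define \<zeta> where "\<zeta> = \<eta> - pi / 2"
  define K where "K = (\<Prod>j\<in>J. ip S \<theta> (a j) (b j)) * cos (\<zeta> + real (card J) * (pi / 2))"
  define F where "F x = expectation (\<lambda>\<omega>. ?P \<omega> * cos (lin S (\<theta>' x) \<omega> + \<zeta>))" for x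
  have ab: "a j \<in> S" "b j \<in> S" "a j \<le> b j" "0 \<le> a j" "b j \<le> T" if "j \<in> insert k J" for j
    using insert.prems(1)[OF that] assms(2) by auto
  \<comment> \<open>The induction hypothesis evaluates \<open>F\<close> in closed form. The
    intervals are disjoint, so the other inner products stay put and only the covariance depends on
    \<open>x\<close>.\<close>
  have F: "F x = K * exp (- (cov S \<theta> + 2 * x * ip S \<theta> (a k) (b k) + x\<^sup>2 * (b k - a k)) / 2)" for x
  proof -
    have "F x = (\<Prod>j\<in>J. ip S (\<theta>' x) (a j) (b j)) * exp (- cov S (\<theta>' x) / 2) * cos (\<zeta> + real (card J) * (pi / 2))"
      unfolding F_def by (rule insert.IH) (use insert.prems in auto)
    also have "(\<Prod>j\<in>J. ip S (\<theta>' x) (a j) (b j)) = (\<Prod>j\<in>J. ip S \<theta> (a j) (b j))"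
      unfolding \<theta>'_def
    proof (rule prod.cong[OF refl])
      fix j assume j: "j \<in> J"
      then have "j \<noteq> k" using insert.hyps by auto
      then have "b j \<le> a k \<or> b k \<le> a j" using insert.prems(2)[of j k] j by auto
      then show "ip S (\<lambda>s. \<theta> s + x * (indicat_real {b k} s - indicat_real {a k} s)) (a j) (b j) = ip S \<theta> (a j) (b j)"
        using ab[of j] ab[of k] j by (intro ip_shift[OF assms(1)]) auto
    qed
    also have "cov S (\<theta>' x) = cov S \<theta> + 2 * x * ip S \<theta> (a k) (b k) + x\<^sup>2 * (b k - a k)"
      unfolding \<theta>'_def using ab[of k] by (intro cov_shift[OF assms(1)]) auto
    finally show ?thesis by (simp add: K_def mult_ac)
  qed
  have mP: "all_moments M ?P" using ab by (intro all_moments_prod increment_all_moments) auto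
  have mD: "all_moments M ?D" using ab[of k] by (intro increment_all_moments) auto
  have mPD: "integrable M (\<lambda>\<omega>. ?P \<omega> * ?D \<omega>)" by (intro all_moments_integrable all_moments_mult mP mD)
  have [measurable]: "?P \<in> borel_measurable M" "?D \<in> borel_measurable M"
    using mP mD by (auto simp: all_moments_def)
  have [measurable]: "lin S \<xi> \<in> borel_measurable M" for \<xi> by (rule lin_measurable[OF assms(2)])
  have lin': "lin S (\<theta>' x) \<omega> = lin S \<theta> \<omega> + x * ?D \<omega>" for x \<omega>
    unfolding \<theta>'_def using ab[of k] by (intro lin_shift[OF assms(1)]) auto
  define x where "x n = inverse (real (Suc n))" for n
  have x: "x n > 0" "x \<longlonglongrightarrow> 0" for n
    unfolding x_def by (simp, rule LIMSEQ_inverse_real_of_nat)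
  have "(\<lambda>n. (F (0 + x n) - F 0) / x n) \<longlonglongrightarrow> K * (exp (- cov S \<theta> / 2) * (- ip S \<theta> (a k) (b k)))"
  proof -
    have "(F has_real_derivative K * (exp (- cov S \<theta> / 2) * (- ip S \<theta> (a k) (b k)))) (at 0)"
      unfolding F by (rule derivative_eq_intros refl | simp)+
    then have "(\<lambda>h. (F (0 + h) - F 0) / h) \<midarrow>0\<rightarrow> K * (exp (- cov S \<theta> / 2) * (- ip S \<theta> (a k) (b k)))"
      by (simp add: DERIV_def)
    moreover have "filterlim x (at 0) sequentially"
      using x by (intro filterlim_atI) (auto simp: less_imp_neq[symmetric])
    ultimately show ?thesis by (rule filterlim_compose)
  qed
  \<comment> \<open>The same derivative, taken under the expectation. The difference quotients are
    dominated because the cosine is 1-Lipschitz.\<close>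
  moreover have "(\<lambda>n. (F (0 + x n) - F 0) / x n) \<longlonglongrightarrow>
    expectation (\<lambda>\<omega>. ?P \<omega> * ?D \<omega> * - sin (lin S \<theta> \<omega> + \<zeta>))"
  proof -
    let ?f = "\<lambda>n \<omega>. ?P \<omega> * ((cos (lin S \<theta> \<omega> + x n * ?D \<omega> + \<zeta>) - cos (lin S \<theta> \<omega> + \<zeta>)) / x n)"
    have intc: "integrable M (\<lambda>\<omega>. ?P \<omega> * cos (lin S \<xi> \<omega> + \<zeta>))" for \<xi>
    proof (rule Bochner_Integration.integrable_bound[OF all_moments_integrable[OF mP]])
      show "AE \<omega> in M. norm (?P \<omega> * cos (lin S \<xi> \<omega> + \<zeta>)) \<le> norm (?P \<omega>)"
        by (intro AE_I2) (simp add: abs_mult mult_left_le)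
    qed measurable
    have alg: "(p * c - p * d) / y = p * ((c - d) / y)" for p c d y :: real
      by (simp add: right_diff_distrib)
    have "(F (0 + x n) - F 0) / x n = expectation (?f n)" for n
    proof -
      have 1: "F (0 + x n) - F 0 = expectation (\<lambda>\<omega>. ?P \<omega> * cos (lin S (\<theta>' (x n)) \<omega> + \<zeta>) - ?P \<omega> * cos (lin S (\<theta>' 0) \<omega> + \<zeta>))"
        unfolding F_def add_0 by (rule Bochner_Integration.integral_diff[OF intc intc, symmetric])
      have 2: "expectation (\<lambda>\<omega>. ?P \<omega> * cos (lin S (\<theta>' (x n)) \<omega> + \<zeta>) - ?P \<omega> * cos (lin S (\<theta>' 0) \<omega> + \<zeta>)) / x n =
          expectation (\<lambda>\<omega>. (?P \<omega> * cos (lin S (\<theta>' (x n)) \<omega> + \<zeta>) - ?P \<omega> * cos (lin S (\<theta>' 0) \<omega> + \<zeta>)) / x n)"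
        by (rule integral_divide_zero[symmetric])
      show ?thesis unfolding 1 2 by (simp only: alg lin' mult_zero_left add_0_right)
    qed
    moreover have "(\<lambda>n. expectation (?f n)) \<longlonglongrightarrow> expectation (\<lambda>\<omega>. ?P \<omega> * ?D \<omega> * - sin (lin S \<theta> \<omega> + \<zeta>))"
    proof (rule integral_dominated_convergence[where w = "\<lambda>\<omega>. \<bar>?P \<omega> * ?D \<omega>\<bar>"])
      show "AE \<omega> in M. (\<lambda>n. ?f n \<omega>) \<longlonglongrightarrow> ?P \<omega> * ?D \<omega> * - sin (lin S \<theta> \<omega> + \<zeta>)"
      proof (intro AE_I2)
        fix \<omega>
        have "((\<lambda>h. cos (lin S \<theta> \<omega> + h * ?D \<omega> + \<zeta>)) has_real_derivative ?D \<omega> * - sin (lin S \<theta> \<omega> + \<zeta>)) (at 0)"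
          by (rule derivative_eq_intros refl | simp)+
        then have "(\<lambda>h. (cos (lin S \<theta> \<omega> + h * ?D \<omega> + \<zeta>) - cos (lin S \<theta> \<omega> + \<zeta>)) / h) \<midarrow>0\<rightarrow> ?D \<omega> * - sin (lin S \<theta> \<omega> + \<zeta>)"
          by (simp add: DERIV_def)
        moreover have "filterlim x (at 0) sequentially"
          using x by (intro filterlim_atI) (auto simp: less_imp_neq[symmetric])
        ultimately have "(\<lambda>n. (cos (lin S \<theta> \<omega> + x n * ?D \<omega> + \<zeta>) - cos (lin S \<theta> \<omega> + \<zeta>)) / x n) \<longlonglongrightarrow> ?D \<omega> * - sin (lin S \<theta> \<omega> + \<zeta>)"
          by (rule filterlim_compose)
        from tendsto_mult_left[OF this, of "?P \<omega>"]
        show "(\<lambda>n. ?f n \<omega>) \<longlonglongrightarrow> ?P \<omega> * ?D \<omega> * - sin (lin S \<theta> \<omega> + \<zeta>)" by (simp add: mult.assoc)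
      qed
      show "AE \<omega> in M. norm (?f n \<omega>) \<le> \<bar>?P \<omega> * ?D \<omega>\<bar>" for n
      proof (intro AE_I2)
        fix \<omega>
        have "\<bar>cos (lin S \<theta> \<omega> + x n * ?D \<omega> + \<zeta>) - cos (lin S \<theta> \<omega> + \<zeta>)\<bar> \<le> x n * \<bar>?D \<omega>\<bar>"
          using abs_cos_diff_le[of "lin S \<theta> \<omega> + x n * ?D \<omega> + \<zeta>" "lin S \<theta> \<omega> + \<zeta>"] x(1)[of n]
          by (simp add: abs_mult)
        then have "\<bar>(cos (lin S \<theta> \<omega> + x n * ?D \<omega> + \<zeta>) - cos (lin S \<theta> \<omega> + \<zeta>)) / x n\<bar> \<le> \<bar>?D \<omega>\<bar>"
          using x(1)[of n] by (simp add: abs_divide pos_divide_le_eq mult.commute)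
        then show "norm (?f n \<omega>) \<le> \<bar>?P \<omega> * ?D \<omega>\<bar>"
          unfolding real_norm_def abs_mult by (rule mult_left_mono) simp
      qed
      show "integrable M (\<lambda>\<omega>. \<bar>?P \<omega> * ?D \<omega>\<bar>)" using mPD by simp
    qed measurable
    ultimately show ?thesis by presburger
  qed
  ultimately have eq: "expectation (\<lambda>\<omega>. ?P \<omega> * ?D \<omega> * - sin (lin S \<theta> \<omega> + \<zeta>)) =
      K * (exp (- cov S \<theta> / 2) * (- ip S \<theta> (a k) (b k)))"
    by (rule LIMSEQ_unique[symmetric])
  have "expectation (\<lambda>\<omega>. (\<Prod>j\<in>insert k J. B (b j) \<omega> - B (a j) \<omega>) * cos (lin S \<theta> \<omega> + \<eta>)) =
      expectation (\<lambda>\<omega>. ?P \<omega> * ?D \<omega> * - sin (lin S \<theta> \<omega> + \<zeta>))"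
  proof (intro Bochner_Integration.integral_cong refl)
    fix \<omega>
    have "lin S \<theta> \<omega> + \<eta> = (lin S \<theta> \<omega> + \<zeta>) + pi / 2" by (simp add: \<zeta>_def)
    then have "cos (lin S \<theta> \<omega> + \<eta>) = - sin (lin S \<theta> \<omega> + \<zeta>)" by (simp only: cos_add) simp
    then show "(\<Prod>j\<in>insert k J. B (b j) \<omega> - B (a j) \<omega>) * cos (lin S \<theta> \<omega> + \<eta>) = ?P \<omega> * ?D \<omega> * - sin (lin S \<theta> \<omega> + \<zeta>)"
      using insert.hyps by (simp add: mult_ac)
  qed
  also have "\<dots> = (\<Prod>j\<in>insert k J. ip S \<theta> (a j) (b j)) * exp (- cov S \<theta> / 2) * cos (\<eta> + real (card (insert k J)) * (pi / 2))"
  proof -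
    \<comment> \<open>One more factor moves the phase by pi / 2, and passing from \<zeta> to \<eta>
      moves it by another pi / 2; the resulting sign matches the one from differentiating the
      Gaussian factor.\<close>
    have "\<eta> + real (card (insert k J)) * (pi / 2) = (\<zeta> + real (card J) * (pi / 2)) + pi"
      using insert.hyps by (simp add: \<zeta>_def algebra_simps)
    then have "cos (\<eta> + real (card (insert k J)) * (pi / 2)) = - cos (\<zeta> + real (card J) * (pi / 2))"
      by (simp only: cos_periodic_pi)
    then show ?thesis unfolding eq K_def using insert.hyps by simp
  qed
  finally show ?case .
qed

end

section \<open>Signed densities with vanishing Fourier transform\<close>

text \<open>Split \<open>V\<close> into positive and negative parts. The hypothesis at r = 0 gives
  both the same mass \<open>m\<close>; divided by \<open>m\<close>, they are densities under which
  the two laws of \<open>X\<close> have the same characteristic function, and Levy's theorem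
  identifies these laws.\<close>

lemma (in prob_space) signed_density_uniqueness:
  fixes V X :: "'a \<Rightarrow> real"
  assumes V: "integrable M V" and X [measurable]: "X \<in> borel_measurable M"
    and cos: "\<And>r. expectation (\<lambda>\<omega>. V \<omega> * cos (r * X \<omega>)) = 0"
    and sin: "\<And>r. expectation (\<lambda>\<omega>. V \<omega> * sin (r * X \<omega>)) = 0"
    and A [measurable]: "A \<in> sets borel"
  shows "expectation (\<lambda>\<omega>. V \<omega> * indicator A (X \<omega>)) = 0"
proof -
  have [measurable]: "V \<in> borel_measurable M" using V by auto
  define P where "P \<omega> = max (V \<omega>) 0" for \<omega>
  define N where "N \<omega> = max (- V \<omega>) 0" for \<omega>
  have [measurable]: "P \<in> borel_measurable M" "N \<in> borel_measurable M"
    unfolding P_def N_def by measurable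
  have PN: "V \<omega> = P \<omega> - N \<omega>" "P \<omega> \<ge> 0" "N \<omega> \<ge> 0" for \<omega> by (auto simp: P_def N_def)
  have int: "integrable M P" "integrable M N"
    unfolding P_def N_def using V by auto
  define m where "m = expectation P"
  have mN: "expectation N = m"
    using cos[of 0] int by (simp add: PN(1) m_def)
  have intg: "integrable M (\<lambda>\<omega>. Q \<omega> * g (X \<omega>))"
    if "integrable M Q" "g \<in> borel_measurable borel" "\<And>x. \<bar>g x\<bar> \<le> 1" for Q and g :: "real \<Rightarrow> real"
  proof (rule Bochner_Integration.integrable_bound[OF that(1)])
    show "(\<lambda>\<omega>. Q \<omega> * g (X \<omega>)) \<in> borel_measurable M" using that by measurable
    show "AE \<omega> in M. norm (Q \<omega> * g (X \<omega>)) \<le> norm (Q \<omega>)"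
      using that(3) by (intro AE_I2) (simp add: abs_mult mult_left_le)
  qed
  have eq: "expectation (\<lambda>\<omega>. P \<omega> * g (X \<omega>)) = expectation (\<lambda>\<omega>. N \<omega> * g (X \<omega>))"
    if "expectation (\<lambda>\<omega>. V \<omega> * g (X \<omega>)) = 0" "g \<in> borel_measurable borel" "\<And>x. \<bar>g x\<bar> \<le> 1" for g :: "real \<Rightarrow> real"
    using that(1) intg[OF int(1) that(2,3)] intg[OF int(2) that(2,3)]
    by (simp add: PN(1) left_diff_distrib)
  show ?thesis
  \<comment> \<open>Without mass there is nothing to normalise, but then \<open>V\<close> vanishes
    almost everywhere.\<close>
  proof (cases "m = 0")
    case True
    have "AE \<omega> in M. P \<omega> = 0" "AE \<omega> in M. N \<omega> = 0"
      using integral_nonneg_eq_0_iff_AE[OF int(1)] integral_nonneg_eq_0_iff_AE[OF int(2)] mN True PN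
      by (auto simp: m_def)
    then have "AE \<omega> in M. V \<omega> * indicator A (X \<omega>) = 0" by eventually_elim (simp add: PN(1))
    then show ?thesis by (rule integral_eq_zero_AE)
  next
    case False
    moreover have "m \<ge> 0" using PN by (auto simp: m_def)
    ultimately have m: "m > 0" by simp
    define \<mu> where "\<mu> Q = distr (density M (\<lambda>\<omega>. ennreal (Q \<omega> / m))) borel X" for Q :: "'a \<Rightarrow> real"
    have char_\<mu>: "char (\<mu> Q) r = of_real (expectation (\<lambda>\<omega>. Q \<omega> * cos (r * X \<omega>)) / m) +
        \<i> * of_real (expectation (\<lambda>\<omega>. Q \<omega> * sin (r * X \<omega>)) / m)"
      if [measurable]: "Q \<in> borel_measurable M" and "\<And>\<omega>. Q \<omega> \<ge> 0" "integrable M Q" for Q r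
    proof -
      have "char (\<mu> Q) r = (CLINT \<omega>|density M (\<lambda>\<omega>. ennreal (Q \<omega> / m)). iexp (r * X \<omega>))"
        unfolding char_def \<mu>_def by (rule integral_distr) auto
      also have "\<dots> = (CLINT \<omega>|M. (Q \<omega> / m) *\<^sub>R iexp (r * X \<omega>))"
        using that m by (intro integral_density) auto
      also have "\<dots> = (CLINT \<omega>|M. of_real (Q \<omega> * cos (r * X \<omega>) / m) + \<i> * of_real (Q \<omega> * sin (r * X \<omega>) / m))"
        by (intro Bochner_Integration.integral_cong refl)
          (simp add: complex_eq_iff Re_exp Im_exp)
      also have "\<dots> = of_real (expectation (\<lambda>\<omega>. Q \<omega> * cos (r * X \<omega>)) / m) +
        \<i> * of_real (expectation (\<lambda>\<omega>. Q \<omega> * sin (r * X \<omega>)) / m)"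
      proof -
        have c: "integrable M (\<lambda>\<omega>. complex_of_real (Q \<omega> * cos (r * X \<omega>) / m))"
          using intg[OF that(3), of "\<lambda>x. cos (r * x)"] by (intro integrable_of_real integrable_divide) auto
        have s: "integrable M (\<lambda>\<omega>. \<i> * complex_of_real (Q \<omega> * sin (r * X \<omega>) / m))"
          using intg[OF that(3), of "\<lambda>x. sin (r * x)"]
          by (intro integrable_mult_right integrable_of_real integrable_divide) auto
        show ?thesis
          by (simp only: Bochner_Integration.integral_add[OF c s] integral_mult_right_zero
              integral_complex_of_real integral_divide_zero)
      qed
      finally show ?thesis .
    qed
    have real_dist: "real_distribution (\<mu> Q)"
      if [measurable]: "Q \<in> borel_measurable M" and "\<And>\<omega>. Q \<omega> \<ge> 0" "integrable M Q" "expectation Q = m" for Q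
    proof -
      have "(\<integral>\<^sup>+\<omega>. ennreal (Q \<omega> / m) \<partial>M) = ennreal (expectation (\<lambda>\<omega>. Q \<omega> / m))"
        using that m by (intro nn_integral_eq_integral) auto
      also have "\<dots> = 1" using that m by simp
      finally have "(\<integral>\<^sup>+\<omega>. ennreal (Q \<omega> / m) \<partial>M) = 1" .
      then have "prob_space (density M (\<lambda>\<omega>. ennreal (Q \<omega> / m)))"
        by (intro prob_spaceI) (simp add: emeasure_density cong: nn_integral_cong)
      then have "prob_space (\<mu> Q)" unfolding \<mu>_def by (rule prob_space.prob_space_distr) simp
      then show ?thesis unfolding real_distribution_def real_distribution_axioms_def by (simp add: \<mu>_def)
    qed
    have "\<mu> P = \<mu> N"
    proof (rule Levy_uniqueness)
      show "real_distribution (\<mu> P)" "real_distribution (\<mu> N)"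
        using int PN mN by (auto intro!: real_dist simp: m_def)
      show "char (\<mu> P) = char (\<mu> N)"
        using int PN by (simp add: fun_eq_iff char_\<mu> eq[OF cos] eq[OF sin])
    qed
    then have "measure (\<mu> P) A = measure (\<mu> N) A" by simp
    moreover have "measure (\<mu> Q) A = expectation (\<lambda>\<omega>. Q \<omega> * indicator A (X \<omega>)) / m"
      if [measurable]: "Q \<in> borel_measurable M" and "\<And>\<omega>. Q \<omega> \<ge> 0" "integrable M Q" for Q
    proof -
      have "measure (\<mu> Q) A = (\<integral>x. indicator A x \<partial>\<mu> Q)" by (simp add: \<mu>_def)
      also have "\<dots> = (\<integral>\<omega>. indicator A (X \<omega>) \<partial>density M (\<lambda>\<omega>. ennreal (Q \<omega> / m)))"
        unfolding \<mu>_def by (rule integral_distr) auto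
      also have "\<dots> = (\<integral>\<omega>. (Q \<omega> / m) *\<^sub>R indicator A (X \<omega>) \<partial>M)"
        using that m by (intro integral_density) auto
      finally show ?thesis by simp
    qed
    ultimately have "expectation (\<lambda>\<omega>. P \<omega> * indicator A (X \<omega>)) = expectation (\<lambda>\<omega>. N \<omega> * indicator A (X \<omega>))"
      using int PN m by simp
    moreover have "integrable M (\<lambda>\<omega>. P \<omega> * indicator A (X \<omega>))" "integrable M (\<lambda>\<omega>. N \<omega> * indicator A (X \<omega>))"
      using intg[OF int(1), of "indicator A"] intg[OF int(2), of "indicator A"] by (auto simp: indicator_def)
    ultimately show ?thesis by (simp add: PN(1) left_diff_distrib)
  qed
qed

text \<open>The sets over which \<open>W\<close> integrates to zero form a Dynkin class, so they
  exhaust the sigma-algebra. Testing {W < 0} shows W >= 0, and a nonnegative function of mean zero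
  vanishes almost everywhere.\<close>

lemma (in prob_space) AE_zero_if_integrals_zero:
  fixes W :: "'a \<Rightarrow> real"
  assumes W: "integrable M W" and G: "Int_stable G" "G \<subseteq> Pow (space M)" "sets M = sigma_sets (space M) G" "space M \<in> G"
    and zero: "\<And>A. A \<in> G \<Longrightarrow> expectation (\<lambda>\<omega>. W \<omega> * indicator A \<omega>) = 0"
  shows "AE \<omega> in M. W \<omega> = 0"
proof -
  have [measurable]: "W \<in> borel_measurable M" using W by auto
  have intW: "integrable M (\<lambda>\<omega>. W \<omega> * indicator A \<omega>)" if "A \<in> sets M" for A
    using integrable_mult_indicator[OF that W] by (simp add: mult.commute)
  have all: "expectation (\<lambda>\<omega>. W \<omega> * indicator A \<omega>) = 0" if "A \<in> sigma_sets (space M) G" for A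
    using G(1,2) that
  proof (induction rule: sigma_sets_induct_disjoint)
    case (compl A)
    have A: "A \<in> sets M" using compl.hyps G(3) by simp
    have "expectation (\<lambda>\<omega>. W \<omega> * indicator (space M - A) \<omega>) =
        expectation (\<lambda>\<omega>. W \<omega> * indicator (space M) \<omega> - W \<omega> * indicator A \<omega>)"
      by (intro Bochner_Integration.integral_cong refl) (auto simp: indicator_def)
    also have "\<dots> = 0"
      using zero[OF G(4)] compl.IH intW[OF A] intW[of "space M"] by simp
    finally show ?case .
  next
    case (union A)
    have A: "A i \<in> sets M" for i using union(2) G(3) by auto
    let ?U = "\<lambda>n. \<Union>i<n. A i"
    have "(\<lambda>n. expectation (\<lambda>\<omega>. W \<omega> * indicator (?U n) \<omega>)) \<longlonglongrightarrow> expectation (\<lambda>\<omega>. W \<omega> * indicator (\<Union>i. A i) \<omega>)"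
    proof (rule integral_dominated_convergence[where w = "\<lambda>\<omega>. \<bar>W \<omega>\<bar>"])
      show "AE \<omega> in M. (\<lambda>n. W \<omega> * indicator (?U n) \<omega>) \<longlonglongrightarrow> W \<omega> * indicator (\<Union>i. A i) \<omega>"
        by (intro AE_I2 tendsto_mult tendsto_const LIMSEQ_indicator_UN)
      show "AE \<omega> in M. norm (W \<omega> * indicator (?U n) \<omega>) \<le> \<bar>W \<omega>\<bar>" for n
        by (intro AE_I2) (auto simp: indicator_def)
    qed (use A W in auto)
    moreover have "expectation (\<lambda>\<omega>. W \<omega> * indicator (?U n) \<omega>) = 0" for n
    proof -
      have "W \<omega> * indicator (?U n) \<omega> = (\<Sum>i<n. W \<omega> * indicator (A i) \<omega>)" for \<omega>
        using union(1) by (subst indicator_UN_disjoint)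
          (auto simp: sum_distrib_left disjoint_family_on_def)
      then have "expectation (\<lambda>\<omega>. W \<omega> * indicator (?U n) \<omega>) = (\<Sum>i<n. expectation (\<lambda>\<omega>. W \<omega> * indicator (A i) \<omega>))"
        by (simp only: Bochner_Integration.integral_sum intW[OF A])
      then show ?thesis by (simp only: union(3) sum.neutral_const)
    qed
    ultimately show ?case by (simp add: LIMSEQ_const_iff)
  qed (use zero in auto)
  have "AE \<omega> in M. 0 \<le> W \<omega>"
  proof -
    have "expectation (\<lambda>\<omega>. W \<omega> * indicator {\<omega> \<in> space M. W \<omega> < 0} \<omega>) = 0"
      by (intro all) (simp flip: G(3))
    moreover have "expectation (\<lambda>\<omega>. - (W \<omega> * indicator {\<omega> \<in> space M. W \<omega> < 0} \<omega>)) =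
        - expectation (\<lambda>\<omega>. W \<omega> * indicator {\<omega> \<in> space M. W \<omega> < 0} \<omega>)" by simp
    moreover have "integrable M (\<lambda>\<omega>. - (W \<omega> * indicator {\<omega> \<in> space M. W \<omega> < 0} \<omega>))"
      by (intro Bochner_Integration.integrable_minus intW) measurable
    moreover have "AE \<omega> in M. 0 \<le> - (W \<omega> * indicator {\<omega> \<in> space M. W \<omega> < 0} \<omega>)"
      by (intro AE_I2) (auto simp: indicator_def)
    ultimately have "AE \<omega> in M. - (W \<omega> * indicator {\<omega> \<in> space M. W \<omega> < 0} \<omega>) = 0"
      by (simp only: integral_nonneg_eq_0_iff_AE[symmetric])
    then show ?thesis by (rule AE_mp) (auto intro!: AE_I2 simp: indicator_def split: if_splits)
  qed
  moreover have "expectation W = 0"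
    using zero[OF G(4)] by (simp cong: Bochner_Integration.integral_cong)
  ultimately show ?thesis using integral_nonneg_eq_0_iff_AE[OF W] by simp
qed

section \<open>Elementary multiple integrals\<close>

text \<open>Expand each product of block sums: a fine multi-index belongs to the coarse one obtained
  by dividing its entries by \<open>q\<close>.\<close>

lemma sum_PiE_refine:
  fixes x :: "nat \<Rightarrow> nat \<Rightarrow> real"
  assumes "q > 0"
  shows "(\<Sum>i \<in> {..<n} \<rightarrow>\<^sub>E {..<N}. c i * (\<Prod>j<n. \<Sum>l\<in>{i j * q..<Suc (i j) * q}. x j l)) =
    (\<Sum>i \<in> {..<n} \<rightarrow>\<^sub>E {..<N * q}. c (\<lambda>j\<in>{..<n}. i j div q) * (\<Prod>j<n. x j (i j)))"
proof -
  let ?S = "{..<n} \<rightarrow>\<^sub>E {..<N * q}" and ?T = "{..<n} \<rightarrow>\<^sub>E {..<N}"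
  let ?g = "\<lambda>i. \<lambda>j\<in>{..<n}. i j div q"
  have div_iff: "l div q = k \<longleftrightarrow> l \<in> {k * q..<Suc k * q}" for l k
  proof -
    have "l div q = k \<longleftrightarrow> k \<le> l div q \<and> l div q < Suc k" by auto
    then show ?thesis
      using assms by (simp only: less_eq_div_iff_mult_less_eq div_less_iff_less_mult atLeastLessThan_iff)
  qed
  \<comment> \<open>The fine indices over a coarse \<open>k\<close> form a product of blocks of
    length \<open>q\<close>, so the inner sum of products is a product of block sums.\<close>
  have fibre: "{i \<in> ?S. ?g i = k} = PiE {..<n} (\<lambda>j. {k j * q..<Suc (k j) * q})" if k: "k \<in> ?T" for k
  proof (intro set_eqI iffI)
    fix i assume "i \<in> {i \<in> ?S. ?g i = k}"
    then have i: "i \<in> ?S" and eq: "?g i = k" by auto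
    have "i j div q = k j" if "j < n" for j using fun_cong[OF eq, of j] that by simp
    then show "i \<in> PiE {..<n} (\<lambda>j. {k j * q..<Suc (k j) * q})"
      using i unfolding div_iff by (simp add: PiE_iff)
  next
    fix i assume i: "i \<in> PiE {..<n} (\<lambda>j. {k j * q..<Suc (k j) * q})"
    then have d: "i j div q = k j" if "j < n" for j unfolding div_iff using that by (auto simp: PiE_iff)
    then have "?g i = k" using k by (auto simp: fun_eq_iff PiE_iff extensional_def)
    moreover have "i j < N * q" if "j < n" for j
    proof -
      have "i j div q < N" using d[OF that] k that by auto
      then show ?thesis using assms by (simp add: div_less_iff_less_mult)
    qed
    ultimately show "i \<in> {i \<in> ?S. ?g i = k}" using i by (auto simp: PiE_iff)
  qed
  have "(\<Sum>i\<in>?S. c (?g i) * (\<Prod>j<n. x j (i j))) =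
      (\<Sum>k\<in>?T. \<Sum>i\<in>{i \<in> ?S. ?g i = k}. c (?g i) * (\<Prod>j<n. x j (i j)))"
  proof -
    have sub: "?g ` ?S \<subseteq> ?T"
    proof (intro image_subsetI restrict_PiE_iff[THEN iffD2] ballI)
      fix i j assume "i \<in> ?S" "j \<in> {..<n}"
      then have "i j < N * q" by auto
      then show "i j div q \<in> {..<N}" using assms by (simp add: div_less_iff_less_mult)
    qed
    have fin: "finite ?S" "finite ?T" by (intro finite_PiE; simp)+
    show ?thesis
      by (rule sum.group[OF fin sub, of "\<lambda>i. c (?g i) * (\<Prod>j<n. x j (i j))", symmetric])
  qed
  also have "\<dots> = (\<Sum>k\<in>?T. c k * (\<Sum>i\<in>{i \<in> ?S. ?g i = k}. \<Prod>j<n. x j (i j)))"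
    by (simp add: sum_distrib_left)
  also have "\<dots> = (\<Sum>k\<in>?T. c k * (\<Prod>j<n. \<Sum>l\<in>{k j * q..<Suc (k j) * q}. x j l))"
    by (intro sum.cong refl) (simp add: fibre prod_sum_PiE)
  finally show ?thesis by simp
qed

text \<open>A fine cell inherits the coefficient of the coarse cell containing it. The restriction
  makes the coarse index extensional.\<close>

definition refine :: "nat \<Rightarrow> nat \<Rightarrow> ((nat \<Rightarrow> nat) \<Rightarrow> real) \<Rightarrow> (nat \<Rightarrow> nat) \<Rightarrow> real" where
  "refine n q c i = c (\<lambda>j\<in>{..<n}. i j div q)"

lemma sum_block_telescope:
  fixes g :: "nat \<Rightarrow> real"
  shows "(\<Sum>l\<in>{k * q..<Suc k * q}. g (Suc l) - g l) = g (Suc k * q) - g (k * q)"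
  by (rule sum_Suc_diff') simp

lemma indicator_Ioc_diff: "a \<le> b \<Longrightarrow> indicat_real {a<..b} x = indicat_real {..b} x - indicat_real {..a} x" for x :: real
  by (auto simp: indicator_def)

text \<open>Uniform grids are used since any two of them have a common refinement of the same kind.\<close>

definition grid :: "real \<Rightarrow> nat \<Rightarrow> nat \<Rightarrow> real" where
  "grid T N k = T * real k / real N"

lemma grid_0 [simp]: "grid T N 0 = 0" by (simp add: grid_def)

lemma grid_end: "N > 0 \<Longrightarrow> grid T N N = T" by (simp add: grid_def)

lemma grid_refine: "q > 0 \<Longrightarrow> grid T (N * q) (k * q) = grid T N k"
  by (simp add: grid_def)

lemma grid_mono: "T > 0 \<Longrightarrow> k \<le> l \<Longrightarrow> grid T N k \<le> grid T N l"
  by (simp add: grid_def divide_right_mono mult_left_mono)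

lemma grid_strict_mono: "T > 0 \<Longrightarrow> N > 0 \<Longrightarrow> strict_mono_on A (grid T N)"
  by (intro strict_mono_onI) (simp add: grid_def divide_strict_right_mono)

lemma grid_step: "grid T N (Suc k) - grid T N k = T / N"
  by (simp add: grid_def field_simps flip: diff_divide_distrib add_divide_distrib)

lemma off_diagonal_grid_uniform:
  assumes "T > 0" "N > 0"
  shows "off_diagonal_grid T n N (grid T N) c \<longleftrightarrow> (\<forall>i \<in> {..<n} \<rightarrow>\<^sub>E {..<N}. \<not> inj_on i {..<n} \<longrightarrow> c i = 0)"
  using assms by (simp add: off_diagonal_grid_def grid_end grid_strict_mono)

text \<open>Each coarse interval is the disjoint union of \<open>q\<close> fine ones, so its
  indicator is the sum of theirs, by telescoping indicators of half-lines.\<close>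

lemma elem_kernel_refine:
  assumes "T > 0" "q > 0"
  shows "elem_kernel n N (grid T N) c s = elem_kernel n (N * q) (grid T (N * q)) (refine n q c) s"
proof -
  have *: "indicat_real {grid T N k<..grid T N (Suc k)} x =
      (\<Sum>l\<in>{k * q..<Suc k * q}. indicator {grid T (N * q) l<..grid T (N * q) (Suc l)} x)" for k x
    using sum_block_telescope[of "\<lambda>l. indicat_real {..grid T (N * q) l} x" k q] assms
    by (simp add: indicator_Ioc_diff grid_mono grid_refine del: mult_Suc)
  show ?thesis
    unfolding elem_kernel_def refine_def * using sum_PiE_refine[OF assms(2)] by simp
qed

lemma elem_ito_refine:
  assumes "q > 0"
  shows "elem_ito B n N (grid T N) c \<omega> = elem_ito B n (N * q) (grid T (N * q)) (refine n q c) \<omega>"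
proof -
  have *: "B (grid T N (Suc k)) \<omega> - B (grid T N k) \<omega> =
      (\<Sum>l\<in>{k * q..<Suc k * q}. B (grid T (N * q) (Suc l)) \<omega> - B (grid T (N * q) l) \<omega>)" for k
    using sum_block_telescope[of "\<lambda>l. B (grid T (N * q) l) \<omega>" k q] assms
    by (simp add: grid_refine del: mult_Suc)
  show ?thesis
    unfolding elem_ito_def refine_def * using sum_PiE_refine[OF assms] by simp
qed

text \<open>Equal fine indices have equal quotients, so a fine cell on the diagonal lies in a coarse
  one on the diagonal, whose coefficient is zero.\<close>

lemma off_diagonal_refine:
  assumes "T > 0" "N > 0" "q > 0" "off_diagonal_grid T n N (grid T N) c"
  shows "off_diagonal_grid T n (N * q) (grid T (N * q)) (refine n q c)"
proof -
  have "refine n q c i = 0" if i: "i \<in> {..<n} \<rightarrow>\<^sub>E {..<N * q}" "\<not> inj_on i {..<n}" for i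
  proof -
    have "(\<lambda>j\<in>{..<n}. i j div q) \<in> {..<n} \<rightarrow>\<^sub>E {..<N}"
      using i assms by (auto simp: PiE_iff div_less_iff_less_mult)
    moreover have "\<not> inj_on (\<lambda>j\<in>{..<n}. i j div q) {..<n}"
    proof -
      obtain a b where "a < n" "b < n" "i a = i b" "a \<noteq> b" using i(2) by (auto simp: inj_on_def)
      then show ?thesis
        unfolding inj_on_restrict_eq using inj_onD[of "\<lambda>j. i j div q" "{..<n}" a b] by auto
    qed
    ultimately show ?thesis
      using assms by (simp add: refine_def off_diagonal_grid_uniform)
  qed
  then show ?thesis using assms by (simp add: off_diagonal_grid_uniform)
qed

section \<open>Linearity and second moments of elementary kernels and integrals\<close>

lemma elem_kernel_lincomb:
  "elem_kernel n m \<tau> (\<lambda>i. a * c i + b * d i) s = a * elem_kernel n m \<tau> c s + b * elem_kernel n m \<tau> d s"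
  by (simp add: elem_kernel_def distrib_right sum.distrib sum_distrib_left mult.assoc)

lemma elem_ito_lincomb:
  "elem_ito B n m \<tau> (\<lambda>i. a * c i + b * d i) \<omega> = a * elem_ito B n m \<tau> c \<omega> + b * elem_ito B n m \<tau> d \<omega>"
  by (simp add: elem_ito_def distrib_right sum.distrib sum_distrib_left mult.assoc)

lemma off_diagonal_lincomb:
  "off_diagonal_grid T n m \<tau> c \<Longrightarrow> off_diagonal_grid T n m \<tau> d \<Longrightarrow>
    off_diagonal_grid T n m \<tau> (\<lambda>i. a * c i + b * d i)"
  by (simp add: off_diagonal_grid_def)

lemma off_diagonal_gridD:
  assumes "off_diagonal_grid T n m \<tau> c"
  shows "\<And>i j. i \<le> j \<Longrightarrow> j \<le> m \<Longrightarrow> \<tau> i \<le> \<tau> j" "\<And>i. i \<le> m \<Longrightarrow> \<tau> i \<in> {0..T}"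
proof -
  show mono: "\<tau> i \<le> \<tau> j" if "i \<le> j" "j \<le> m" for i j
    using assms strict_mono_onD[of "{..m}" \<tau> i j] that
    by (cases "i = j") (auto simp: off_diagonal_grid_def)
  show "\<tau> i \<in> {0..T}" if "i \<le> m" for i
    using mono[of 0 i] mono[of i m] that assms by (auto simp: off_diagonal_grid_def)
qed

text \<open>The half-open intervals of a grid are disjoint, so no other box contains
  \<open>s\<close> and a single summand survives.\<close>

lemma elem_kernel_eq_coeff:
  assumes "off_diagonal_grid T n m \<tau> c" "i \<in> {..<n} \<rightarrow>\<^sub>E {..<m}"
    and s: "\<And>j. j < n \<Longrightarrow> s j \<in> {\<tau> (i j)<..\<tau> (Suc (i j))}"
  shows "elem_kernel n m \<tau> c s = c i"
proof -
  note mono = off_diagonal_gridD(1)[OF assms(1)]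
  have "(\<Prod>j<n. indicat_real {\<tau> (k j)<..\<tau> (Suc (k j))} (s j)) = (if k = i then 1 else 0)"
    if k: "k \<in> {..<n} \<rightarrow>\<^sub>E {..<m}" for k
  proof (cases "k = i")
    case True
    then show ?thesis using s by (auto intro!: prod.neutral)
  next
    case False
    then obtain j where j: "k j \<noteq> i j" by (auto simp: fun_eq_iff)
    then have "j < n" using k assms(2) by (metis PiE_E lessThan_iff)
    then have lt: "k j < m" "i j < m" using k assms(2) by auto
    have "s j \<notin> {\<tau> (k j)<..\<tau> (Suc (k j))}"
    proof (cases "k j < i j")
      case True
      then show ?thesis using mono[of "Suc (k j)" "i j"] lt s[OF \<open>j < n\<close>] by auto
    next
      case False
      then show ?thesis using mono[of "Suc (i j)" "k j"] lt j s[OF \<open>j < n\<close>] by auto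
    qed
    then show ?thesis using False \<open>j < n\<close> by (auto intro!: prod_zero simp: indicator_def)
  qed
  then have "elem_kernel n m \<tau> c s = (\<Sum>k \<in> {..<n} \<rightarrow>\<^sub>E {..<m}. c k * (if k = i then 1 else 0))"
    unfolding elem_kernel_def by (intro sum.cong) auto
  also have "\<dots> = c i" using assms(2) by (simp add: finite_PiE if_distrib cong: if_cong)
  finally show ?thesis .
qed

text \<open>At most one box contains \<open>s\<close>, so the square has no cross terms.\<close>

lemma elem_kernel_square:
  assumes "off_diagonal_grid T n m \<tau> c"
  shows "(elem_kernel n m \<tau> c s)\<^sup>2 =
    (\<Sum>i \<in> {..<n} \<rightarrow>\<^sub>E {..<m}. (c i)\<^sup>2 * (\<Prod>j<n. indicator {\<tau> (i j)<..\<tau> (Suc (i j))} (s j)))"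
proof (cases "\<exists>i \<in> {..<n} \<rightarrow>\<^sub>E {..<m}. \<forall>j<n. s j \<in> {\<tau> (i j)<..\<tau> (Suc (i j))}")
  case True
  then obtain i where i: "i \<in> {..<n} \<rightarrow>\<^sub>E {..<m}" "\<And>j. j < n \<Longrightarrow> s j \<in> {\<tau> (i j)<..\<tau> (Suc (i j))}"
    by blast
  have off2: "off_diagonal_grid T n m \<tau> (\<lambda>i. (c i)\<^sup>2)"
    using assms by (simp add: off_diagonal_grid_def)
  show ?thesis
    using elem_kernel_eq_coeff[OF assms i] elem_kernel_eq_coeff[OF off2 i]
    by (simp add: elem_kernel_def)
next
  case False
  have 0: "(\<Prod>j<n. indicat_real {\<tau> (i j)<..\<tau> (Suc (i j))} (s j)) = 0" if "i \<in> {..<n} \<rightarrow>\<^sub>E {..<m}" for i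
    using False that by (intro prod_zero) (auto simp: indicator_def)
  have "(\<Sum>i \<in> {..<n} \<rightarrow>\<^sub>E {..<m}. d i * (\<Prod>j<n. indicat_real {\<tau> (i j)<..\<tau> (Suc (i j))} (s j))) = 0" for d
    by (intro sum.neutral ballI) (simp only: 0 mult_zero_right)
  then show ?thesis unfolding elem_kernel_def by simp
qed

text \<open>Two injections with the same range differ by a permutation of the domain. This count is
  the source of n! in the second moment of an n-fold integral.\<close>

lemma card_inj_on_same_range:
  assumes "finite A" "inj_on i A"
  shows "card {k \<in> A \<rightarrow>\<^sub>E C. inj_on k A \<and> k ` A = i ` A} \<le> fact (card A)"
proof -
  have "{k \<in> A \<rightarrow>\<^sub>E C. inj_on k A \<and> k ` A = i ` A} \<subseteq>
      (\<lambda>\<pi>. restrict (i \<circ> \<pi>) A) ` {\<pi>. \<pi> permutes A}"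
  proof safe
    fix k assume k: "k \<in> A \<rightarrow>\<^sub>E C" "inj_on k A" "k ` A = i ` A"
    define \<pi> where "\<pi> j = (if j \<in> A then inv_into A i (k j) else j)" for j
    have *: "\<pi> j \<in> A" "i (\<pi> j) = k j" if "j \<in> A" for j
    proof -
      have "k j \<in> i ` A" using k(3) that by auto
      then show "\<pi> j \<in> A" "i (\<pi> j) = k j" using that by (auto simp: \<pi>_def inv_into_into f_inv_into_f)
    qed
    have "inj_on \<pi> A" using * k(2) by (metis inj_on_def)
    moreover have "\<pi> ` A \<subseteq> A" using * by auto
    ultimately have "bij_betw \<pi> A A" using assms(1) by (metis bij_betw_def endo_inj_surj)
    then have "\<pi> permutes A" by (intro bij_imp_permutes) (auto simp: \<pi>_def)
    moreover have "k = restrict (i \<circ> \<pi>) A"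
      using * k(1) by (auto simp: fun_eq_iff PiE_iff extensional_def)
    ultimately show "k \<in> (\<lambda>\<pi>. restrict (i \<circ> \<pi>) A) ` {\<pi>. \<pi> permutes A}" by blast
  qed
  then have "card {k \<in> A \<rightarrow>\<^sub>E C. inj_on k A \<and> k ` A = i ` A} \<le> card ((\<lambda>\<pi>. restrict (i \<circ> \<pi>) A) ` {\<pi>. \<pi> permutes A})"
    by (intro card_mono finite_imageI finite_permutations assms(1))
  also have "\<dots> \<le> card {\<pi>. \<pi> permutes A}"
    by (intro card_image_le finite_permutations assms(1))
  finally show ?thesis using card_permutations[OF refl assms(1)] by simp
qed

context brownian begin

lemma elem_ito_all_moments:
  assumes "off_diagonal_grid T n m \<tau> c" "\<And>j. j \<in> J \<Longrightarrow> k j < m"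
  shows "all_moments M (\<lambda>\<omega>. \<Prod>j\<in>J. B (\<tau> (Suc (k j))) \<omega> - B (\<tau> (k j)) \<omega>)"
proof (intro all_moments_prod increment_all_moments)
  fix j assume "j \<in> J"
  then show "0 \<le> \<tau> (k j)" "\<tau> (k j) \<le> \<tau> (Suc (k j))" "\<tau> (Suc (k j)) \<le> T"
    using off_diagonal_gridD[OF assms(1)] assms(2)[of j] by (auto simp: Suc_le_eq)
qed

lemma elem_ito_Lp2:
  assumes "off_diagonal_grid T n m \<tau> c"
  shows "elem_ito B n m \<tau> c \<in> Lp M 2"
proof -
  have "(\<lambda>\<omega>. \<Sum>i \<in> {..<n} \<rightarrow>\<^sub>E {..<m}. c i * (\<Prod>j<n. B (\<tau> (Suc (i j))) \<omega> - B (\<tau> (i j)) \<omega>)) \<in> Lp M 2"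
    by (intro Lp2_sum Lp2_cmult all_moments_Lp elem_ito_all_moments[OF assms]) auto
  then show ?thesis unfolding elem_ito_def .
qed

text \<open>Independence factorises the expectation over the grid intervals. An increment occurring
  once has mean zero, so the product survives only if every increment present occurs twice, that is,
  if the two ranges agree.\<close>

lemma elem_ito_product_expectation:
  assumes off: "off_diagonal_grid T n m \<tau> c"
    and i: "i \<in> {..<n} \<rightarrow>\<^sub>E {..<m}" "inj_on i {..<n}" and k: "k \<in> {..<n} \<rightarrow>\<^sub>E {..<m}" "inj_on k {..<n}"
  shows "expectation (\<lambda>\<omega>. (\<Prod>j<n. B (\<tau> (Suc (i j))) \<omega> - B (\<tau> (i j)) \<omega>) * (\<Prod>j<n. B (\<tau> (Suc (k j))) \<omega> - B (\<tau> (k j)) \<omega>)) =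
    (if k ` {..<n} = i ` {..<n} then \<Prod>j<n. \<tau> (Suc (i j)) - \<tau> (i j) else 0)"
proof -
  define R where "R = i ` {..<n}"
  define Q where "Q = k ` {..<n}"
  have RQ: "R \<subseteq> {..<m}" "Q \<subseteq> {..<m}" "card R = n" "card Q = n"
    using i k by (auto simp: R_def Q_def card_image)
  \<comment> \<open>Each increment has exponent 0, 1 or 2, according to its membership in the two
    ranges.\<close>
  define e where "e l = (if l \<in> R then 1 else 0) + (if l \<in> Q then 1 else 0 :: nat)" for l
  let ?D = "\<lambda>l \<omega>. B (\<tau> (Suc l)) \<omega> - B (\<tau> l) \<omega>"
  have \<tau>: "0 \<le> \<tau> l" "\<tau> l \<le> \<tau> (Suc l)" "\<tau> (Suc l) \<le> T" if "l < m" for l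
    using off_diagonal_gridD[OF off] that by (auto simp: Suc_le_eq)
  have prodR: "(\<Prod>j<n. f (i j)) = (\<Prod>l<m. f l ^ (if l \<in> R then 1 else 0))" for f :: "nat \<Rightarrow> real"
  proof -
    have "(\<Prod>j<n. f (i j)) = (\<Prod>l\<in>R. f l)" unfolding R_def using i(2) by (simp add: prod.reindex)
    also have "\<dots> = (\<Prod>l<m. f l ^ (if l \<in> R then 1 else 0))"
      using RQ(1) by (intro prod.mono_neutral_cong_left) auto
    finally show ?thesis .
  qed
  have prodQ: "(\<Prod>j<n. f (k j)) = (\<Prod>l<m. f l ^ (if l \<in> Q then 1 else 0))" for f :: "nat \<Rightarrow> real"
  proof -
    have "(\<Prod>j<n. f (k j)) = (\<Prod>l\<in>Q. f l)" unfolding Q_def using k(2) by (simp add: prod.reindex)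
    also have "\<dots> = (\<Prod>l<m. f l ^ (if l \<in> Q then 1 else 0))"
      using RQ(2) by (intro prod.mono_neutral_cong_left) auto
    finally show ?thesis .
  qed
  have indep: "indep_vars (\<lambda>_. borel) (\<lambda>l \<omega>. ?D l \<omega> ^ e l) {..<m}"
    using off by (intro indep_vars_compose2[OF increments_indep]) (auto simp: off_diagonal_grid_def)
  have int: "integrable M (\<lambda>\<omega>. ?D l \<omega> ^ e l)" if "l < m" for l
  proof -
    have D: "all_moments M (?D l)" using \<tau>[OF that] by (rule increment_all_moments)
    then have "integrable M (\<lambda>\<omega>. \<bar>?D l \<omega>\<bar> ^ e l)" and [measurable]: "?D l \<in> borel_measurable M"
      by (auto simp: all_moments_def)
    then show ?thesis by (subst integrable_abs_iff[symmetric]) (auto simp: power_abs)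
  qed
  have "expectation (\<lambda>\<omega>. (\<Prod>j<n. ?D (i j) \<omega>) * (\<Prod>j<n. ?D (k j) \<omega>)) = expectation (\<lambda>\<omega>. \<Prod>l<m. ?D l \<omega> ^ e l)"
    by (intro Bochner_Integration.integral_cong refl)
      (simp only: prodR[of "\<lambda>l. ?D l _"] prodQ[of "\<lambda>l. ?D l _"] e_def power_add prod.distrib)
  also have "\<dots> = (\<Prod>l<m. expectation (\<lambda>\<omega>. ?D l \<omega> ^ e l))"
    using int by (intro indep_vars_lebesgue_integral indep) auto
  also have "\<dots> = (if Q = R then \<Prod>j<n. \<tau> (Suc (i j)) - \<tau> (i j) else 0)"
  proof (cases "Q = R")
    case True
    have "(\<Prod>l<m. expectation (\<lambda>\<omega>. ?D l \<omega> ^ e l)) = (\<Prod>l<m. (\<tau> (Suc l) - \<tau> l) ^ (if l \<in> R then 1 else 0))"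
      using \<tau> True by (intro prod.cong refl) (auto simp: e_def increment_variance prob_space simp flip: numeral_2_eq_2)
    then show ?thesis using True by (simp add: prodR[of "\<lambda>l. \<tau> (Suc l) - \<tau> l"])
  next
    case False
    \<comment> \<open>The ranges have the same cardinality, so if they differ, \<open>R\<close>
      contains an index missing from \<open>Q\<close>.\<close>
    have "\<not> R \<subseteq> Q" using False RQ card_seteq[of Q R] finite_subset[OF RQ(2)] by auto
    then obtain l where l: "l \<in> R" "l \<notin> Q" by auto
    then have "l < m" "expectation (\<lambda>\<omega>. ?D l \<omega> ^ e l) = 0"
      using RQ \<tau>[of l] by (auto simp: e_def increment_variance)
    then show ?thesis using False by (auto intro!: prod_zero)
  qed
  finally show ?thesis unfolding R_def Q_def .
qed

text \<open>An inequality, since the coefficients need not be symmetric: a mixed term for two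
  multi-indices with the same range is at most the mean of the two squares, and at most n!
  multi-indices share a range.\<close>

lemma elem_ito_square_le:
  assumes off: "off_diagonal_grid T n m \<tau> c"
  shows "expectation (\<lambda>\<omega>. (elem_ito B n m \<tau> c \<omega>)\<^sup>2) \<le>
    fact n * (\<Sum>i \<in> {..<n} \<rightarrow>\<^sub>E {..<m}. (c i)\<^sup>2 * (\<Prod>j<n. \<tau> (Suc (i j)) - \<tau> (i j)))"
proof -
  define I where "I = {i \<in> {..<n} \<rightarrow>\<^sub>E {..<m}. inj_on i {..<n}}"
  let ?D = "\<lambda>i \<omega>. \<Prod>j<n. B (\<tau> (Suc (i j))) \<omega> - B (\<tau> (i j)) \<omega>"
  let ?w = "\<lambda>i. \<Prod>j<n. \<tau> (Suc (i j)) - \<tau> (i j)"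
  let ?same = "\<lambda>i. {k \<in> I. k ` {..<n} = i ` {..<n}}"
  have fin: "finite I" by (simp add: I_def finite_PiE)
  have w: "?w i \<ge> 0" if "i \<in> I" for i
  proof (intro prod_nonneg ballI)
    fix j assume "j \<in> {..<n}"
    then have "i j < m" using that by (auto simp: I_def)
    then show "0 \<le> \<tau> (Suc (i j)) - \<tau> (i j)"
      using off_diagonal_gridD(1)[OF off, of "i j" "Suc (i j)"] by simp
  qed
  have ito: "elem_ito B n m \<tau> c \<omega> = (\<Sum>i\<in>I. c i * ?D i \<omega>)" for \<omega>
    unfolding elem_ito_def using off
    by (intro sum.mono_neutral_cong_right) (auto simp: I_def off_diagonal_grid_def finite_PiE)
  have int: "integrable M (\<lambda>\<omega>. ?D i \<omega> * ?D k \<omega>)" if "i \<in> I" "k \<in> I" for i k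
    using that by (intro all_moments_integrable all_moments_mult elem_ito_all_moments[OF off]) (auto simp: I_def)
  have same: "?w k = ?w i" if "i \<in> I" "k \<in> ?same i" for i k
  proof -
    have reindex: "?w l = (\<Prod>p\<in>l ` {..<n}. \<tau> (Suc p) - \<tau> p)" if "l \<in> I" for l
      using that by (simp add: prod.reindex I_def)
    show ?thesis using that reindex[of i] reindex[of k] by simp
  qed
  have card: "real (card (?same i)) \<le> fact n" if "i \<in> I" for i
  proof -
    have "?same i = {k \<in> {..<n} \<rightarrow>\<^sub>E {..<m}. inj_on k {..<n} \<and> k ` {..<n} = i ` {..<n}}" by (auto simp: I_def)
    then have "card (?same i) \<le> fact n"
      using card_inj_on_same_range[of "{..<n}" i "{..<m}"] that by (simp add: I_def)
    then show ?thesis by (metis of_nat_fact of_nat_le_iff)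
  qed
  have "expectation (\<lambda>\<omega>. (elem_ito B n m \<tau> c \<omega>)\<^sup>2) =
      expectation (\<lambda>\<omega>. \<Sum>i\<in>I. \<Sum>k\<in>I. c i * c k * (?D i \<omega> * ?D k \<omega>))"
    unfolding ito power2_eq_square sum_product by (simp only: mult_ac)
  also have "\<dots> = (\<Sum>i\<in>I. \<Sum>k\<in>I. c i * c k * expectation (\<lambda>\<omega>. ?D i \<omega> * ?D k \<omega>))"
    using int by (simp add: Bochner_Integration.integral_sum Bochner_Integration.integrable_sum)
  also have "\<dots> = (\<Sum>i\<in>I. \<Sum>k\<in>I. if k ` {..<n} = i ` {..<n} then c i * c k * ?w i else 0)"
    by (intro sum.cong refl) (simp add: elem_ito_product_expectation[OF off] I_def)
  also have "\<dots> = (\<Sum>i\<in>I. \<Sum>k\<in>?same i. c i * c k * ?w i)"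
    by (rule sum.cong[OF refl], rule sum.inter_filter[OF fin, symmetric])
  also have "\<dots> \<le> (\<Sum>i\<in>I. \<Sum>k\<in>?same i. ((c i)\<^sup>2 * ?w i + (c k)\<^sup>2 * ?w k) / 2)"
  proof (intro sum_mono)
    fix i k assume ik: "i \<in> I" "k \<in> ?same i"
    have "c i * c k \<le> ((c i)\<^sup>2 + (c k)\<^sup>2) / 2" using sum_squares_bound[of "c i" "c k"] by simp
    then have "c i * c k * ?w i \<le> ((c i)\<^sup>2 + (c k)\<^sup>2) / 2 * ?w i" using w[OF ik(1)] by (rule mult_right_mono)
    then show "c i * c k * ?w i \<le> ((c i)\<^sup>2 * ?w i + (c k)\<^sup>2 * ?w k) / 2"
      unfolding same[OF ik] by (simp add: distrib_right)
  qed
  also have "\<dots> = (\<Sum>i\<in>I. \<Sum>k\<in>?same i. (c i)\<^sup>2 * ?w i)"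
  proof -
    \<comment> \<open>Having the same range is a symmetric relation, so exchanging the summations
      turns the \<open>k\<close>-terms into the \<open>i\<close>-terms.\<close>
    have "(\<Sum>i\<in>I. \<Sum>k\<in>?same i. (c k)\<^sup>2 * ?w k) = (\<Sum>k\<in>I. \<Sum>i\<in>?same k. (c k)\<^sup>2 * ?w k)"
      using sum.swap_restrict[OF fin fin, of "\<lambda>i k. (c k)\<^sup>2 * ?w k" "\<lambda>i k. k ` {..<n} = i ` {..<n}"]
      by (simp add: eq_commute)
    then show ?thesis by (simp add: sum.distrib add_divide_distrib flip: sum_divide_distrib)
  qed
  also have "\<dots> = (\<Sum>i\<in>I. real (card (?same i)) * ((c i)\<^sup>2 * ?w i))" by simp
  also have "\<dots> \<le> (\<Sum>i\<in>I. fact n * ((c i)\<^sup>2 * ?w i))"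
    using card w by (intro sum_mono mult_right_mono) auto
  also have "\<dots> = fact n * (\<Sum>i \<in> {..<n} \<rightarrow>\<^sub>E {..<m}. (c i)\<^sup>2 * ?w i)"
    unfolding sum_distrib_left using off
    by (intro sum.mono_neutral_cong_left) (auto simp: I_def off_diagonal_grid_def finite_PiE)
  finally show ?thesis .
qed

end

section \<open>Density of elementary kernels\<close>

text \<open>The integrand that represents \<open>lin S \<theta>\<close>. On [0, T] the half-line up
  to \<open>r\<close> is the interval [0, r].\<close>

definition step_fun :: "real set \<Rightarrow> (real \<Rightarrow> real) \<Rightarrow> real \<Rightarrow> real" where
  "step_fun S \<theta> x = (\<Sum>r\<in>S. \<theta> r * indicator {..r} x)"

lemma step_fun_measurable [measurable]: "step_fun S \<theta> \<in> borel_measurable borel"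
  unfolding step_fun_def by measurable

lemma step_fun_bounded: "\<bar>step_fun S \<theta> x\<bar> \<le> (\<Sum>r\<in>S. \<bar>\<theta> r\<bar>)"
  unfolding step_fun_def
  by (rule order_trans[OF sum_abs]) (intro sum_mono, simp add: indicator_def)

text \<open>Membership in the L2 closure of the off-diagonal elementary kernels, stated as a
  property of one function so that an induction over sets can carry it.\<close>

definition approximable :: "real \<Rightarrow> nat \<Rightarrow> ((nat \<Rightarrow> real) \<Rightarrow> real) \<Rightarrow> bool" where
  "approximable T n h \<longleftrightarrow> h \<in> Lp (cube T n) 2 \<and>
    (\<forall>e>0. \<exists>N c. N > 0 \<and> off_diagonal_grid T n N (grid T N) c \<and>
      (\<integral>s. (elem_kernel n N (grid T N) c s - h s)\<^sup>2 \<partial>cube T n) < e)"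

context fixes T :: real assumes T_pos: "T > 0" begin

interpretation L: finite_measure "restrict_space lborel {0..T}"
  using T_pos by (intro finite_measureI) (simp add: emeasure_restrict_space space_restrict_space)

interpretation P: product_sigma_finite "\<lambda>_::nat. restrict_space lborel {0..T}"
  by unfold_locales

section \<open>Integration over the cube\<close>

lemma space_cube: "space (cube T n) = {..<n} \<rightarrow>\<^sub>E {0..T}"
  by (simp add: cube_def space_PiM space_restrict_space)

lemma space_cubeD:
  assumes "s \<in> space (cube T n)" "j < n"
  shows "0 \<le> s j" "s j \<le> T"
  using PiE_mem[OF assms(1)[unfolded space_cube], of j] assms(2) by auto

lemma emeasure_cube_box:
  assumes "\<And>j. j < n \<Longrightarrow> A j \<in> sets borel" "\<And>j. j < n \<Longrightarrow> A j \<subseteq> {0..T}"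
  shows "emeasure (cube T n) (Pi\<^sub>E {..<n} A) = (\<Prod>j<n. emeasure lborel (A j))"
proof -
  have "A j \<in> sets (restrict_space lborel {0..T})" if "j < n" for j
    using assms that by (auto simp: sets_restrict_space_iff)
  then show ?thesis
    unfolding cube_def using assms
    by (subst P.emeasure_PiM) (auto simp: emeasure_restrict_space intro!: prod.cong)
qed

lemma finite_measure_cube: "finite_measure (cube T n)"
proof
  show "emeasure (cube T n) (space (cube T n)) \<noteq> \<infinity>"
    unfolding space_cube using T_pos by (subst emeasure_cube_box) (auto simp: ennreal_power)
qed

interpretation cube: finite_measure "cube T n" for n by (rule finite_measure_cube)

lemma coord_measurable [measurable]: "j < n \<Longrightarrow> (\<lambda>s. s j) \<in> borel_measurable (cube T n)"
proof -
  assume "j < n"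
  then have "(\<lambda>s. s j) \<in> measurable (cube T n) (restrict_space lborel {0..T})"
    unfolding cube_def by (intro measurable_component_singleton) simp
  moreover have "(\<lambda>x. x) \<in> measurable (restrict_space lborel {0..T}) borel"
    by (intro measurable_restrict_space1) simp
  ultimately show ?thesis by (rule measurable_compose)
qed

lemma integral_cube_prod:
  fixes f :: "nat \<Rightarrow> real \<Rightarrow> real"
  assumes "\<And>j. j < n \<Longrightarrow> f j \<in> borel_measurable borel" "\<And>j x. j < n \<Longrightarrow> \<bar>f j x\<bar> \<le> C"
  shows "integrable (cube T n) (\<lambda>s. \<Prod>j<n. f j (s j))"
    "(\<integral>s. (\<Prod>j<n. f j (s j)) \<partial>cube T n) = (\<Prod>j<n. \<integral>x. f j x \<partial>restrict_space lborel {0..T})"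
proof -
  have int: "integrable (restrict_space lborel {0..T}) (f j)" if "j < n" for j
    using assms[OF that]
    by (intro L.integrable_const_bound[where B = C]) (auto intro!: measurable_restrict_space1 AE_I2)
  show "integrable (cube T n) (\<lambda>s. \<Prod>j<n. f j (s j))"
    unfolding cube_def using int by (intro P.product_integrable_prod) auto
  show "(\<integral>s. (\<Prod>j<n. f j (s j)) \<partial>cube T n) = (\<Prod>j<n. \<integral>x. f j x \<partial>restrict_space lborel {0..T})"
    unfolding cube_def using int by (intro P.product_integral_prod) auto
qed

lemma integral_Ioc:
  assumes "0 \<le> a" "a \<le> b" "b \<le> T"
  shows "(\<integral>x. indicator {a<..b} x \<partial>restrict_space lborel {0..T}) = b - a"
proof -
  have sub: "{a<..b} \<subseteq> {0..T}" using assms by auto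
  have "(\<integral>x. indicator {a<..b} x \<partial>restrict_space lborel {0..T}) =
      measure (restrict_space lborel {0..T}) ({a<..b} \<inter> space (restrict_space lborel {0..T}))"
    by (rule Bochner_Integration.integral_indicator)
  also have "{a<..b} \<inter> space (restrict_space lborel {0..T}) = {a<..b}"
    using sub by (auto simp: space_restrict_space)
  also have "measure (restrict_space lborel {0..T}) {a<..b} = measure lborel {a<..b}"
    using sub by (intro measure_restrict_space) auto
  finally show ?thesis using assms by simp
qed

text \<open>Inside ]a, b] the half-line up to \<open>r\<close> cuts out ]min r a, min r b]. The
  right-hand side is the formula that defines \<open>ip\<close>.\<close>

lemma integral_Ioc_step_fun:
  assumes "S \<subseteq> {0..T}" "0 \<le> a" "a \<le> b" "b \<le> T"
  shows "(\<integral>x. indicator {a<..b} x * step_fun S \<theta> x \<partial>restrict_space lborel {0..T}) =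
    (\<Sum>r\<in>S. \<theta> r * (min r b - min r a))"
proof -
  have "(\<integral>x. indicator {a<..b} x * step_fun S \<theta> x \<partial>restrict_space lborel {0..T}) =
      (\<integral>x. (\<Sum>r\<in>S. \<theta> r * indicator {min r a<..min r b} x) \<partial>restrict_space lborel {0..T})"
    unfolding step_fun_def sum_distrib_left
    by (intro Bochner_Integration.integral_cong sum.cong refl) (auto simp: indicator_def min_def)
  also have "\<dots> = (\<Sum>r\<in>S. \<integral>x. \<theta> r * indicator {min r a<..min r b} x \<partial>restrict_space lborel {0..T})"
    by (intro Bochner_Integration.integral_sum integrable_mult_right
        L.integrable_const_bound[where B = 1]) (auto intro!: measurable_restrict_space1 AE_I2 simp: indicator_def)
  also have "\<dots> = (\<Sum>r\<in>S. \<theta> r * (min r b - min r a))"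
  proof (intro sum.cong refl)
    fix r assume "r \<in> S"
    then have "0 \<le> min r a" "min r a \<le> min r b" "min r b \<le> T" using assms by auto
    from integral_Ioc[OF this]
    show "(\<integral>x. \<theta> r * indicator {min r a<..min r b} x \<partial>restrict_space lborel {0..T}) = \<theta> r * (min r b - min r a)"
      by simp
  qed
  finally show ?thesis .
qed

lemma elem_kernel_Lp2: "elem_kernel n m \<tau> c \<in> Lp (cube T n) 2"
proof (rule cube.Lp2_bounded)
  have [measurable]: "(\<lambda>s. \<Prod>j<n. indicat_real {\<tau> (i j)<..\<tau> (Suc (i j))} (s j)) \<in> borel_measurable (cube T n)" for i
    by (intro borel_measurable_prod measurable_compose[OF coord_measurable]) auto
  have "(\<lambda>s. \<Sum>i \<in> {..<n} \<rightarrow>\<^sub>E {..<m}. c i * (\<Prod>j<n. indicator {\<tau> (i j)<..\<tau> (Suc (i j))} (s j)))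
      \<in> borel_measurable (cube T n)"
    by (intro borel_measurable_sum) measurable
  then show "elem_kernel n m \<tau> c \<in> borel_measurable (cube T n)" by (simp add: elem_kernel_def[abs_def])
  show "\<bar>elem_kernel n m \<tau> c s\<bar> \<le> (\<Sum>i \<in> {..<n} \<rightarrow>\<^sub>E {..<m}. \<bar>c i\<bar>)" for s
    unfolding elem_kernel_def
  proof (rule order_trans[OF sum_abs], intro sum_mono)
    fix i
    have "\<bar>\<Prod>j<n. indicat_real {\<tau> (i j)<..\<tau> (Suc (i j))} (s j)\<bar> \<le> 1"
      unfolding abs_prod by (intro prod_le_1) (auto simp: indicator_def)
    then show "\<bar>c i * (\<Prod>j<n. indicator {\<tau> (i j)<..\<tau> (Suc (i j))} (s j))\<bar> \<le> \<bar>c i\<bar>"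
      by (simp add: abs_mult mult_left_le)
  qed
qed

text \<open>The right-hand side is the sum that bounds the second moment of the elementary integral,
  so E[I^2] <= n! |K|^2 for every off-diagonal elementary kernel K.\<close>

lemma integral_elem_kernel_square:
  assumes off: "off_diagonal_grid T n m \<tau> c"
  shows "(\<integral>s. (elem_kernel n m \<tau> c s)\<^sup>2 \<partial>cube T n) =
    (\<Sum>i \<in> {..<n} \<rightarrow>\<^sub>E {..<m}. (c i)\<^sup>2 * (\<Prod>j<n. \<tau> (Suc (i j)) - \<tau> (i j)))"
proof -
  have bound: "\<bar>indicat_real A x\<bar> \<le> 1" for A and x :: real by (simp add: indicator_def)
  have meas: "indicat_real {a<..b} \<in> borel_measurable borel" for a b :: real by simp
  have "(\<integral>s. (elem_kernel n m \<tau> c s)\<^sup>2 \<partial>cube T n) = (\<Sum>i \<in> {..<n} \<rightarrow>\<^sub>E {..<m}.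
      \<integral>s. (c i)\<^sup>2 * (\<Prod>j<n. indicator {\<tau> (i j)<..\<tau> (Suc (i j))} (s j)) \<partial>cube T n)"
    unfolding elem_kernel_square[OF off]
    by (intro Bochner_Integration.integral_sum integrable_mult_right integral_cube_prod(1)[OF meas bound])
  also have "\<dots> = (\<Sum>i \<in> {..<n} \<rightarrow>\<^sub>E {..<m}. (c i)\<^sup>2 * (\<Prod>j<n. \<tau> (Suc (i j)) - \<tau> (i j)))"
  proof (intro sum.cong refl)
    fix i assume i: "i \<in> {..<n} \<rightarrow>\<^sub>E {..<m}"
    have "(\<integral>s. (\<Prod>j<n. indicat_real {\<tau> (i j)<..\<tau> (Suc (i j))} (s j)) \<partial>cube T n) =
        (\<Prod>j<n. \<integral>x. indicat_real {\<tau> (i j)<..\<tau> (Suc (i j))} x \<partial>restrict_space lborel {0..T})"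
      by (rule integral_cube_prod(2)[OF meas bound])
    also have "\<dots> = (\<Prod>j<n. \<tau> (Suc (i j)) - \<tau> (i j))"
    proof (intro prod.cong refl integral_Ioc)
      fix j assume "j \<in> {..<n}"
      then have "i j < m" using i by auto
      then show "0 \<le> \<tau> (i j)" "\<tau> (i j) \<le> \<tau> (Suc (i j))" "\<tau> (Suc (i j)) \<le> T"
        using off_diagonal_gridD[OF off] by (auto simp: Suc_le_eq)
    qed
    finally show "(\<integral>s. (c i)\<^sup>2 * (\<Prod>j<n. indicator {\<tau> (i j)<..\<tau> (Suc (i j))} (s j)) \<partial>cube T n) =
        (c i)\<^sup>2 * (\<Prod>j<n. \<tau> (Suc (i j)) - \<tau> (i j))"
      by simp
  qed
  finally show ?thesis .
qed

text \<open>Fubini splits each box into one-dimensional integrals, each of them a value of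
  \<open>ip\<close>; this is the form in which Wick's formula delivers the transform.\<close>

lemma integral_elem_kernel_step_fun:
  assumes off: "off_diagonal_grid T n m \<tau> c" and S: "finite S" "S \<subseteq> {0..T}"
  shows "(\<integral>s. elem_kernel n m \<tau> c s * (\<Prod>j<n. step_fun S \<theta> (s j)) \<partial>cube T n) =
    (\<Sum>i \<in> {..<n} \<rightarrow>\<^sub>E {..<m}. c i * (\<Prod>j<n. \<Sum>r\<in>S. \<theta> r * (min r (\<tau> (Suc (i j))) - min r (\<tau> (i j)))))"
proof -
  define C where "C = (\<Sum>r\<in>S. \<bar>\<theta> r\<bar>)"
  have bound: "\<bar>indicat_real A x * step_fun S \<theta> x\<bar> \<le> C" for A x
    using step_fun_bounded[of S \<theta> x] by (auto simp: indicator_def C_def sum_nonneg)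
  have meas: "(\<lambda>x. indicat_real {a<..b} x * step_fun S \<theta> x) \<in> borel_measurable borel" for a b :: real
    by measurable
  have "(\<integral>s. elem_kernel n m \<tau> c s * (\<Prod>j<n. step_fun S \<theta> (s j)) \<partial>cube T n) =
      (\<integral>s. (\<Sum>i \<in> {..<n} \<rightarrow>\<^sub>E {..<m}. c i * (\<Prod>j<n. indicator {\<tau> (i j)<..\<tau> (Suc (i j))} (s j) * step_fun S \<theta> (s j))) \<partial>cube T n)"
    unfolding elem_kernel_def by (simp only: sum_distrib_right prod.distrib mult.assoc)
  also have "\<dots> = (\<Sum>i \<in> {..<n} \<rightarrow>\<^sub>E {..<m}.
      \<integral>s. c i * (\<Prod>j<n. indicator {\<tau> (i j)<..\<tau> (Suc (i j))} (s j) * step_fun S \<theta> (s j)) \<partial>cube T n)"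
    by (intro Bochner_Integration.integral_sum integrable_mult_right integral_cube_prod(1)[OF meas bound])
  also have "\<dots> = (\<Sum>i \<in> {..<n} \<rightarrow>\<^sub>E {..<m}. c i * (\<Prod>j<n. \<Sum>r\<in>S. \<theta> r * (min r (\<tau> (Suc (i j))) - min r (\<tau> (i j)))))"
  proof (intro sum.cong refl)
    fix i assume i: "i \<in> {..<n} \<rightarrow>\<^sub>E {..<m}"
    have "(\<integral>s. (\<Prod>j<n. indicat_real {\<tau> (i j)<..\<tau> (Suc (i j))} (s j) * step_fun S \<theta> (s j)) \<partial>cube T n) =
        (\<Prod>j<n. \<integral>x. indicat_real {\<tau> (i j)<..\<tau> (Suc (i j))} x * step_fun S \<theta> x \<partial>restrict_space lborel {0..T})"
      by (rule integral_cube_prod(2)[OF meas bound])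
    also have "\<dots> = (\<Prod>j<n. \<Sum>r\<in>S. \<theta> r * (min r (\<tau> (Suc (i j))) - min r (\<tau> (i j))))"
    proof (intro prod.cong refl integral_Ioc_step_fun S)
      fix j assume "j \<in> {..<n}"
      then have "i j < m" using i by auto
      then show "0 \<le> \<tau> (i j)" "\<tau> (i j) \<le> \<tau> (Suc (i j))" "\<tau> (Suc (i j)) \<le> T"
        using off_diagonal_gridD[OF off] by (auto simp: Suc_le_eq)
    qed
    finally show "(\<integral>s. c i * (\<Prod>j<n. indicator {\<tau> (i j)<..\<tau> (Suc (i j))} (s j) * step_fun S \<theta> (s j)) \<partial>cube T n) =
        c i * (\<Prod>j<n. \<Sum>r\<in>S. \<theta> r * (min r (\<tau> (Suc (i j))) - min r (\<tau> (i j))))"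
      by simp
  qed
  finally show ?thesis .
qed

section \<open>Null sets of the cube\<close>

lemma AE_cube_coord_neq:
  assumes "j < n"
  shows "AE s in cube T n. s j \<noteq> v"
proof -
  have "emeasure (cube T n) (\<Pi>\<^sub>E k\<in>{..<n}. if k = j then {v} \<inter> {0..T} else {0..T}) =
      (\<Prod>k<n. emeasure lborel (if k = j then {v} \<inter> {0..T} else {0..T}))"
    by (rule emeasure_cube_box) auto
  also have "\<dots> = 0"
  proof (rule prod_zero)
    have "emeasure lborel ({v} \<inter> {0..T}) = 0" by (cases "v \<in> {0..T}") auto
    then show "\<exists>k\<in>{..<n}. emeasure lborel (if k = j then {v} \<inter> {0..T} else {0..T}) = 0"
      using assms by (intro bexI[of _ j]) simp_all
  qed simp
  finally have "emeasure (cube T n) (\<Pi>\<^sub>E k\<in>{..<n}. if k = j then {v} \<inter> {0..T} else {0..T}) = 0" .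
  moreover have "(\<Pi>\<^sub>E k\<in>{..<n}. if k = j then {v} \<inter> {0..T} else {0..T}) = {s \<in> space (cube T n). \<not> s j \<noteq> v}"
  proof (intro set_eqI iffI)
    fix s assume s: "s \<in> (\<Pi>\<^sub>E k\<in>{..<n}. if k = j then {v} \<inter> {0..T} else {0..T})"
    have "s k \<in> {0..T}" if "k \<in> {..<n}" for k
      using PiE_mem[OF s that] by (cases "k = j") auto
    then have "s \<in> space (cube T n)"
      unfolding space_cube using PiE_arb[OF s] by (intro PiE_I) auto
    moreover have "s j = v" using PiE_mem[OF s, of j] assms by simp
    ultimately show "s \<in> {s \<in> space (cube T n). \<not> s j \<noteq> v}" by simp
  next
    fix s assume s: "s \<in> {s \<in> space (cube T n). \<not> s j \<noteq> v}"
    then have s: "s \<in> {..<n} \<rightarrow>\<^sub>E {0..T}" and v: "s j = v" by (auto simp: space_cube)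
    show "s \<in> (\<Pi>\<^sub>E k\<in>{..<n}. if k = j then {v} \<inter> {0..T} else {0..T})"
    proof (rule PiE_I)
      fix k assume "k \<in> {..<n}"
      from PiE_mem[OF s this] v show "s k \<in> (if k = j then {v} \<inter> {0..T} else {0..T})"
        by (cases "k = j") simp_all
    qed (rule PiE_arb[OF s])
  qed
  moreover have "{s \<in> space (cube T n). \<not> s j \<noteq> v} \<in> sets (cube T n)" using assms by measurable
  ultimately show ?thesis by (intro AE_I[where N = "{s \<in> space (cube T n). \<not> s j \<noteq> v}"]) auto
qed

lemma ex_grid_cell:
  assumes "N > 0" "0 < x" "x \<le> T"
  obtains k where "k < N" "x \<in> {grid T N k<..grid T N (Suc k)}"
proof -
  \<comment> \<open>Cells are open on the left and closed on the right, so the index is the ceiling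
    minus one; it is a natural number because x > 0.\<close>
  define k where "k = nat \<lceil>x * N / T\<rceil> - 1"
  have "x * N / T > 0" using assms T_pos by simp
  then have c: "\<lceil>x * N / T\<rceil> \<ge> 1" by simp
  then have Suc: "real (Suc k) = of_int \<lceil>x * N / T\<rceil>" by (simp add: k_def)
  have "x * N / T \<le> N" using assms T_pos by (simp add: field_simps)
  then have "\<lceil>x * N / T\<rceil> \<le> int N" by (simp add: ceiling_le_iff)
  then have "nat \<lceil>x * N / T\<rceil> \<le> N" "1 \<le> nat \<lceil>x * N / T\<rceil>" using c by linarith+
  then have "k < N" unfolding k_def by linarith
  moreover have "x * N / T \<le> real (Suc k)" "real k < x * N / T"
    using Suc by linarith+
  then have "x \<in> {grid T N k<..grid T N (Suc k)}"
    using assms T_pos by (auto simp: grid_def field_simps)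
  ultimately show ?thesis by (rule that)
qed

text \<open>Away from the hyperplane s_j = 0 the diagonal is covered by one square cell per grid
  interval. For N intervals the total measure of the cover is of order 1 / N.\<close>

lemma AE_cube_distinct:
  assumes jk: "j < n" "k < n" "j \<noteq> k"
  shows "AE s in cube T n. s j \<noteq> s k"
proof -
  define D where "D = {s \<in> space (cube T n). s j = s k}"
  have D [measurable]: "D \<in> sets (cube T n)" unfolding D_def using jk by measurable
  \<comment> \<open>The number of coordinates left free, each contributing a factor
    \<open>T\<close>.\<close>
  define d where "d = card ({..<n} \<inter> - {l. l = j \<or> l = k})"
  let ?f = "\<lambda>N p l x. if l = j \<or> l = k then indicat_real {grid T N p<..grid T N (Suc p)} x else 1"
  have bound: "\<bar>?f N p l x\<bar> \<le> 1" for N p l and x :: real by (simp add: indicator_def)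
  have meas: "?f N p l \<in> borel_measurable borel" for N p l by simp
  have le: "measure (cube T n) D \<le> T\<^sup>2 * T ^ d / real (Suc N)" for N
  proof -
    let ?N = "Suc N"
    have int1: "(\<integral>s. (\<Prod>l<n. ?f ?N p l (s l)) \<partial>cube T n) = (T / ?N)\<^sup>2 * T ^ d" if "p < ?N" for p
    proof -
      have "(\<integral>s. (\<Prod>l<n. ?f ?N p l (s l)) \<partial>cube T n) =
          (\<Prod>l<n. \<integral>x. ?f ?N p l x \<partial>restrict_space lborel {0..T})"
        by (rule integral_cube_prod(2)[OF meas bound])
      also have "\<dots> = (\<Prod>l<n. if l = j \<or> l = k then T / ?N else T)"
      proof (intro prod.cong refl)
        fix l
        have "(\<integral>x. indicat_real {grid T ?N p<..grid T ?N (Suc p)} x \<partial>restrict_space lborel {0..T}) = T / ?N"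
          using that T_pos grid_mono[of T 0 p ?N] grid_mono[of T p "Suc p" ?N] grid_mono[of T "Suc p" ?N ?N]
          by (subst integral_Ioc) (auto simp: grid_end grid_step)
        moreover have "measure (restrict_space lborel {0..T}) (space (restrict_space lborel {0..T})) = T"
          using T_pos by (simp add: space_restrict_space measure_restrict_space)
        ultimately show "(\<integral>x. ?f ?N p l x \<partial>restrict_space lborel {0..T}) = (if l = j \<or> l = k then T / ?N else T)"
          by simp
      qed
      also have "\<dots> = (T / ?N) ^ card ({..<n} \<inter> {l. l = j \<or> l = k}) * T ^ d"
        by (simp add: prod.If_cases d_def)
      also have "{..<n} \<inter> {l. l = j \<or> l = k} = {j, k}" using jk by auto
      finally show ?thesis using jk by (simp add: power2_eq_square)
    qed
    have "measure (cube T n) D = (\<integral>s. indicator D s \<partial>cube T n)" using sets.Int_space_eq2[OF D] by simp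
    also have "\<dots> \<le> (\<integral>s. (\<Sum>p<?N. \<Prod>l<n. ?f ?N p l (s l)) \<partial>cube T n)"
    proof (rule integral_mono_AE)
      show "integrable (cube T n) (indicat_real D)" by (rule cube.integrable_const_bound[where B = 1]) (auto simp: indicator_def)
      show "integrable (cube T n) (\<lambda>s. \<Sum>p<?N. \<Prod>l<n. ?f ?N p l (s l))"
        by (intro Bochner_Integration.integrable_sum integral_cube_prod(1)[OF meas bound])
      show "AE s in cube T n. indicator D s \<le> (\<Sum>p<?N. \<Prod>l<n. ?f ?N p l (s l))"
        using AE_cube_coord_neq[OF jk(1), of 0] AE_space
      proof eventually_elim
        case (elim s)
        have nonneg: "0 \<le> (\<Prod>l<n. ?f ?N p l (s l))" for p by (intro prod_nonneg) (simp add: indicator_def)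
        show ?case
        proof (cases "s \<in> D")
          case False
          then have "indicat_real D s = 0" by simp
          also have "0 \<le> (\<Sum>p<?N. \<Prod>l<n. ?f ?N p l (s l))" by (intro sum_nonneg nonneg)
          finally show ?thesis .
        next
          case True
          have "0 < s j" "s j \<le> T" using elim(1) space_cubeD[OF elim(2) jk(1)] by linarith+
          from ex_grid_cell[OF _ this, of ?N] obtain p where p: "p < ?N" "s j \<in> {grid T ?N p<..grid T ?N (Suc p)}" by blast
          have sk: "s k = s j" using True by (simp add: D_def)
          have one: "(\<Prod>l<n. ?f ?N p l (s l)) = 1"
          proof (rule prod.neutral, rule ballI)
            fix l
            show "?f ?N p l (s l) = 1" using p(2) sk by (cases "l = j"; cases "l = k") (simp_all add: indicator_def)
          qed
          have "indicat_real D s = (\<Prod>l<n. ?f ?N p l (s l))" unfolding one using True by simp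
          also have "\<dots> \<le> (\<Sum>p<?N. \<Prod>l<n. ?f ?N p l (s l))"
            using p(1) by (intro member_le_sum nonneg) auto
          finally show ?thesis .
        qed
      qed
    qed
    also have "\<dots> = (\<Sum>p<?N. \<integral>s. (\<Prod>l<n. ?f ?N p l (s l)) \<partial>cube T n)"
      by (intro Bochner_Integration.integral_sum integral_cube_prod(1)[OF meas bound])
    also have "\<dots> = (\<Sum>p<?N. (T / ?N)\<^sup>2 * T ^ d)" by (intro sum.cong refl int1) simp
    also have "\<dots> = T\<^sup>2 * T ^ d / ?N"
    proof -
      have "x * ((T / x)\<^sup>2 * y) = T\<^sup>2 * y / x" if "x > 0" for x y :: real
        using that by (simp add: power2_eq_square field_simps)
      from this[of "real ?N"] show ?thesis by (simp del: of_nat_Suc)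
    qed
    finally show ?thesis .
  qed
  have "(\<lambda>N. T\<^sup>2 * T ^ d / real (Suc N)) \<longlonglongrightarrow> 0"
    by (rule LIMSEQ_Suc[OF lim_const_over_n])
  then have "measure (cube T n) D \<le> 0" by (rule LIMSEQ_le_const) (use le in blast)
  then have "emeasure (cube T n) D = 0" by (simp add: cube.emeasure_eq_measure measure_le_0_iff)
  with D show ?thesis unfolding D_def by (intro AE_I[where N = "{s \<in> space (cube T n). s j = s k}"]) auto
qed


section \<open>L2 limits and closure properties of approximability\<close>

lemma tendsto_integral_square_bounded:
  fixes f :: "nat \<Rightarrow> (nat \<Rightarrow> real) \<Rightarrow> real"
  assumes meas: "\<And>k. f k \<in> borel_measurable (cube T n)" "g \<in> borel_measurable (cube T n)"
    and lim: "AE s in cube T n. (\<lambda>k. f k s) \<longlonglongrightarrow> g s"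
    and bound: "\<And>k. AE s in cube T n. \<bar>f k s - g s\<bar> \<le> w s" and w: "integrable (cube T n) (\<lambda>s. (w s)\<^sup>2)"
  shows "(\<lambda>k. \<integral>s. (f k s - g s)\<^sup>2 \<partial>cube T n) \<longlonglongrightarrow> 0"
proof -
  have "(\<lambda>k. \<integral>s. (f k s - g s)\<^sup>2 \<partial>cube T n) \<longlonglongrightarrow> (\<integral>s. 0 \<partial>cube T n)"
  proof (rule integral_dominated_convergence[where f = "\<lambda>_. 0" and s = "\<lambda>k s. (f k s - g s)\<^sup>2"])
    show "integrable (cube T n) (\<lambda>s. (w s)\<^sup>2)" by (rule w)
    show "AE s in cube T n. (\<lambda>k. (f k s - g s)\<^sup>2) \<longlonglongrightarrow> 0"
      using lim
    proof eventually_elim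
      case (elim s)
      from tendsto_power[OF tendsto_diff[OF elim tendsto_const], of "g s" 2] show ?case by simp
    qed
    show "AE s in cube T n. norm ((f k s - g s)\<^sup>2) \<le> (w s)\<^sup>2" for k
      using bound[of k]
    proof eventually_elim
      case (elim s)
      from power_mono[OF elim abs_ge_zero, of 2] show ?case by simp
    qed
  qed (use meas in measurable)
  then show ?thesis by simp
qed

lemma approximable_limit:
  assumes h: "h \<in> Lp (cube T n) 2"
    and ex: "\<And>e. e > 0 \<Longrightarrow> \<exists>h'. approximable T n h' \<and> (\<integral>s. (h' s - h s)\<^sup>2 \<partial>cube T n) < e"
  shows "approximable T n h"
  unfolding approximable_def
proof safe
  fix e :: real assume "e > 0"
  then have e4: "e / 4 > 0" by simp
  from ex[OF e4] obtain h' where h': "approximable T n h'" "(\<integral>s. (h' s - h s)\<^sup>2 \<partial>cube T n) < e / 4" by blast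
  from h'(1) e4 obtain N c where N: "N > 0" "off_diagonal_grid T n N (grid T N) c"
    and lt: "(\<integral>s. (elem_kernel n N (grid T N) c s - h' s)\<^sup>2 \<partial>cube T n) < e / 4"
    unfolding approximable_def by blast
  have "h' \<in> Lp (cube T n) 2" using h'(1) by (simp add: approximable_def)
  from integral_square_add_le[OF Lp2_diff[OF elem_kernel_Lp2 this] Lp2_diff[OF this h], of N "grid T N" c]
  have "(\<integral>s. (elem_kernel n N (grid T N) c s - h s)\<^sup>2 \<partial>cube T n) < e"
    using lt h'(2) by simp
  then show "\<exists>N c. 0 < N \<and> off_diagonal_grid T n N (grid T N) c \<and>
      (\<integral>s. (elem_kernel n N (grid T N) c s - h s)\<^sup>2 \<partial>cube T n) < e"
    using N by blast
qed (rule h)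

lemma approximable_lincomb:
  assumes h: "approximable T n h" and g: "approximable T n g"
  shows "approximable T n (\<lambda>s. a * h s + b * g s)"
  unfolding approximable_def
proof safe
  have hL: "h \<in> Lp (cube T n) 2" and gL: "g \<in> Lp (cube T n) 2" using h g by (auto simp: approximable_def)
  then show "(\<lambda>s. a * h s + b * g s) \<in> Lp (cube T n) 2" by (intro Lp2_add Lp2_cmult)
  fix e :: real assume "e > 0"
  have split: "\<exists>d>0. 2 * (x\<^sup>2 * d) < e / 2" for x :: real
  \<comment> \<open>The summand 1 makes the choice valid for a zero coefficient as well.\<close>
  proof (intro exI[of _ "e / (4 * (x\<^sup>2 + 1))"] conjI)
    have "x\<^sup>2 + 1 > 0" by (simp add: add_nonneg_pos)
    then show "0 < e / (4 * (x\<^sup>2 + 1))" "2 * (x\<^sup>2 * (e / (4 * (x\<^sup>2 + 1)))) < e / 2"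
      using \<open>e > 0\<close> by (auto simp: field_simps)
  qed
  obtain d where d: "d > 0" "2 * (a\<^sup>2 * d) < e / 2" using split by blast
  obtain d' where d': "d' > 0" "2 * (b\<^sup>2 * d') < e / 2" using split by blast
  from h d(1) obtain N c where N: "N > 0" "off_diagonal_grid T n N (grid T N) c"
    and lt: "(\<integral>s. (elem_kernel n N (grid T N) c s - h s)\<^sup>2 \<partial>cube T n) < d"
    unfolding approximable_def by blast
  from g d'(1) obtain N' c' where N': "N' > 0" "off_diagonal_grid T n N' (grid T N') c'"
    and lt': "(\<integral>s. (elem_kernel n N' (grid T N') c' s - g s)\<^sup>2 \<partial>cube T n) < d'"
    unfolding approximable_def by blast
  \<comment> \<open>The grid with N N' intervals refines both given grids, so the two kernels can be
    combined coefficientwise.\<close>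
  let ?N = "N * N'"
  let ?c = "\<lambda>i. a * refine n N' c i + b * refine n N c' i"
  have off: "off_diagonal_grid T n ?N (grid T ?N) ?c"
    using off_diagonal_refine[OF T_pos N(1) N'(1) N(2)] off_diagonal_refine[OF T_pos N'(1) N(1) N'(2)]
    by (intro off_diagonal_lincomb) (auto simp: mult.commute)
  have ker: "elem_kernel n ?N (grid T ?N) ?c s =
      a * elem_kernel n N (grid T N) c s + b * elem_kernel n N' (grid T N') c' s" for s
    unfolding elem_kernel_lincomb
    using elem_kernel_refine[OF T_pos N'(1), of n N c s] elem_kernel_refine[OF T_pos N(1), of n N' c' s]
    by (simp add: mult.commute)
  have "(\<integral>s. (elem_kernel n ?N (grid T ?N) ?c s - (a * h s + b * g s))\<^sup>2 \<partial>cube T n) =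
      (\<integral>s. (a * (elem_kernel n N (grid T N) c s - h s) + b * (elem_kernel n N' (grid T N') c' s - g s))\<^sup>2 \<partial>cube T n)"
    unfolding ker by (intro Bochner_Integration.integral_cong refl arg_cong[where f = "\<lambda>x. x\<^sup>2"]) (simp add: algebra_simps)
  also have "\<dots> \<le> 2 * (\<integral>s. (a * (elem_kernel n N (grid T N) c s - h s))\<^sup>2 \<partial>cube T n) +
      2 * (\<integral>s. (b * (elem_kernel n N' (grid T N') c' s - g s))\<^sup>2 \<partial>cube T n)"
    by (intro integral_square_add_le Lp2_cmult Lp2_diff elem_kernel_Lp2 hL gL)
  also have "\<dots> = 2 * (a\<^sup>2 * (\<integral>s. (elem_kernel n N (grid T N) c s - h s)\<^sup>2 \<partial>cube T n)) +
      2 * (b\<^sup>2 * (\<integral>s. (elem_kernel n N' (grid T N') c' s - g s)\<^sup>2 \<partial>cube T n))"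
    by (simp add: power_mult_distrib)
  also have "\<dots> \<le> 2 * (a\<^sup>2 * d) + 2 * (b\<^sup>2 * d')"
    using lt lt' by (intro add_mono mult_left_mono) auto
  also have "\<dots> < e" using d d' by simp
  finally show "\<exists>N c. 0 < N \<and> off_diagonal_grid T n N (grid T N) c \<and>
      (\<integral>s. (elem_kernel n N (grid T N) c s - (a * h s + b * g s))\<^sup>2 \<partial>cube T n) < e"
    using off N(1) N'(1) by (intro exI[of _ ?N] exI[of _ ?c]) simp
qed

lemma approximable_zero: "approximable T n (\<lambda>_. 0)"
  unfolding approximable_def
proof safe
  fix e :: real assume "e > 0"
  moreover have "elem_kernel n 1 (grid T 1) (\<lambda>_. 0) s = 0" for s by (simp add: elem_kernel_def)
  ultimately show "\<exists>N c. 0 < N \<and> off_diagonal_grid T n N (grid T N) c \<and>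
      (\<integral>s. (elem_kernel n N (grid T N) c s - 0)\<^sup>2 \<partial>cube T n) < e"
    using T_pos by (intro exI[of _ 1] exI[of _ "\<lambda>_. 0"]) (simp add: off_diagonal_grid_uniform)
qed (simp add: Lp2_iff)

lemma approximable_sum:
  "finite I \<Longrightarrow> (\<And>i. i \<in> I \<Longrightarrow> approximable T n (h i)) \<Longrightarrow> approximable T n (\<lambda>s. \<Sum>i\<in>I. a i * h i s)"
proof (induction I rule: finite_induct)
  case (insert i I)
  then show ?case using approximable_lincomb[of n "h i" "\<lambda>s. \<Sum>i\<in>I. a i * h i s" "a i" 1] by simp
qed (simp add: approximable_zero)

lemma approximable_cong:
  assumes "\<And>s. s \<in> space (cube T n) \<Longrightarrow> h s = g s" "approximable T n h"
  shows "approximable T n g"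
proof (rule approximable_limit)
  have h: "h \<in> Lp (cube T n) 2" using assms(2) by (simp add: approximable_def)
  then show "g \<in> Lp (cube T n) 2"
    using assms(1) measurable_cong[of "cube T n" h g borel]
      Bochner_Integration.integrable_cong[of "cube T n" "cube T n" "\<lambda>s. (h s)\<^sup>2" "\<lambda>s. (g s)\<^sup>2"]
    by (simp add: Lp2_iff)
  fix e :: real assume "e > 0"
  moreover have "(\<integral>s. (h s - g s)\<^sup>2 \<partial>cube T n) = (\<integral>s. 0 \<partial>cube T n)"
    using assms(1) by (intro Bochner_Integration.integral_cong) auto
  ultimately show "\<exists>h'. approximable T n h' \<and> (\<integral>s. (h' s - g s)\<^sup>2 \<partial>cube T n) < e"
    using assms(2) by auto
qed

section \<open>Lower boxes and the sigma-algebra of the cube\<close>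

definition lower_box :: "nat \<Rightarrow> (nat \<Rightarrow> real) \<Rightarrow> (nat \<Rightarrow> real) set" where
  "lower_box n b = {s \<in> space (cube T n). \<forall>j<n. s j \<le> b j}"

lemma lower_box_sets [measurable]: "lower_box n b \<in> sets (cube T n)"
  unfolding lower_box_def by measurable

lemma eventually_grid_fine:
  assumes "d > 0"
  shows "eventually (\<lambda>N. T / real (Suc N) < d) sequentially"
proof -
  have "(\<lambda>N. T / real (Suc N)) \<longlonglongrightarrow> 0" by (rule LIMSEQ_Suc[OF lim_const_over_n])
  from order_tendstoD(2)[OF this assms] show ?thesis .
qed

text \<open>Keep the off-diagonal grid cells lying below the corner \<open>b\<close>. A point with
  distinct coordinates, none on a face of the box, is classified correctly once the mesh is finer
  than its distances to diagonals and faces, so the kernels converge almost everywhere.\<close>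

lemma approximable_lower_box: "approximable T n (indicator (lower_box n b))"
proof -
  define c where "c N i = (if inj_on i {..<n} \<and> (\<forall>j<n. grid T N (Suc (i j)) \<le> b j) then 1 else 0 :: real)" for N i
  let ?f = "\<lambda>N. elem_kernel n (Suc N) (grid T (Suc N)) (c (Suc N))"
  have off: "off_diagonal_grid T n (Suc N) (grid T (Suc N)) (c (Suc N))" for N
    using T_pos by (simp add: off_diagonal_grid_uniform c_def)
  have distinct: "AE s in cube T n. \<forall>j\<in>{..<n}. \<forall>k\<in>{..<n}. j \<noteq> k \<longrightarrow> s j \<noteq> s k"
    by (intro AE_finite_allI AE_impI AE_cube_distinct) auto
  \<comment> \<open>A coordinate equal to 0 lies in no grid interval; this null set is discarded
    together with the faces.\<close>
  have neq: "AE s in cube T n. \<forall>j\<in>{..<n}. s j \<noteq> 0 \<and> s j \<noteq> b j"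
    by (intro AE_finite_allI AE_conjI AE_cube_coord_neq) auto
  have cell: "AE s in cube T n. \<forall>N. \<exists>i \<in> {..<n} \<rightarrow>\<^sub>E {..<Suc N}.
      \<forall>j<n. s j \<in> {grid T (Suc N) (i j)<..grid T (Suc N) (Suc (i j))}"
    using neq AE_space
  proof eventually_elim
    case (elim s)
    show ?case
    proof
      fix N
      have ex: "\<forall>j\<in>{..<n}. \<exists>k. k < Suc N \<and> s j \<in> {grid T (Suc N) k<..grid T (Suc N) (Suc k)}"
      proof
        fix j assume j: "j \<in> {..<n}"
        then have "s j \<noteq> 0" using elim(1) by blast
        then have "0 < s j" "s j \<le> T" using space_cubeD[OF elim(2), of j] j by auto
        from ex_grid_cell[OF _ this, of "Suc N"]
        show "\<exists>k. k < Suc N \<and> s j \<in> {grid T (Suc N) k<..grid T (Suc N) (Suc k)}" by blast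
      qed
      obtain i where i: "\<forall>j\<in>{..<n}. i j < Suc N \<and> s j \<in> {grid T (Suc N) (i j)<..grid T (Suc N) (Suc (i j))}"
        using bchoice[OF ex] by (rule exE)
      show "\<exists>i \<in> {..<n} \<rightarrow>\<^sub>E {..<Suc N}. \<forall>j<n. s j \<in> {grid T (Suc N) (i j)<..grid T (Suc N) (Suc (i j))}"
      proof (rule bexI[of _ "restrict i {..<n}"])
        show "restrict i {..<n} \<in> {..<n} \<rightarrow>\<^sub>E {..<Suc N}"
          unfolding restrict_PiE_iff using i by blast
        show "\<forall>j<n. s j \<in> {grid T (Suc N) (restrict i {..<n} j)<..grid T (Suc N) (Suc (restrict i {..<n} j))}"
        proof (intro allI impI)
          fix j assume "j < n"
          then have "restrict i {..<n} j = i j" "j \<in> {..<n}" by simp_all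
          then show "s j \<in> {grid T (Suc N) (restrict i {..<n} j)<..grid T (Suc N) (Suc (restrict i {..<n} j))}"
            using i by presburger
        qed
      qed
    qed
  qed
  have lim: "AE s in cube T n. (\<lambda>N. ?f N s) \<longlonglongrightarrow> indicator (lower_box n b) s"
    using distinct neq cell AE_space
  proof eventually_elim
    case (elim s)
    \<comment> \<open>Distances to the faces and between coordinates; the entry 1 keeps the set
      nonempty when n = 0.\<close>
    define D where "D = insert 1 ((\<lambda>j. \<bar>s j - b j\<bar>) ` {..<n} \<union> (\<lambda>(j, k). \<bar>s j - s k\<bar>) ` {(j, k). j < n \<and> k < n \<and> j \<noteq> k})"
    have "finite {(j, k). j < n \<and> k < n \<and> j \<noteq> k}"
      by (rule finite_subset[of _ "{..<n} \<times> {..<n}"]) auto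
    then have finD: "finite D" by (simp add: D_def)
    have "d > 0" if "d \<in> D" for d using that elim(1,2) by (auto simp: D_def)
    then have "Min D > 0" using finD by (subst Min_gr_iff) (auto simp: D_def)
    have "?f N s = indicator (lower_box n b) s" if fine: "T / real (Suc N) < Min D" for N
    proof -
      obtain i where i: "i \<in> {..<n} \<rightarrow>\<^sub>E {..<Suc N}"
        and s: "\<And>j. j < n \<Longrightarrow> s j \<in> {grid T (Suc N) (i j)<..grid T (Suc N) (Suc (i j))}"
        using elim(3) by blast
      have small: "T / real (Suc N) < d" if "d \<in> D" for d using fine Min_le[OF finD that] by linarith
      have "inj_on i {..<n}"
      proof (rule inj_onI, rule ccontr)
        fix j k assume jk: "j \<in> {..<n}" "k \<in> {..<n}" "i j = i k" "j \<noteq> k"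
        then have "\<bar>s j - s k\<bar> \<in> D" by (auto simp: D_def)
        from small[OF this] s[of j] s[of k] jk grid_step[of T "Suc N" "i j"] show False by auto
      qed
      moreover have "grid T (Suc N) (Suc (i j)) \<le> b j \<longleftrightarrow> s j \<le> b j" if "j < n" for j
      proof -
        have "\<bar>s j - b j\<bar> \<in> D" using that by (auto simp: D_def)
        from small[OF this] s[OF that] grid_step[of T "Suc N" "i j"] show ?thesis by auto
      qed
      ultimately have "c (Suc N) i = indicator (lower_box n b) s"
        using elim(4) by (auto simp: c_def lower_box_def indicator_def)
      then show ?thesis using elem_kernel_eq_coeff[OF off i s] by simp
    qed
    then show ?case
      by (intro tendsto_eventually eventually_mono[OF eventually_grid_fine[OF \<open>Min D > 0\<close>]]) auto
  qed
  have bound: "AE s in cube T n. \<bar>?f N s - indicator (lower_box n b) s\<bar> \<le> 2" for N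
    using cell
  proof eventually_elim
    case (elim s)
    obtain i where i: "i \<in> {..<n} \<rightarrow>\<^sub>E {..<Suc N}"
      and s: "\<And>j. j < n \<Longrightarrow> s j \<in> {grid T (Suc N) (i j)<..grid T (Suc N) (Suc (i j))}"
      using elim by blast
    have "?f N s = c (Suc N) i" by (rule elem_kernel_eq_coeff[OF off i s])
    then show ?case by (simp add: c_def indicator_def)
  qed
  have fL: "?f N \<in> Lp (cube T n) 2" for N by (rule elem_kernel_Lp2)
  have "(\<lambda>N. \<integral>s. (?f N s - indicator (lower_box n b) s)\<^sup>2 \<partial>cube T n) \<longlonglongrightarrow> 0"
    by (rule tendsto_integral_square_bounded[OF _ _ lim bound]) (use fL in \<open>auto simp: Lp2_iff\<close>)
  then have small: "\<exists>N. (\<integral>s. (?f N s - indicator (lower_box n b) s)\<^sup>2 \<partial>cube T n) < e" if "e > 0" for e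
    using order_tendstoD(2)[of _ 0 sequentially e] that eventually_happens'[OF sequentially_bot] by blast
  show ?thesis
    unfolding approximable_def
  proof safe
    show "indicat_real (lower_box n b) \<in> Lp (cube T n) 2"
      by (rule cube.Lp2_bounded[where C = 1]) (auto simp: indicator_def)
    fix e :: real assume "e > 0"
    then show "\<exists>N c. 0 < N \<and> off_diagonal_grid T n N (grid T N) c \<and>
        (\<integral>s. (elem_kernel n N (grid T N) c s - indicator (lower_box n b) s)\<^sup>2 \<partial>cube T n) < e"
      using small[of e] off by (meson zero_less_Suc)
  qed
qed

lemma lower_box_full: "lower_box n (\<lambda>_. T) = space (cube T n)"
  unfolding lower_box_def using space_cubeD(2) by blast

text \<open>A sublevel set of one coordinate is a lower box whose other corners are
  \<open>T\<close>, so the boxes make every coordinate measurable and thus generate the product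
  sigma-algebra.\<close>

lemma sets_cube_lower_box: "sets (cube T n) = sigma_sets (space (cube T n)) (range (lower_box n))"
proof
  let ?N = "sigma (space (cube T n)) (range (lower_box n))"
  have sub: "range (lower_box n) \<subseteq> Pow (space (cube T n))" by (auto simp: lower_box_def)
  have coord: "(\<lambda>s. s j) \<in> borel_measurable ?N" if "j < n" for j
  proof (rule borel_measurableI_le)
    fix a
    have "{s \<in> space ?N. s j \<le> a} = lower_box n (\<lambda>k. if k = j then a else T)"
    proof -
      have "space ?N = space (cube T n)" using sub by (simp add: space_measure_of)
      moreover have "s j \<le> a \<longleftrightarrow> (\<forall>i<n. s i \<le> (if i = j then a else T))" if s: "s \<in> space (cube T n)" for s
      proof
        assume "s j \<le> a"
        then show "\<forall>i<n. s i \<le> (if i = j then a else T)" using space_cubeD(2)[OF s] by simp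
      next
        assume "\<forall>i<n. s i \<le> (if i = j then a else T)"
        then show "s j \<le> a" using \<open>j < n\<close> by fastforce
      qed
      ultimately show ?thesis unfolding lower_box_def by blast
    qed
    then show "{s \<in> space ?N. s j \<le> a} \<in> sets ?N" using sub by (auto simp: sets_measure_of)
  qed
  have sp: "space ?N = space (cube T n)" using sub by (simp add: space_measure_of)
  let ?G = "{{f \<in> \<Pi>\<^sub>E i\<in>{..<n}. space (restrict_space lborel {0..T}). f i \<in> A} |i A.
        i \<in> {..<n} \<and> A \<in> sets (restrict_space lborel {0..T})}"
  have "sets (cube T n) = sigma_sets (space ?N) ?G"
    unfolding sp unfolding cube_def sets_PiM_single space_PiM ..
  also have "\<dots> \<subseteq> sets ?N"
  proof (rule sets.sigma_sets_subset)
    show "?G \<subseteq> sets ?N"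
    proof safe
      fix i A assume i: "i < n" and A: "A \<in> sets (restrict_space lborel {0..T})"
      then obtain A' where A': "A' \<in> sets borel" "A = {0..T} \<inter> A'" by (auto simp: sets_restrict_space)
      have "(\<lambda>s. s i) -` A' \<inter> space ?N \<in> sets ?N" using coord[OF i] A'(1) by (rule measurable_sets)
      moreover have "(\<lambda>s. s i) -` A' \<inter> space ?N = {f \<in> \<Pi>\<^sub>E i\<in>{..<n}. space (restrict_space lborel {0..T}). f i \<in> A}"
      proof -
        have "s i \<in> A' \<longleftrightarrow> s i \<in> A" if "s \<in> space (cube T n)" for s
          using space_cubeD[OF that i] A'(2) by simp
        then have "(\<lambda>s. s i) -` A' \<inter> space (cube T n) = {s \<in> space (cube T n). s i \<in> A}" by blast
        then show ?thesis unfolding sp by (simp add: space_cube space_restrict_space)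
      qed
      ultimately show "{f \<in> \<Pi>\<^sub>E i\<in>{..<n}. space (restrict_space lborel {0..T}). f i \<in> A} \<in> sets ?N" by simp
    qed
  qed
  also have "sets ?N = sigma_sets (space (cube T n)) (range (lower_box n))" using sub by (simp add: sets_measure_of)
  finally show "sets (cube T n) \<subseteq> sigma_sets (space (cube T n)) (range (lower_box n))" .
  show "sigma_sets (space (cube T n)) (range (lower_box n)) \<subseteq> sets (cube T n)"
    by (rule sets.sigma_sets_subset) auto
qed

text \<open>Dynkin induction from the intersection-stable lower boxes. Complements are differences
  from the full box; countable disjoint unions are L2 limits of finite ones.\<close>

lemma approximable_indicator:
  assumes "A \<in> sets (cube T n)"
  shows "approximable T n (indicator A)"
proof -
  have stable: "Int_stable (range (lower_box n))"
  proof (rule Int_stableI_image)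
    fix a b
    have "lower_box n a \<inter> lower_box n b = lower_box n (\<lambda>j. min (a j) (b j))"
      by (auto simp: lower_box_def)
    then show "\<exists>k\<in>UNIV. lower_box n a \<inter> lower_box n b = lower_box n k" by blast
  qed
  have sub: "range (lower_box n) \<subseteq> Pow (space (cube T n))" by (auto simp: lower_box_def)
  from stable sub assms[unfolded sets_cube_lower_box] show ?thesis
  proof (induction rule: sigma_sets_induct_disjoint)
    case (basic A)
    then show ?case by (auto simp: approximable_lower_box)
  next
    case empty
    then show ?case using approximable_zero by simp
  next
    case (compl A)
    have "approximable T n (\<lambda>s. 1 * indicator (lower_box n (\<lambda>_. T)) s + (-1) * indicator A s)"
      by (intro approximable_lincomb approximable_lower_box compl)
    then show ?case
      by (rule approximable_cong[rotated]) (auto simp: lower_box_full indicator_def)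
  next
    case (union A)
    have A [measurable]: "A i \<in> sets (cube T n)" for i using union(2) by (auto simp: sets_cube_lower_box)
    let ?f = "\<lambda>k s. \<Sum>i<k. 1 * indicat_real (A i) s"
    have f: "?f k s = indicator (\<Union>i<k. A i) s" for k s
      using union(1) by (subst indicator_UN_disjoint) (auto simp: disjoint_family_on_def)
    have "(\<lambda>k. \<integral>s. (?f k s - indicator (\<Union>i. A i) s)\<^sup>2 \<partial>cube T n) \<longlonglongrightarrow> 0"
    proof (rule tendsto_integral_square_bounded[where w = "\<lambda>_. 2"])
      show "AE s in cube T n. (\<lambda>k. ?f k s) \<longlonglongrightarrow> indicator (\<Union>i. A i) s"
        unfolding f by (intro AE_I2 LIMSEQ_indicator_UN)
      show "AE s in cube T n. \<bar>?f k s - indicator (\<Union>i. A i) s\<bar> \<le> 2" for k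
        unfolding f by (intro AE_I2) (simp add: indicator_def)
    qed auto
    then have small: "\<exists>k. (\<integral>s. (?f k s - indicator (\<Union>i. A i) s)\<^sup>2 \<partial>cube T n) < e" if "e > 0" for e
      using order_tendstoD(2)[of _ 0 sequentially e] that eventually_happens'[OF sequentially_bot] by blast
    show ?case
    proof (rule approximable_limit)
      show "indicat_real (\<Union>i. A i) \<in> Lp (cube T n) 2"
        by (rule cube.Lp2_bounded[where C = 1]) (auto simp: indicator_def)
      fix e :: real assume "e > 0"
      with small obtain k where "(\<integral>s. (?f k s - indicator (\<Union>i. A i) s)\<^sup>2 \<partial>cube T n) < e" by blast
      moreover have "approximable T n (?f k)" by (intro approximable_sum union) auto
      ultimately show "\<exists>h'. approximable T n h' \<and> (\<integral>s. (h' s - indicator (\<Union>i. A i) s)\<^sup>2 \<partial>cube T n) < e"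
        by blast
    qed
  qed
qed

lemma approximable_simple_function:
  fixes f :: "(nat \<Rightarrow> real) \<Rightarrow> real"
  assumes f: "simple_function (cube T n) f"
  shows "approximable T n f"
proof (rule approximable_cong)
  have fin: "finite (f ` space (cube T n))" using f by (simp add: simple_function_def)
  show "approximable T n (\<lambda>s. \<Sum>y\<in>f ` space (cube T n). y * indicator (f -` {y} \<inter> space (cube T n)) s)"
    using f by (intro approximable_sum[OF fin] approximable_indicator simple_functionD)
  show "(\<Sum>y\<in>f ` space (cube T n). y * indicator (f -` {y} \<inter> space (cube T n)) s) = f s"
    if "s \<in> space (cube T n)" for s
  proof -
    have "(\<Sum>y\<in>f ` space (cube T n). y * indicator (f -` {y} \<inter> space (cube T n)) s) =
        (\<Sum>y\<in>f ` space (cube T n). if y = f s then y else 0)"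
      using that by (intro sum.cong) (auto simp: indicator_def)
    also have "\<dots> = f s" using that fin by simp
    finally show ?thesis .
  qed
qed

text \<open>Simple functions bounded by 2 |h| converge pointwise to \<open>h\<close>, so dominated
  convergence with 3 |h| gives convergence in L2.\<close>

theorem approximable_Lp2:
  assumes h: "h \<in> Lp (cube T n) 2"
  shows "approximable T n h"
proof (rule approximable_limit[OF h])
  have [measurable]: "h \<in> borel_measurable (cube T n)" using h by (simp add: Lp2_iff)
  obtain F where F': "(\<forall>i. simple_function (cube T n) (F i)) \<and>
      (\<forall>s\<in>space (cube T n). (\<lambda>i. F i s) \<longlonglongrightarrow> h s) \<and>
      (\<forall>i. \<forall>s\<in>space (cube T n). dist (F i s) 0 \<le> 2 * dist (h s) 0)"
    using borel_measurable_implies_sequence_metric[of h "cube T n" 0, OF \<open>h \<in> borel_measurable (cube T n)\<close>]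
    by (rule exE)
  have F: "\<And>i. simple_function (cube T n) (F i)"
      "\<And>s. s \<in> space (cube T n) \<Longrightarrow> (\<lambda>i. F i s) \<longlonglongrightarrow> h s"
      "\<And>i s. s \<in> space (cube T n) \<Longrightarrow> dist (F i s) 0 \<le> 2 * dist (h s) 0"
    using F' by blast+
  have "(\<lambda>k. \<integral>s. (F k s - h s)\<^sup>2 \<partial>cube T n) \<longlonglongrightarrow> 0"
  proof (rule tendsto_integral_square_bounded[where w = "\<lambda>s. 3 * \<bar>h s\<bar>"])
    show "AE s in cube T n. (\<lambda>k. F k s) \<longlonglongrightarrow> h s" using F(2) by (rule AE_I2)
    have "\<bar>F k s - h s\<bar> \<le> 3 * \<bar>h s\<bar>" if "s \<in> space (cube T n)" for k s
      using F(3)[OF that, of k] by (simp add: dist_real_def)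
    then show "AE s in cube T n. \<bar>F k s - h s\<bar> \<le> 3 * \<bar>h s\<bar>" for k by (rule AE_I2)
    show "integrable (cube T n) (\<lambda>s. (3 * \<bar>h s\<bar>)\<^sup>2)" using h by (simp add: Lp2_iff power_mult_distrib)
  qed (use F(1) in \<open>auto intro: borel_measurable_simple_function\<close>)
  then show "\<exists>h'. approximable T n h' \<and> (\<integral>s. (h' s - h s)\<^sup>2 \<partial>cube T n) < e" if "e > 0" for e
    using order_tendstoD(2)[of _ 0 sequentially e] that eventually_happens'[OF sequentially_bot]
      approximable_simple_function[OF F(1)] by blast
qed

end

section \<open>Existence and Fourier transform of multiple integrals\<close>

context brownian begin

text \<open>On the common refinement the difference is again an off-diagonal elementary integral, so
  the second-moment bound applies to it.\<close>

lemma elem_ito_uniform_diff_square_le: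
  assumes N: "N > 0" "off_diagonal_grid T n N (grid T N) c"
    and N': "N' > 0" "off_diagonal_grid T n N' (grid T N') c'"
  shows "expectation (\<lambda>\<omega>. (elem_ito B n N (grid T N) c \<omega> - elem_ito B n N' (grid T N') c' \<omega>)\<^sup>2) \<le>
    fact n * (\<integral>s. (elem_kernel n N (grid T N) c s - elem_kernel n N' (grid T N') c' s)\<^sup>2 \<partial>cube T n)"
proof -
  let ?N = "N * N'"
  let ?c = "\<lambda>i. 1 * refine n N' c i + (-1) * refine n N c' i"
  have off: "off_diagonal_grid T n ?N (grid T ?N) ?c"
    using off_diagonal_refine[OF T_pos N(1) N'(1) N(2)] off_diagonal_refine[OF T_pos N'(1) N(1) N'(2)]
    by (intro off_diagonal_lincomb) (auto simp: mult.commute)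
  have ker: "elem_kernel n ?N (grid T ?N) ?c s =
      elem_kernel n N (grid T N) c s - elem_kernel n N' (grid T N') c' s" for s
    unfolding elem_kernel_lincomb
    using elem_kernel_refine[OF T_pos N'(1), of n N c s] elem_kernel_refine[OF T_pos N(1), of n N' c' s]
    by (simp add: mult.commute)
  have ito: "elem_ito B n ?N (grid T ?N) ?c \<omega> =
      elem_ito B n N (grid T N) c \<omega> - elem_ito B n N' (grid T N') c' \<omega>" for \<omega>
    unfolding elem_ito_lincomb
    using elem_ito_refine[OF N'(1), of B n N T c \<omega>] elem_ito_refine[OF N(1), of B n N' T c' \<omega>]
    by (simp add: mult.commute)
  show ?thesis
    using elem_ito_square_le[OF off] integral_elem_kernel_square[OF T_pos off] unfolding ker ito by simp
qed

text \<open>The witness for the choice in \<open>multiple_ito\<close>. Elementary kernels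
  approximate \<open>h\<close>, the second-moment bound makes their integrals a Cauchy sequence, and
  completeness of L2 supplies the limit.\<close>

theorem has_multiple_ito_exists:
  assumes h: "h \<in> Lp (cube T n) 2"
  shows "\<exists>Y. has_multiple_ito M T B n h Y"
proof -
  let ?K = "\<lambda>N c. elem_kernel n N (grid T N) c"
  have "\<forall>k. \<exists>p. fst p > 0 \<and> off_diagonal_grid T n (fst p) (grid T (fst p)) (snd p) \<and>
      (\<integral>s. (?K (fst p) (snd p) s - h s)\<^sup>2 \<partial>cube T n) < 1 / real (Suc k)"
  proof
    fix k
    have "1 / real (Suc k) > 0" by simp
    with approximable_Lp2[OF T_pos h] obtain N c where "N > 0" "off_diagonal_grid T n N (grid T N) c"
      "(\<integral>s. (?K N c s - h s)\<^sup>2 \<partial>cube T n) < 1 / real (Suc k)"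
      unfolding approximable_def by blast
    then show "\<exists>p. fst p > 0 \<and> off_diagonal_grid T n (fst p) (grid T (fst p)) (snd p) \<and>
      (\<integral>s. (?K (fst p) (snd p) s - h s)\<^sup>2 \<partial>cube T n) < 1 / real (Suc k)"
      by (intro exI[of _ "(N, c)"]) simp
  qed
  from choice[OF this] obtain p where p: "\<And>k. fst (p k) > 0"
      "\<And>k. off_diagonal_grid T n (fst (p k)) (grid T (fst (p k))) (snd (p k))"
      "\<And>k. (\<integral>s. (?K (fst (p k)) (snd (p k)) s - h s)\<^sup>2 \<partial>cube T n) < 1 / real (Suc k)"
    by blast
  define K where "K k = ?K (fst (p k)) (snd (p k))" for k
  define I where "I k = elem_ito B n (fst (p k)) (grid T (fst (p k))) (snd (p k))" for k
  have KL: "K k \<in> Lp (cube T n) 2" for k unfolding K_def by (rule elem_kernel_Lp2[OF T_pos])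
  have IL: "I k \<in> Lp M 2" for k unfolding I_def by (rule elem_ito_Lp2[OF p(2)])
  have Kh: "(\<integral>s. (K k s - h s)\<^sup>2 \<partial>cube T n) < 1 / real (Suc k)" for k using p(3) by (simp add: K_def)
  have lim: "(\<lambda>k. \<integral>s. (K k s - h s)\<^sup>2 \<partial>cube T n) \<longlonglongrightarrow> 0"
  proof (rule tendsto_sandwich[OF _ _ tendsto_const LIMSEQ_Suc[OF lim_1_over_n]])
    show "\<forall>\<^sub>F k in sequentially. (\<integral>s. (K k s - h s)\<^sup>2 \<partial>cube T n) \<le> 1 / real (Suc k)"
      using Kh by (intro always_eventually allI less_imp_le)
  qed simp
  have KK: "(\<integral>s. (K k s - K l s)\<^sup>2 \<partial>cube T n) \<le> 2 / real (Suc k) + 2 / real (Suc l)" for k l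
  proof -
    have "(\<integral>s. (K k s - K l s)\<^sup>2 \<partial>cube T n) \<le>
        2 * (\<integral>s. (K k s - h s)\<^sup>2 \<partial>cube T n) + 2 * (\<integral>s. (h s - K l s)\<^sup>2 \<partial>cube T n)"
      using integral_square_add_le[OF Lp2_diff[OF KL h] Lp2_diff[OF h KL], of k l] by simp
    also have "(\<integral>s. (h s - K l s)\<^sup>2 \<partial>cube T n) = (\<integral>s. (K l s - h s)\<^sup>2 \<partial>cube T n)"
      by (simp add: power2_commute)
    finally show ?thesis using Kh[of k] Kh[of l] by simp
  qed
  obtain Y where Y: "tendsto_Lp M 2 I Y"
  proof (rule complete_L2[OF IL])
    fix e :: real assume "e > 0"
    have "(\<lambda>k. fact n * (4 / real (Suc k))) \<longlonglongrightarrow> fact n * 0"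
      by (intro tendsto_mult tendsto_const LIMSEQ_Suc[OF lim_const_over_n])
    then have "\<forall>\<^sub>F k in sequentially. fact n * (4 / real (Suc k)) < e"
      using order_tendstoD(2) \<open>e > 0\<close> by fastforce
    from eventually_happens'[OF sequentially_bot this] obtain k where k: "fact n * (4 / real (Suc k)) < e"
      by (rule exE)
    have "(\<integral>x. (I i x - I j x)\<^sup>2 \<partial>M) < e" if ij: "i \<ge> k" "j \<ge> k" for i j
    proof -
      have "(\<integral>x. (I i x - I j x)\<^sup>2 \<partial>M) \<le> fact n * (\<integral>s. (K i s - K j s)\<^sup>2 \<partial>cube T n)"
        unfolding I_def K_def by (intro elem_ito_uniform_diff_square_le p)
      also have "\<dots> \<le> fact n * (2 / real (Suc i) + 2 / real (Suc j))" by (intro mult_left_mono KK) simp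
      also have "\<dots> \<le> fact n * (2 / real (Suc k) + 2 / real (Suc k))"
        using ij by (intro mult_left_mono add_mono divide_left_mono) auto
      also have "\<dots> = fact n * (4 / real (Suc k))" by (simp add: add_divide_distrib[symmetric])
      finally show ?thesis using k by linarith
    qed
    then show "\<exists>K. \<forall>m\<ge>K. \<forall>n\<ge>K. (\<integral>x. (I m x - I n x)\<^sup>2 \<partial>M) < e" by blast
  qed
  have "tendsto_Lp (cube T n) 2 K h" using KL h lim by (simp add: tendsto_Lp_def)
  with Y p(2) have "has_multiple_ito M T B n h Y"
    unfolding has_multiple_ito_def K_def[abs_def] I_def[abs_def]
    by (intro exI[of _ "\<lambda>k. fst (p k)"] exI[of _ "\<lambda>k. grid T (fst (p k))"] exI[of _ "\<lambda>k. snd (p k)"]) simp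
  then show ?thesis by (intro exI[of _ Y])
qed

text \<open>Squared norms are continuous along the approximating sequence, so the elementary bound
  survives on both sides.\<close>

lemma has_multiple_ito_square_le:
  assumes "has_multiple_ito M T B n h Y"
  shows "expectation (\<lambda>\<omega>. (Y \<omega>)\<^sup>2) \<le> fact n * (\<integral>s. (h s)\<^sup>2 \<partial>cube T n)"
proof -
  obtain m \<tau> c where off: "\<And>k. off_diagonal_grid T n (m k) (\<tau> k) (c k)"
    and K: "tendsto_Lp (cube T n) 2 (\<lambda>k. elem_kernel n (m k) (\<tau> k) (c k)) h"
    and I: "tendsto_Lp M 2 (\<lambda>k. elem_ito B n (m k) (\<tau> k) (c k)) Y"
    using assms unfolding has_multiple_ito_def by blast
  show ?thesis
  proof (rule LIMSEQ_le[OF tendsto_Lp2_integral_square[OF I]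
        tendsto_mult_left[OF tendsto_Lp2_integral_square[OF K], of "fact n"]])
    show "\<exists>k0. \<forall>k\<ge>k0. expectation (\<lambda>\<omega>. (elem_ito B n (m k) (\<tau> k) (c k) \<omega>)\<^sup>2) \<le>
        fact n * (\<integral>s. (elem_kernel n (m k) (\<tau> k) (c k) s)\<^sup>2 \<partial>cube T n)"
      using elem_ito_square_le[OF off] integral_elem_kernel_square[OF T_pos off] by simp
  qed
qed

text \<open>Padding with zero coefficients allows grid points to be added to the time set.\<close>

lemma lin_extend:
  assumes "finite S'" "S \<subseteq> S'"
  shows "lin S' (\<lambda>s. if s \<in> S then \<theta> s else 0) = lin S \<theta>"
    "cov S' (\<lambda>s. if s \<in> S then \<theta> s else 0) = cov S \<theta>"
    "ip S' (\<lambda>s. if s \<in> S then \<theta> s else 0) a b = ip S \<theta> a b"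
proof -
  show "lin S' (\<lambda>s. if s \<in> S then \<theta> s else 0) = lin S \<theta>"
    unfolding lin_def using assms by (intro ext sum.mono_neutral_cong_right) auto
  show "ip S' (\<lambda>s. if s \<in> S then \<theta> s else 0) a b = ip S \<theta> a b"
    unfolding ip_def using assms by (intro sum.mono_neutral_cong_right) auto
  have "cov S' (\<lambda>s. if s \<in> S then \<theta> s else 0) =
      (\<Sum>s\<in>S. \<Sum>r\<in>S'. \<theta> s * (if r \<in> S then \<theta> r else 0) * min s r)"
    unfolding cov_def using assms by (intro sum.mono_neutral_cong_right) auto
  also have "\<dots> = cov S \<theta>"
    unfolding cov_def using assms by (intro sum.cong refl sum.mono_neutral_cong_right) auto
  finally show "cov S' (\<lambda>s. if s \<in> S then \<theta> s else 0) = cov S \<theta>" .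
qed

text \<open>Wick's formula box by box: off the diagonal the \<open>n\<close> intervals are disjoint,
  and on it the coefficient is zero. The products of inner products add up to the kernel paired with
  the tensor power of the step function.\<close>

lemma elem_ito_cos:
  assumes off: "off_diagonal_grid T n m \<tau> c" and S: "finite S" "S \<subseteq> {0..T}"
  shows "expectation (\<lambda>\<omega>. elem_ito B n m \<tau> c \<omega> * cos (lin S \<theta> \<omega> + \<eta>)) =
    (\<integral>s. elem_kernel n m \<tau> c s * (\<Prod>j<n. step_fun S \<theta> (s j)) \<partial>cube T n) *
      exp (- cov S \<theta> / 2) * cos (\<eta> + real n * (pi / 2))"
proof -
  note mono = off_diagonal_gridD(1)[OF off] and range = off_diagonal_gridD(2)[OF off]
  let ?D = "\<lambda>i \<omega>. \<Prod>j<n. B (\<tau> (Suc (i j))) \<omega> - B (\<tau> (i j)) \<omega>"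
  let ?e = "exp (- cov S \<theta> / 2) * cos (\<eta> + real n * (pi / 2))"
  have [measurable]: "lin S \<theta> \<in> borel_measurable M" by (rule lin_measurable[OF S(2)])
  have int: "integrable M (\<lambda>\<omega>. ?D i \<omega> * cos (lin S \<theta> \<omega> + \<eta>))" if i: "i \<in> {..<n} \<rightarrow>\<^sub>E {..<m}" for i
  proof -
    have D: "all_moments M (?D i)" using i by (intro elem_ito_all_moments[OF off]) auto
    then have [measurable]: "?D i \<in> borel_measurable M" by (simp add: all_moments_def)
    show ?thesis
    proof (rule Bochner_Integration.integrable_bound[OF all_moments_integrable[OF D]])
      show "AE \<omega> in M. norm (?D i \<omega> * cos (lin S \<theta> \<omega> + \<eta>)) \<le> norm (?D i \<omega>)"
        by (intro AE_I2) (simp add: abs_mult mult_left_le)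
    qed measurable
  qed
  have "expectation (\<lambda>\<omega>. elem_ito B n m \<tau> c \<omega> * cos (lin S \<theta> \<omega> + \<eta>)) =
      expectation (\<lambda>\<omega>. \<Sum>i \<in> {..<n} \<rightarrow>\<^sub>E {..<m}. c i * (?D i \<omega> * cos (lin S \<theta> \<omega> + \<eta>)))"
    unfolding elem_ito_def by (simp only: sum_distrib_right mult.assoc)
  also have "\<dots> = (\<Sum>i \<in> {..<n} \<rightarrow>\<^sub>E {..<m}. expectation (\<lambda>\<omega>. c i * (?D i \<omega> * cos (lin S \<theta> \<omega> + \<eta>))))"
    by (intro Bochner_Integration.integral_sum integrable_mult_right int)
  also have "\<dots> = (\<Sum>i \<in> {..<n} \<rightarrow>\<^sub>E {..<m}. c i * (\<Prod>j<n. ip S \<theta> (\<tau> (i j)) (\<tau> (Suc (i j)))) * ?e)"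
  proof (rule sum.cong[OF refl])
    fix i assume i: "i \<in> {..<n} \<rightarrow>\<^sub>E {..<m}"
    show "expectation (\<lambda>\<omega>. c i * (?D i \<omega> * cos (lin S \<theta> \<omega> + \<eta>))) =
        c i * (\<Prod>j<n. ip S \<theta> (\<tau> (i j)) (\<tau> (Suc (i j)))) * ?e"
    proof (cases "inj_on i {..<n}")
      case False
      then have "c i = 0" using off i by (simp add: off_diagonal_grid_def)
      then show ?thesis by simp
    next
      case True
      have lt: "i j < m" if "j < n" for j using i that by auto
      \<comment> \<open>The end points of the increments must be among the times of the linear
        functional, since Wick's formula differentiates in their coefficients.\<close>
      define S' where "S' = S \<union> \<tau> ` {..m}"
      have S': "finite S'" "S' \<subseteq> {0..T}" "S \<subseteq> S'" using S range unfolding S'_def by blast+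
      define \<theta>' where "\<theta>' s = (if s \<in> S then \<theta> s else 0)" for s
      note ext = lin_extend[OF S'(1,3), of \<theta>, folded \<theta>'_def[abs_def]]
      have "expectation (\<lambda>\<omega>. ?D i \<omega> * cos (lin S' \<theta>' \<omega> + \<eta>)) =
        (\<Prod>j<n. ip S' \<theta>' (\<tau> (i j)) (\<tau> (Suc (i j)))) * exp (- cov S' \<theta>' / 2) * cos (\<eta> + real (card {..<n}) * (pi / 2))"
      proof (rule integral_prod_increments_cos[OF S'(1,2)])
        show "\<tau> (i j) \<in> S' \<and> \<tau> (Suc (i j)) \<in> S' \<and> \<tau> (i j) \<le> \<tau> (Suc (i j))" if "j \<in> {..<n}" for j
          using lt[of j] that mono[of "i j" "Suc (i j)"] by (simp add: S'_def)
        show "\<tau> (Suc (i j)) \<le> \<tau> (i k) \<or> \<tau> (Suc (i k)) \<le> \<tau> (i j)" if "j \<in> {..<n}" "k \<in> {..<n}" "j \<noteq> k" for j k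
        proof -
          have "i j \<noteq> i k" using that inj_onD[OF True] by blast
          then consider "Suc (i j) \<le> i k" | "Suc (i k) \<le> i j" by linarith
          then show ?thesis using mono[of "Suc (i j)" "i k"] mono[of "Suc (i k)" "i j"] lt[of j] lt[of k] that
            by cases auto
        qed
      qed simp
      then show ?thesis unfolding ext by simp
    qed
  qed
  also have "\<dots> = (\<Sum>i \<in> {..<n} \<rightarrow>\<^sub>E {..<m}. c i * (\<Prod>j<n. ip S \<theta> (\<tau> (i j)) (\<tau> (Suc (i j))))) * ?e"
    by (simp add: sum_distrib_right)
  also have "(\<Sum>i \<in> {..<n} \<rightarrow>\<^sub>E {..<m}. c i * (\<Prod>j<n. ip S \<theta> (\<tau> (i j)) (\<tau> (Suc (i j))))) =
      (\<integral>s. elem_kernel n m \<tau> c s * (\<Prod>j<n. step_fun S \<theta> (s j)) \<partial>cube T n)"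
    unfolding ip_def by (rule integral_elem_kernel_step_fun[OF T_pos off S, symmetric])
  finally show ?thesis by (simp only: mult.assoc)
qed

text \<open>Both sides pass to the limit, the cosine and the tensor power of the step function being
  bounded. The right-hand side does not involve \<open>Y\<close>, so all versions of the integral
  have the same transform.\<close>

theorem multiple_ito_cos:
  assumes "has_multiple_ito M T B n h Y" and S: "finite S" "S \<subseteq> {0..T}"
  shows "expectation (\<lambda>\<omega>. Y \<omega> * cos (lin S \<theta> \<omega> + \<eta>)) =
    (\<integral>s. h s * (\<Prod>j<n. step_fun S \<theta> (s j)) \<partial>cube T n) *
      exp (- cov S \<theta> / 2) * cos (\<eta> + real n * (pi / 2))"
proof -
  obtain m \<tau> c where off: "\<And>k. off_diagonal_grid T n (m k) (\<tau> k) (c k)"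
    and K: "tendsto_Lp (cube T n) 2 (\<lambda>k. elem_kernel n (m k) (\<tau> k) (c k)) h"
    and I: "tendsto_Lp M 2 (\<lambda>k. elem_ito B n (m k) (\<tau> k) (c k)) Y"
    using assms unfolding has_multiple_ito_def by blast
  have [measurable]: "lin S \<theta> \<in> borel_measurable M" by (rule lin_measurable[OF S(2)])
  have 1: "(\<lambda>k. expectation (\<lambda>\<omega>. elem_ito B n (m k) (\<tau> k) (c k) \<omega> * cos (lin S \<theta> \<omega> + \<eta>)))
      \<longlonglongrightarrow> expectation (\<lambda>\<omega>. Y \<omega> * cos (lin S \<theta> \<omega> + \<eta>))"
    by (rule tendsto_Lp1_integral_bounded[OF tendsto_Lp2_imp_Lp1[OF I], where C = 1]) auto
  have 2: "(\<lambda>k. \<integral>s. elem_kernel n (m k) (\<tau> k) (c k) s * (\<Prod>j<n. step_fun S \<theta> (s j)) \<partial>cube T n)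
      \<longlonglongrightarrow> (\<integral>s. h s * (\<Prod>j<n. step_fun S \<theta> (s j)) \<partial>cube T n)"
  proof (rule tendsto_Lp1_integral_bounded)
    show "tendsto_Lp (cube T n) 1 (\<lambda>k. elem_kernel n (m k) (\<tau> k) (c k)) h"
      by (rule finite_measure.tendsto_Lp2_imp_Lp1[OF finite_measure_cube[OF T_pos] K])
    show "(\<lambda>s. \<Prod>j<n. step_fun S \<theta> (s j)) \<in> borel_measurable (cube T n)"
      by (intro borel_measurable_prod measurable_compose[OF coord_measurable[OF T_pos]]) auto
    show "\<bar>\<Prod>j<n. step_fun S \<theta> (s j)\<bar> \<le> (\<Prod>j<n. \<Sum>r\<in>S. \<bar>\<theta> r\<bar>)" for s
      unfolding abs_prod by (intro prod_mono conjI step_fun_bounded) simp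
  qed
  have "(\<lambda>k. expectation (\<lambda>\<omega>. elem_ito B n (m k) (\<tau> k) (c k) \<omega> * cos (lin S \<theta> \<omega> + \<eta>)))
      \<longlonglongrightarrow> (\<integral>s. h s * (\<Prod>j<n. step_fun S \<theta> (s j)) \<partial>cube T n) *
        exp (- cov S \<theta> / 2) * cos (\<eta> + real n * (pi / 2))"
    unfolding elem_ito_cos[OF off S] by (intro tendsto_mult tendsto_const 2)
  with 1 show ?thesis by (rule LIMSEQ_unique)
qed

end

section \<open>Trigonometric functionals determine a random variable\<close>

text \<open>The filtration hypothesis is kept apart because it acts at one point: a random variable
  is recovered from its transform.\<close>

locale brownian_filtered = brownian +
  assumes sets_M: "sets M = sets (augmented_filtration M B T)"
begin

text \<open>The time \<open>s0\<close> may already belong to \<open>S\<close>; its coefficient is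
  then increased by \<open>r\<close>.\<close>

lemma lin_insert:
  assumes "finite S"
  shows "lin (insert s0 S) (\<lambda>s. (if s \<in> S then \<theta> s else 0) + r * indicat_real {s0} s) \<omega> = lin S \<theta> \<omega> + r * B s0 \<omega>"
proof -
  have "lin (insert s0 S) (\<lambda>s. (if s \<in> S then \<theta> s else 0) + r * indicat_real {s0} s) \<omega> =
      lin (insert s0 S) (\<lambda>s. if s \<in> S then \<theta> s else 0) \<omega> + r * (\<Sum>s\<in>insert s0 S. indicat_real {s0} s * B s \<omega>)"
    by (simp add: lin_def sum.distrib distrib_right sum_distrib_left mult.assoc)
  also have "(\<Sum>s\<in>insert s0 S. indicat_real {s0} s * B s \<omega>) = B s0 \<omega>"
    using assms by (intro sum_mult_indicator_singleton) auto
  also have "lin (insert s0 S) (\<lambda>s. if s \<in> S then \<theta> s else 0) \<omega> = lin S \<theta> \<omega>"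
    using assms lin_extend(1)[of "insert s0 S" S \<theta>] by (simp add: fun_eq_iff subset_insertI)
  finally show ?thesis .
qed

text \<open>Indicators enter one time at a time. The cosine with arbitrary \<open>S\<close>,
  \<theta> and \<eta> stays in the claim because, for a new time, it absorbs the test functions
  cos(r B + \<zeta>); \<open>signed_density_uniqueness\<close> then trades these for an
  indicator.\<close>

lemma integral_cylinder_cos_zero:
  assumes W: "integrable M W"
    and zero: "\<And>S \<theta> \<eta>. finite S \<Longrightarrow> S \<subseteq> {0..T} \<Longrightarrow> expectation (\<lambda>\<omega>. W \<omega> * cos (lin S \<theta> \<omega> + \<eta>)) = 0"
    and F: "finite F" "F \<subseteq> {0..T}" and A: "\<And>s. A s \<in> sets borel"
  shows "finite S \<Longrightarrow> S \<subseteq> {0..T} \<Longrightarrow>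
    expectation (\<lambda>\<omega>. W \<omega> * (\<Prod>s\<in>F. indicator (A s) (B s \<omega>)) * cos (lin S \<theta> \<omega> + \<eta>)) = 0"
  using F
proof (induction F arbitrary: S \<theta> \<eta> rule: finite_induct)
  case empty
  then show ?case using zero by simp
next
  case (insert s0 F)
  let ?P = "\<lambda>\<omega>. W \<omega> * (\<Prod>s\<in>F. indicat_real (A s) (B s \<omega>))"
  have s0: "s0 \<in> {0..T}" and F: "F \<subseteq> {0..T}" using insert.prems by auto
  have [measurable]: "B s0 \<in> borel_measurable M" "A s0 \<in> sets borel" using s0 A by (auto intro: B_measurable)
  have [measurable]: "lin S' \<xi> \<in> borel_measurable M" if "S' \<subseteq> {0..T}" for S' \<xi> by (rule lin_measurable[OF that])
  have [measurable]: "W \<in> borel_measurable M" using W by auto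
  have "(\<lambda>\<omega>. indicat_real (A s) (B s \<omega>)) \<in> borel_measurable M" if "s \<in> F" for s
  proof -
    have "B s \<in> borel_measurable M" using that F by (intro B_measurable) auto
    then show ?thesis by (rule measurable_compose[OF _ borel_measurable_indicator[OF A]])
  qed
  then have [measurable]: "(\<lambda>\<omega>. \<Prod>s\<in>F. indicat_real (A s) (B s \<omega>)) \<in> borel_measurable M"
    by (rule borel_measurable_prod)
  have P01: "0 \<le> (\<Prod>s\<in>F. indicat_real (A s) (B s \<omega>))" "(\<Prod>s\<in>F. indicat_real (A s) (B s \<omega>)) \<le> 1" for \<omega>
    by (auto intro!: prod_nonneg prod_le_1)
  have int: "integrable M (\<lambda>\<omega>. ?P \<omega> * cos (lin S' \<xi> \<omega> + \<zeta>))" if S': "S' \<subseteq> {0..T}" for S' \<xi> \<zeta>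
  proof (rule Bochner_Integration.integrable_bound[OF W])
    have "\<bar>?P \<omega> * cos (lin S' \<xi> \<omega> + \<zeta>)\<bar> \<le> \<bar>W \<omega>\<bar> * 1 * 1" for \<omega>
      unfolding abs_mult using P01[of \<omega>] by (intro mult_mono) auto
    then show "AE \<omega> in M. norm (?P \<omega> * cos (lin S' \<xi> \<omega> + \<zeta>)) \<le> norm (W \<omega>)" by (intro AE_I2) simp
    have "lin S' \<xi> \<in> borel_measurable M" by (rule lin_measurable[OF S'])
    then show "(\<lambda>\<omega>. ?P \<omega> * cos (lin S' \<xi> \<omega> + \<zeta>)) \<in> borel_measurable M" by measurable
  qed
  \<comment> \<open>The product of the two cosines is half the sum of two cosines of linear
    functionals that include the time \<open>s0\<close>, so the induction hypothesis applies to
    each.\<close>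
  have key: "expectation (\<lambda>\<omega>. (?P \<omega> * cos (lin S \<theta> \<omega> + \<eta>)) * cos (r * B s0 \<omega> + \<zeta>)) = 0" for r \<zeta>
  proof -
    let ?S = "insert s0 S"
    let ?\<theta> = "\<lambda>r s. (if s \<in> S then \<theta> s else 0) + r * indicat_real {s0} s"
    have S: "finite ?S" "?S \<subseteq> {0..T}" using insert.prems s0 by auto
    have "(?P \<omega> * cos (lin S \<theta> \<omega> + \<eta>)) * cos (r * B s0 \<omega> + \<zeta>) =
        (?P \<omega> * cos (lin ?S (?\<theta> (- r)) \<omega> + (\<eta> - \<zeta>)) + ?P \<omega> * cos (lin ?S (?\<theta> r) \<omega> + (\<eta> + \<zeta>))) / 2" for \<omega>
    proof -
      have "cos (lin S \<theta> \<omega> + \<eta>) * cos (r * B s0 \<omega> + \<zeta>) =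
          (cos (lin ?S (?\<theta> (- r)) \<omega> + (\<eta> - \<zeta>)) + cos (lin ?S (?\<theta> r) \<omega> + (\<eta> + \<zeta>))) / 2"
        unfolding lin_insert[OF insert.prems(1)] by (subst cos_times_cos) (simp add: algebra_simps)
      then show ?thesis by (simp only: mult.assoc times_divide_eq_right distrib_left)
    qed
    then have "expectation (\<lambda>\<omega>. (?P \<omega> * cos (lin S \<theta> \<omega> + \<eta>)) * cos (r * B s0 \<omega> + \<zeta>)) =
        (expectation (\<lambda>\<omega>. ?P \<omega> * cos (lin ?S (?\<theta> (- r)) \<omega> + (\<eta> - \<zeta>))) +
         expectation (\<lambda>\<omega>. ?P \<omega> * cos (lin ?S (?\<theta> r) \<omega> + (\<eta> + \<zeta>)))) / 2"
      by (simp only: integral_divide_zero Bochner_Integration.integral_add[OF int[OF S(2)] int[OF S(2)]])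
    also have "\<dots> = 0" unfolding insert.IH[OF S F] by simp
    finally show ?thesis .
  qed
  have sin: "sin x = cos (x + (- pi / 2))" for x :: real unfolding cos_add by simp
  have "expectation (\<lambda>\<omega>. (?P \<omega> * cos (lin S \<theta> \<omega> + \<eta>)) * indicator (A s0) (B s0 \<omega>)) = 0"
  proof (rule signed_density_uniqueness)
    show "integrable M (\<lambda>\<omega>. ?P \<omega> * cos (lin S \<theta> \<omega> + \<eta>))" by (rule int[OF insert.prems(2)])
    show "expectation (\<lambda>\<omega>. (?P \<omega> * cos (lin S \<theta> \<omega> + \<eta>)) * cos (r * B s0 \<omega>)) = 0" for r
      using key[of r 0] by simp
    show "expectation (\<lambda>\<omega>. (?P \<omega> * cos (lin S \<theta> \<omega> + \<eta>)) * sin (r * B s0 \<omega>)) = 0" for r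
      unfolding sin by (rule key)
  qed measurable
  moreover have "W \<omega> * (\<Prod>s\<in>insert s0 F. indicator (A s) (B s \<omega>)) * cos (lin S \<theta> \<omega> + \<eta>) =
      (?P \<omega> * cos (lin S \<theta> \<omega> + \<eta>)) * indicator (A s0) (B s0 \<omega>)" for \<omega>
    by (simp only: prod.insert[OF insert.hyps] mult_ac)
  ultimately show ?case by (simp only:)
qed

text \<open>Cylinder sets together with null sets form an intersection-stable family containing the
  generators of the augmented filtration at time \<open>T\<close>, so it suffices to test
  \<open>W\<close> on them.\<close>

theorem AE_zero_if_cos_integrals_zero:
  assumes W: "integrable M W"
    and zero: "\<And>S \<theta> \<eta>. finite S \<Longrightarrow> S \<subseteq> {0..T} \<Longrightarrow> expectation (\<lambda>\<omega>. W \<omega> * cos (lin S \<theta> \<omega> + \<eta>)) = 0"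
  shows "AE \<omega> in M. W \<omega> = 0"
proof -
  define cyl where "cyl F A = {\<omega> \<in> space M. \<forall>s\<in>F. B s \<omega> \<in> A s}" for F and A :: "real \<Rightarrow> real set"
  define C where "C = {cyl F A |F A. finite F \<and> F \<subseteq> {0..T} \<and> (\<forall>s. A s \<in> sets borel)}"
  have cyl_sets: "cyl F A \<in> sets M" if "finite F" "F \<subseteq> {0..T}" "\<forall>s. A s \<in> sets borel" for F A
  proof -
    have "{\<omega> \<in> space M. B s \<omega> \<in> A s} \<in> sets M" if "s \<in> F" for s
    proof -
      have "B s \<in> borel_measurable M" using that \<open>F \<subseteq> {0..T}\<close> by (intro B_measurable) auto
      from measurable_sets[OF this, of "A s"] \<open>\<forall>s. A s \<in> sets borel\<close> show ?thesis
        by (simp add: vimage_def Int_def conj_commute)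
    qed
    then show ?thesis unfolding cyl_def using that(1) by (rule sets.sets_Collect_finite_All)
  qed
  have CM: "C \<subseteq> sets M" using cyl_sets unfolding C_def by blast
  have stable: "Int_stable (C \<union> null_sets M)"
  proof (rule Int_stableI)
    fix X Y assume XY: "X \<in> C \<union> null_sets M" "Y \<in> C \<union> null_sets M"
    then have sets: "X \<in> sets M" "Y \<in> sets M" using CM by auto
    show "X \<inter> Y \<in> C \<union> null_sets M"
    proof (cases "X \<in> null_sets M \<or> Y \<in> null_sets M")
      case True
      then show ?thesis using sets null_set_Int1[of Y M X] null_set_Int1[of X M Y] by (auto simp: Int_commute)
    next
      case False
      then obtain F A F' A' where F: "X = cyl F A" "finite F" "F \<subseteq> {0..T}" "\<forall>s. A s \<in> sets borel"
        and F': "Y = cyl F' A'" "finite F'" "F' \<subseteq> {0..T}" "\<forall>s. A' s \<in> sets borel"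
        using XY unfolding C_def by blast
      define A'' where "A'' s = (if s \<in> F then A s else UNIV) \<inter> (if s \<in> F' then A' s else UNIV)" for s
      have "X \<inter> Y = cyl (F \<union> F') A''" unfolding F F' cyl_def A''_def by auto
      moreover have "\<forall>s. A'' s \<in> sets borel" using F(4) F'(4) by (simp add: A''_def)
      ultimately have "X \<inter> Y \<in> C" using F F' unfolding C_def by blast
      then show ?thesis by simp
    qed
  qed
  show ?thesis
  proof (rule AE_zero_if_integrals_zero[OF W stable])
    show sub: "C \<union> null_sets M \<subseteq> Pow (space M)" using CM sets.sets_into_space by blast
    let ?G = "{B s -` A \<inter> space M | s A. s \<in> {0..T} \<and> A \<in> sets borel} \<union> null_sets M"
    have G: "?G \<subseteq> Pow (space M)" using null_setsD2 sets.sets_into_space by blast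
    have "sets M = sigma_sets (space M) ?G"
      using sets_M unfolding augmented_filtration_def sets_measure_of[OF G] .
    also have "\<dots> \<subseteq> sigma_sets (space M) (C \<union> null_sets M)"
    proof (rule sigma_sets_subseteq, rule Un_mono, rule subsetI)
      fix X assume "X \<in> {B s -` A \<inter> space M | s A. s \<in> {0..T} \<and> A \<in> sets borel}"
      then obtain s A where "X = B s -` A \<inter> space M" "s \<in> {0..T}" "A \<in> sets borel" by blast
      then have "X = cyl {s} (\<lambda>_. A)" "finite {s}" "{s} \<subseteq> {0..T}" "\<forall>s. (\<lambda>_. A) s \<in> sets borel"
        by (auto simp: cyl_def)
      then show "X \<in> C" unfolding C_def by blast
    qed simp
    finally show "sets M = sigma_sets (space M) (C \<union> null_sets M)"
      using sets.sigma_sets_subset[of "C \<union> null_sets M" M] CM null_setsD2 by blast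
    have "space M = cyl {} (\<lambda>_. UNIV)" by (simp add: cyl_def)
    then have "space M \<in> C" unfolding C_def by force
    then show "space M \<in> C \<union> null_sets M" by simp
    fix X assume "X \<in> C \<union> null_sets M"
    then show "expectation (\<lambda>\<omega>. W \<omega> * indicator X \<omega>) = 0"
    proof
      assume "X \<in> C"
      then obtain F A where F: "X = cyl F A" "finite F" "F \<subseteq> {0..T}" "\<forall>s. A s \<in> sets borel"
        unfolding C_def by blast
      \<comment> \<open>With an empty set of times and phase 0 the cosine factor is identically
        1.\<close>
      have "expectation (\<lambda>\<omega>. W \<omega> * indicator X \<omega>) =
          expectation (\<lambda>\<omega>. W \<omega> * (\<Prod>s\<in>F. indicator (A s) (B s \<omega>)) * cos (lin {} (\<lambda>_. 0) \<omega> + 0))"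
      proof (intro Bochner_Integration.integral_cong refl)
        fix \<omega> assume "\<omega> \<in> space M"
        then have "indicator X \<omega> = (\<Prod>s\<in>F. indicat_real (A s) (B s \<omega>))"
          using F(2) by (auto simp: F(1) cyl_def indicator_def prod.If_cases)
        then show "W \<omega> * indicator X \<omega> = W \<omega> * (\<Prod>s\<in>F. indicator (A s) (B s \<omega>)) * cos (lin {} (\<lambda>_. 0) \<omega> + 0)"
          by (simp add: lin_def)
      qed
      also have "\<dots> = 0"
        using F by (intro integral_cylinder_cos_zero[OF W zero]) auto
      finally show ?thesis .
    next
      assume "X \<in> null_sets M"
      then have "AE \<omega> in M. W \<omega> * indicator X \<omega> = 0"
        by (intro AE_I'[of X]) (auto simp: indicator_def)
      then show ?thesis by (rule integral_eq_zero_AE)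
    qed
  qed
qed

corollary AE_eq_if_cos_integrals_eq:
  assumes V: "integrable M V" and W: "integrable M W"
    and eq: "\<And>S \<theta> \<eta>. finite S \<Longrightarrow> S \<subseteq> {0..T} \<Longrightarrow>
      expectation (\<lambda>\<omega>. V \<omega> * cos (lin S \<theta> \<omega> + \<eta>)) = expectation (\<lambda>\<omega>. W \<omega> * cos (lin S \<theta> \<omega> + \<eta>))"
  shows "AE \<omega> in M. V \<omega> = W \<omega>"
proof -
  have "AE \<omega> in M. V \<omega> - W \<omega> = 0"
  proof (rule AE_zero_if_cos_integrals_zero)
    fix S \<theta> \<eta> assume S: "finite S" "S \<subseteq> {0..T}"
    have [measurable]: "lin S \<theta> \<in> borel_measurable M" by (rule lin_measurable[OF S(2)])
    have int: "integrable M (\<lambda>\<omega>. U \<omega> * cos (lin S \<theta> \<omega> + \<eta>))" if "integrable M U" for U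
    proof (rule Bochner_Integration.integrable_bound[OF that])
      show "AE \<omega> in M. norm (U \<omega> * cos (lin S \<theta> \<omega> + \<eta>)) \<le> norm (U \<omega>)"
        by (intro AE_I2) (simp add: abs_mult mult_left_le)
    qed (use that in measurable)
    show "expectation (\<lambda>\<omega>. (V \<omega> - W \<omega>) * cos (lin S \<theta> \<omega> + \<eta>)) = 0"
      using eq[OF S, of \<theta> \<eta>] int[OF V] int[OF W] by (simp add: left_diff_distrib)
  qed (use V W in simp)
  then show ?thesis by simp
qed

end

section \<open>Second quantization\<close>

text \<open>Comparison test in L2: by Minkowski the norm of a block of terms is at most the
  corresponding block of the summable series.\<close>

lemma (in finite_measure) complete_sum_L2:
  assumes X: "\<And>n. X n \<in> Lp M 2" and b: "\<And>n. (\<integral>x. (X n x)\<^sup>2 \<partial>M) \<le> (b n)\<^sup>2" "\<And>n. b n > 0"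
    and sum: "summable b"
  obtains Y where "tendsto_Lp M 2 (\<lambda>N x. \<Sum>n<N. X n x) Y"
proof (rule complete_L2)
  show "(\<lambda>x. \<Sum>n<N. X n x) \<in> Lp M 2" for N by (intro Lp2_sum X)
  fix e :: real assume "e > 0"
  then have "sqrt e > 0" by simp
  from sum[unfolded summable_Cauchy, rule_format, OF this]
  obtain K where K: "\<forall>m\<ge>K. \<forall>n. norm (sum b {m..<n}) < sqrt e" ..
  have less: "(\<integral>x. ((\<Sum>i<n. X i x) - (\<Sum>i<m. X i x))\<^sup>2 \<partial>M) < e" if "K \<le> m" "m \<le> n" for m n
  proof -
    have "(\<Sum>i<n. X i x) - (\<Sum>i<m. X i x) = (\<Sum>i\<in>{m..<n}. X i x)" for x
      using sum_diff_nat_ivl[of 0 m n "\<lambda>i. X i x"] that(2) by (simp add: lessThan_atLeast0)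
    then have "(\<integral>x. ((\<Sum>i<n. X i x) - (\<Sum>i<m. X i x))\<^sup>2 \<partial>M) \<le> (sum b {m..<n})\<^sup>2"
      using integral_square_sum_le[of "{m..<n}" X M b] X b by simp
    also have "\<dots> < (sqrt e)\<^sup>2"
    proof (rule power_strict_mono)
      show "sum b {m..<n} < sqrt e" using K[rule_format, OF that(1), of n] by (simp add: abs_less_iff)
      show "0 \<le> sum b {m..<n}" by (intro sum_nonneg less_imp_le b(2))
    qed simp
    finally show ?thesis using \<open>e > 0\<close> by simp
  qed
  have "(\<integral>x. ((\<Sum>i<m. X i x) - (\<Sum>i<n. X i x))\<^sup>2 \<partial>M) < e" if "K \<le> m" "K \<le> n" for m n
  proof (cases "m \<le> n")
    case True
    then show ?thesis using less[of m n] that by (simp add: power2_commute)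
  next
    case False
    then show ?thesis using less[of n m] that by simp
  qed
  then show "\<exists>K. \<forall>m\<ge>K. \<forall>n\<ge>K. (\<integral>x. ((\<Sum>i<m. X i x) - (\<Sum>i<n. X i x))\<^sup>2 \<partial>M) < e" by blast
qed

lemma step_fun_scale: "step_fun S (\<lambda>s. l * \<theta> s) x = l * step_fun S \<theta> x"
  by (simp add: step_fun_def sum_distrib_left mult.assoc)

context brownian_filtered begin

abbreviation MI :: "nat \<Rightarrow> ((nat \<Rightarrow> real) \<Rightarrow> real) \<Rightarrow> 'a \<Rightarrow> real" where
  "MI n h \<equiv> multiple_ito M T B n h"

lemma multiple_ito_has: "h \<in> Lp (cube T n) 2 \<Longrightarrow> has_multiple_ito M T B n h (MI n h)"
  unfolding multiple_ito_def by (rule someI_ex[OF has_multiple_ito_exists])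

lemma multiple_ito_Lp2: "h \<in> Lp (cube T n) 2 \<Longrightarrow> MI n h \<in> Lp M 2"
  using multiple_ito_has[of h n] unfolding has_multiple_ito_def tendsto_Lp_def by blast

lemma symmetric_L2_Lp2: "h \<in> symmetric_L2 T n \<Longrightarrow> h \<in> Lp (cube T n) 2"
  by (simp add: symmetric_L2_def)

lemma cos_lin_Lp2: "S \<subseteq> {0..T} \<Longrightarrow> (\<lambda>\<omega>. cos (lin S \<theta> \<omega> + \<eta>)) \<in> Lp M 2"
  using lin_measurable[of S \<theta>] by (intro Lp2_bounded[where C = 1]) auto

lemma tendsto_Lp1_cos:
  assumes "tendsto_Lp M 1 Xs X" "S \<subseteq> {0..T}"
  shows "(\<lambda>k. expectation (\<lambda>\<omega>. Xs k \<omega> * cos (lin S \<theta> \<omega> + \<eta>))) \<longlonglongrightarrow> expectation (\<lambda>\<omega>. X \<omega> * cos (lin S \<theta> \<omega> + \<eta>))"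
  using lin_measurable[OF assms(2), of \<theta>]
  by (intro tendsto_Lp1_integral_bounded[OF assms(1), where C = 1]) auto

lemma partial_sum_cos:
  assumes h: "\<And>n. h n \<in> Lp (cube T n) 2" and S: "finite S" "S \<subseteq> {0..T}"
  shows "expectation (\<lambda>\<omega>. (\<Sum>n<N. l ^ n * MI n (h n) \<omega>) * cos (lin S \<theta> \<omega> + \<eta>)) =
    (\<Sum>n<N. l ^ n * (\<integral>s. h n s * (\<Prod>j<n. step_fun S \<theta> (s j)) \<partial>cube T n) * cos (\<eta> + real n * (pi / 2))) *
      exp (- cov S \<theta> / 2)"
proof -
  have int: "integrable M (\<lambda>\<omega>. MI n (h n) \<omega> * cos (lin S \<theta> \<omega> + \<eta>))" for n
    by (intro integrable_mult_Lp2 multiple_ito_Lp2 h cos_lin_Lp2 S)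
  have "expectation (\<lambda>\<omega>. (\<Sum>n<N. l ^ n * MI n (h n) \<omega>) * cos (lin S \<theta> \<omega> + \<eta>)) =
      expectation (\<lambda>\<omega>. \<Sum>n<N. l ^ n * (MI n (h n) \<omega> * cos (lin S \<theta> \<omega> + \<eta>)))"
    by (simp only: sum_distrib_right mult.assoc)
  also have "\<dots> = (\<Sum>n<N. expectation (\<lambda>\<omega>. l ^ n * (MI n (h n) \<omega> * cos (lin S \<theta> \<omega> + \<eta>))))"
    by (intro Bochner_Integration.integral_sum integrable_mult_right int)
  also have "\<dots> = (\<Sum>n<N. l ^ n * ((\<integral>s. h n s * (\<Prod>j<n. step_fun S \<theta> (s j)) \<partial>cube T n) *
      exp (- cov S \<theta> / 2) * cos (\<eta> + real n * (pi / 2))))"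
    by (simp add: multiple_ito_cos[OF multiple_ito_has[OF h] S])
  also have "\<dots> = (\<Sum>n<N. l ^ n * (\<integral>s. h n s * (\<Prod>j<n. step_fun S \<theta> (s j)) \<partial>cube T n) * cos (\<eta> + real n * (pi / 2))) *
      exp (- cov S \<theta> / 2)"
    unfolding sum_distrib_right by (intro sum.cong refl) (simp only: mult_ac)
  finally show ?thesis .
qed

text \<open>Scaling \<theta> by \<open>l\<close> puts l^n into the pairing with the n-th kernel and
  l^2 into the covariance. Multiplying by exp(cov / 2) removes the Gaussian factor, so the partial
  sums agree, and the identity passes to the limit for any \<open>l\<close> for which
  \<open>Y\<close> exists.\<close>

lemma second_quant_cos:
  assumes X: "has_chaos M T B X h"
    and Y: "tendsto_Lp M 2 (\<lambda>N \<omega>. \<Sum>n<N. l ^ n * MI n (h n) \<omega>) Y"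
    and S: "finite S" "S \<subseteq> {0..T}"
  shows "expectation (\<lambda>\<omega>. Y \<omega> * cos (lin S \<theta> \<omega> + \<eta>)) * exp (cov S \<theta> / 2) =
    expectation (\<lambda>\<omega>. X \<omega> * cos (lin S (\<lambda>s. l * \<theta> s) \<omega> + \<eta>)) * exp (l\<^sup>2 * cov S \<theta> / 2)"
proof -
  have h: "h n \<in> Lp (cube T n) 2" for n using X by (simp add: has_chaos_def symmetric_L2_Lp2)
  have X2: "tendsto_Lp M 2 (\<lambda>N \<omega>. \<Sum>n<N. 1 ^ n * MI n (h n) \<omega>) X" using X by (simp add: has_chaos_def)
  let ?k = "\<lambda>n. \<integral>s. h n s * (\<Prod>j<n. step_fun S \<theta> (s j)) \<partial>cube T n"
  have scale: "(\<integral>s. h n s * (\<Prod>j<n. step_fun S (\<lambda>s. l * \<theta> s) (s j)) \<partial>cube T n) = l ^ n * ?k n" for n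
  proof -
    have "(\<integral>s. h n s * (\<Prod>j<n. step_fun S (\<lambda>s. l * \<theta> s) (s j)) \<partial>cube T n) =
        (\<integral>s. l ^ n * (h n s * (\<Prod>j<n. step_fun S \<theta> (s j))) \<partial>cube T n)"
      unfolding step_fun_scale prod.distrib by (simp add: mult_ac)
    then show ?thesis by simp
  qed
  have eq: "expectation (\<lambda>\<omega>. (\<Sum>n<N. l ^ n * MI n (h n) \<omega>) * cos (lin S \<theta> \<omega> + \<eta>)) * exp (cov S \<theta> / 2) =
      expectation (\<lambda>\<omega>. (\<Sum>n<N. 1 ^ n * MI n (h n) \<omega>) * cos (lin S (\<lambda>s. l * \<theta> s) \<omega> + \<eta>)) * exp (l\<^sup>2 * cov S \<theta> / 2)" for N
    unfolding partial_sum_cos[OF h S] scale cov_scale by (simp add: mult.assoc flip: exp_add)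
  have "(\<lambda>N. expectation (\<lambda>\<omega>. (\<Sum>n<N. l ^ n * MI n (h n) \<omega>) * cos (lin S \<theta> \<omega> + \<eta>)) * exp (cov S \<theta> / 2))
      \<longlonglongrightarrow> expectation (\<lambda>\<omega>. Y \<omega> * cos (lin S \<theta> \<omega> + \<eta>)) * exp (cov S \<theta> / 2)"
    by (intro tendsto_mult tendsto_const tendsto_Lp1_cos tendsto_Lp2_imp_Lp1 Y S)
  moreover have "(\<lambda>N. expectation (\<lambda>\<omega>. (\<Sum>n<N. l ^ n * MI n (h n) \<omega>) * cos (lin S \<theta> \<omega> + \<eta>)) * exp (cov S \<theta> / 2))
      \<longlonglongrightarrow> expectation (\<lambda>\<omega>. X \<omega> * cos (lin S (\<lambda>s. l * \<theta> s) \<omega> + \<eta>)) * exp (l\<^sup>2 * cov S \<theta> / 2)"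
    unfolding eq by (intro tendsto_mult tendsto_const tendsto_Lp1_cos tendsto_Lp2_imp_Lp1 X2 S)
  ultimately show ?thesis by (rule LIMSEQ_unique)
qed

text \<open>The relation underlying the choice in \<open>second_quant\<close>; as a relation it can
  be compared across kernels and limits before anything is selected.\<close>

definition is_second_quant :: "real \<Rightarrow> ('a \<Rightarrow> real) \<Rightarrow> ('a \<Rightarrow> real) \<Rightarrow> bool" where
  "is_second_quant l X Y \<longleftrightarrow> (\<exists>h. has_chaos M T B X h \<and>
     tendsto_Lp M 2 (\<lambda>N \<omega>. \<Sum>n<N. l ^ n * MI n (h n) \<omega>) Y)"

lemma is_second_quant_Lp2: "is_second_quant l X Y \<Longrightarrow> Y \<in> Lp M 2"
  unfolding is_second_quant_def tendsto_Lp_def by blast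

lemma is_second_quant_cos:
  assumes "is_second_quant l X Y" "finite S" "S \<subseteq> {0..T}"
  shows "expectation (\<lambda>\<omega>. Y \<omega> * cos (lin S \<theta> \<omega> + \<eta>)) * exp (cov S \<theta> / 2) =
    expectation (\<lambda>\<omega>. X \<omega> * cos (lin S (\<lambda>s. l * \<theta> s) \<omega> + \<eta>)) * exp (l\<^sup>2 * cov S \<theta> / 2)"
  using assms second_quant_cos unfolding is_second_quant_def by blast

text \<open>The two limits may stem from different kernels, but the transform of each is expressed
  by \<open>X\<close> alone.\<close>

lemma is_second_quant_unique:
  assumes Y: "is_second_quant l X Y" and Z: "is_second_quant l X Z"
  shows "AE \<omega> in M. Y \<omega> = Z \<omega>"
proof (rule AE_eq_if_cos_integrals_eq)
  show "integrable M Y" "integrable M Z"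
    using Lp2_imp_Lp1[OF is_second_quant_Lp2[OF Y]] Lp2_imp_Lp1[OF is_second_quant_Lp2[OF Z]]
    by (simp_all only: Lp1_iff)
  fix S \<theta> \<eta> assume S: "finite S" "S \<subseteq> {0..T}"
  show "expectation (\<lambda>\<omega>. Y \<omega> * cos (lin S \<theta> \<omega> + \<eta>)) = expectation (\<lambda>\<omega>. Z \<omega> * cos (lin S \<theta> \<omega> + \<eta>))"
    using trans[OF is_second_quant_cos[OF Y S, of \<theta> \<eta>] is_second_quant_cos[OF Z S, of \<theta> \<eta>, symmetric]]
    by (simp only: mult_cancel_right exp_not_eq_zero simp_thms)
qed

lemma second_quant_is:
  assumes "is_second_quant l X Y"
  shows "is_second_quant l X (second_quant M T B l X)"
proof -
  have "\<exists>Y h. has_chaos M T B X h \<and> tendsto_Lp M 2 (\<lambda>N \<omega>. \<Sum>n<N. l ^ n * MI n (h n) \<omega>) Y"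
    using assms unfolding is_second_quant_def by (intro exI[of _ Y])
  from someI_ex[OF this] show ?thesis unfolding is_second_quant_def second_quant_def .
qed

text \<open>
  For \<open>l < 1\<close> the series defining \<open>\<Gamma>(l) X\<close> converges absolutely: the chaos components of \<open>X\<close>
  tend to zero in \<open>L\<^sup>2\<close>, being differences of consecutive partial sums.
\<close>

lemma is_second_quant_exists:
  assumes X: "has_chaos M T B X h" and l: "0 < l" "l < 1"
  shows "\<exists>Y. is_second_quant l X Y"
proof -
  have h: "h n \<in> Lp (cube T n) 2" for n using X by (simp add: has_chaos_def symmetric_L2_Lp2)
  define P where "P N \<omega> = (\<Sum>n<N. MI n (h n) \<omega>)" for N \<omega>
  have P: "tendsto_Lp M 2 P X" using X by (simp add: has_chaos_def P_def[abs_def])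
  have PX: "(\<lambda>\<omega>. P N \<omega> - X \<omega>) \<in> Lp M 2" for N using P by (intro Lp2_diff) (auto simp: tendsto_Lp_def)
  have lim: "(\<lambda>N. expectation (\<lambda>\<omega>. (P N \<omega> - X \<omega>)\<^sup>2)) \<longlonglongrightarrow> 0" using P by (simp add: tendsto_Lp_def)
  then have "Bseq (\<lambda>N. expectation (\<lambda>\<omega>. (P N \<omega> - X \<omega>)\<^sup>2))" by (intro convergent_imp_Bseq convergentI)
  then obtain C where C: "C > 0" "\<And>N. norm (expectation (\<lambda>\<omega>. (P N \<omega> - X \<omega>)\<^sup>2)) \<le> C"
    unfolding Bseq_def by blast
  \<comment> \<open>A chaos component is the difference of consecutive errors, so its second moment
    is at most 4 C; this is enlarged to a square because the summation criterion takes bounds of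
    that form.\<close>
  have bound: "expectation (\<lambda>\<omega>. (MI n (h n) \<omega>)\<^sup>2) \<le> (4 * C + 1)\<^sup>2" for n
  proof -
    have "expectation (\<lambda>\<omega>. (MI n (h n) \<omega>)\<^sup>2) = expectation (\<lambda>\<omega>. ((P (Suc n) \<omega> - X \<omega>) + -1 * (P n \<omega> - X \<omega>))\<^sup>2)"
      by (simp add: P_def)
    also have "\<dots> \<le> 2 * expectation (\<lambda>\<omega>. (P (Suc n) \<omega> - X \<omega>)\<^sup>2) + 2 * expectation (\<lambda>\<omega>. (-1 * (P n \<omega> - X \<omega>))\<^sup>2)"
      by (intro integral_square_add_le Lp2_cmult PX)
    also have "\<dots> = 2 * expectation (\<lambda>\<omega>. (P (Suc n) \<omega> - X \<omega>)\<^sup>2) + 2 * expectation (\<lambda>\<omega>. (P n \<omega> - X \<omega>)\<^sup>2)"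
      by (simp add: power2_commute)
    also have "\<dots> \<le> 2 * C + 2 * C" using C(2)[of n] C(2)[of "Suc n"] by (simp add: abs_le_iff)
    also have "\<dots> \<le> (4 * C + 1)\<^sup>2" using C(1) by (simp add: power2_sum add_increasing)
    finally show ?thesis .
  qed
  obtain Y where "tendsto_Lp M 2 (\<lambda>N \<omega>. \<Sum>n<N. l ^ n * MI n (h n) \<omega>) Y"
  proof (rule complete_sum_L2)
    show "(\<lambda>\<omega>. l ^ n * MI n (h n) \<omega>) \<in> Lp M 2" for n by (intro Lp2_cmult multiple_ito_Lp2 h)
    show "expectation (\<lambda>\<omega>. (l ^ n * MI n (h n) \<omega>)\<^sup>2) \<le> (l ^ n * (4 * C + 1))\<^sup>2" for n
      using bound[of n] by (simp add: power_mult_distrib mult_left_mono)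
    show "l ^ n * (4 * C + 1) > 0" for n using l C(1) by simp
    show "summable (\<lambda>n. l ^ n * (4 * C + 1))" using l by (intro summable_mult2 summable_geometric) simp
  qed
  with X have "is_second_quant l X Y" unfolding is_second_quant_def by blast
  then show ?thesis by (intro exI[of _ Y])
qed

lemma second_quant_of_dom:
  assumes "X \<in> second_quant_dom M T B l" "0 < l" "l < 1"
  shows "is_second_quant l X (second_quant M T B l X)"
proof -
  obtain h where "has_chaos M T B X h" using assms(1) unfolding second_quant_dom_def by blast
  from is_second_quant_exists[OF this assms(2,3)] obtain Y where "is_second_quant l X Y" ..
  then show ?thesis by (rule second_quant_is)
qed

lemma second_quant_L1_cos:
  assumes Ys: "\<And>k. Ys k \<in> second_quant_dom M T B l" and l: "0 < l" "l < 1"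
    and Y: "tendsto_Lp M 1 Ys Y" and Z: "tendsto_Lp M 1 (\<lambda>k. second_quant M T B l (Ys k)) Z"
    and S: "finite S" "S \<subseteq> {0..T}"
  shows "expectation (\<lambda>\<omega>. Z \<omega> * cos (lin S \<theta> \<omega> + \<eta>)) * exp (cov S \<theta> / 2) =
    expectation (\<lambda>\<omega>. Y \<omega> * cos (lin S (\<lambda>s. l * \<theta> s) \<omega> + \<eta>)) * exp (l\<^sup>2 * cov S \<theta> / 2)"
proof -
  have "(\<lambda>k. expectation (\<lambda>\<omega>. second_quant M T B l (Ys k) \<omega> * cos (lin S \<theta> \<omega> + \<eta>)) * exp (cov S \<theta> / 2))
      \<longlonglongrightarrow> expectation (\<lambda>\<omega>. Z \<omega> * cos (lin S \<theta> \<omega> + \<eta>)) * exp (cov S \<theta> / 2)"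
    by (intro tendsto_mult tendsto_const tendsto_Lp1_cos Z S)
  moreover have "(\<lambda>k. expectation (\<lambda>\<omega>. second_quant M T B l (Ys k) \<omega> * cos (lin S \<theta> \<omega> + \<eta>)) * exp (cov S \<theta> / 2))
      \<longlonglongrightarrow> expectation (\<lambda>\<omega>. Y \<omega> * cos (lin S (\<lambda>s. l * \<theta> s) \<omega> + \<eta>)) * exp (l\<^sup>2 * cov S \<theta> / 2)"
    unfolding is_second_quant_cos[OF second_quant_of_dom[OF Ys l] S]
    by (intro tendsto_mult tendsto_const tendsto_Lp1_cos Y S)
  ultimately show ?thesis by (rule LIMSEQ_unique)
qed

text \<open>One sequence with convergent images does two things: it shows that the choice in
  \<open>second_quant_L1\<close> has a witness, and by the transform its limit agrees with whichever
  one was chosen.\<close>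

lemma second_quant_L1_eq:
  assumes Ys: "\<And>k. Ys k \<in> second_quant_dom M T B l" and l: "0 < l" "l < 1"
    and Y: "tendsto_Lp M 1 Ys Y" and Z: "tendsto_Lp M 1 (\<lambda>k. second_quant M T B l (Ys k)) Z"
  shows "AE \<omega> in M. Z \<omega> = second_quant_L1 M T B l Y \<omega>"
proof -
  let ?Z = "second_quant_L1 M T B l Y"
  have "\<exists>Z Ys. (\<forall>k. Ys k \<in> second_quant_dom M T B l) \<and>
     tendsto_Lp M 1 Ys Y \<and> tendsto_Lp M 1 (\<lambda>k. second_quant M T B l (Ys k)) Z"
    using Ys Y Z by (intro exI[of _ Z] exI[of _ Ys]) simp
  from someI_ex[OF this] have "\<exists>Ys. (\<forall>k. Ys k \<in> second_quant_dom M T B l) \<and>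
     tendsto_Lp M 1 Ys Y \<and> tendsto_Lp M 1 (\<lambda>k. second_quant M T B l (Ys k)) ?Z"
    unfolding second_quant_L1_def .
  then obtain Ys' where Ys': "\<And>k. Ys' k \<in> second_quant_dom M T B l"
    "tendsto_Lp M 1 Ys' Y" "tendsto_Lp M 1 (\<lambda>k. second_quant M T B l (Ys' k)) ?Z" by blast
  show ?thesis
  proof (rule AE_eq_if_cos_integrals_eq)
    show "integrable M Z" "integrable M ?Z" using Z Ys'(3) unfolding tendsto_Lp_def Lp1_iff by blast+
    fix S \<theta> \<eta> assume S: "finite S" "S \<subseteq> {0..T}"
    show "expectation (\<lambda>\<omega>. Z \<omega> * cos (lin S \<theta> \<omega> + \<eta>)) = expectation (\<lambda>\<omega>. ?Z \<omega> * cos (lin S \<theta> \<omega> + \<eta>))"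
      using trans[OF second_quant_L1_cos[OF Ys l Y Z S, of \<theta> \<eta>]
          second_quant_L1_cos[OF Ys'(1) l Ys'(2,3) S, of \<theta> \<eta>, symmetric]]
      by (simp only: mult_cancel_right exp_not_eq_zero simp_thms)
  qed
qed

end

section \<open>Chaos expansion of trigonometric functions of the Brownian motion\<close>

definition heat_flow :: "(real \<times> real \<times> real) list \<Rightarrow> real \<Rightarrow> real \<Rightarrow> real" where
  "heat_flow L t = trig_sum (map (\<lambda>(a, w, p). (a * exp (- w\<^sup>2 * t / 2), w, p)) L)"

lemma heat_flow_Nil: "heat_flow [] t x = 0"
  by (simp add: heat_flow_def trig_sum_def)

lemma heat_flow_Cons: "heat_flow ((a, w, p) # L) t x = a * exp (- w\<^sup>2 * t / 2) * cos (w * x + p) + heat_flow L t x"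
  by (simp add: heat_flow_def trig_sum_def)

lemma heat_flow_0: "heat_flow L 0 x = trig_sum L x"
  by (induction L) (auto simp: heat_flow_Nil heat_flow_Cons trig_sum_def)

lemma heat_flow_continuous: "continuous_on A (\<lambda>(t, x). heat_flow L t x)"
proof (induction L)
  case (Cons q L)
  obtain a w p where q: "q = (a, w, p)" by (cases q)
  show ?case
    using Cons unfolding q heat_flow_Cons case_prod_unfold by (intro continuous_intros) auto
qed (simp add: heat_flow_Nil)

lemma heat_flow_bounded: "\<exists>C\<ge>0. \<forall>t\<ge>0. \<forall>x. \<bar>heat_flow L t x\<bar> \<le> C"
proof (induction L)
  case (Cons q L)
  obtain a w p where q: "q = (a, w, p)" by (cases q)
  obtain C where C: "C \<ge> 0" "\<And>t x. t \<ge> 0 \<Longrightarrow> \<bar>heat_flow L t x\<bar> \<le> C" using Cons by blast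
  have "\<bar>heat_flow (q # L) t x\<bar> \<le> \<bar>a\<bar> + C" if "t \<ge> 0" for t x
  proof -
    have "\<bar>a * exp (- w\<^sup>2 * t / 2) * cos (w * x + p)\<bar> \<le> \<bar>a\<bar> * 1 * 1"
      unfolding abs_mult using that by (intro mult_mono) auto
    then show ?thesis unfolding q heat_flow_Cons using C(2)[OF that, of x] by linarith
  qed
  then show ?case using C(1) by (intro exI[of _ "\<bar>a\<bar> + C"]) auto
qed (auto simp: heat_flow_Nil)

text \<open>Each mode cos(w x + p) is an eigenfunction of half the second derivative with eigenvalue
  -w^2 / 2, the rate at which its amplitude changes.\<close>

lemma heat_flow_derivatives:
  "\<exists>ut ux uxx. \<forall>t x. ((\<lambda>s. heat_flow L s x) has_real_derivative ut t x) (at t) \<and>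
    (heat_flow L t has_real_derivative ux t x) (at x) \<and> (ux t has_real_derivative uxx t x) (at x) \<and>
    ut t x = 1 / 2 * uxx t x"
proof (induction L)
  case Nil
  show ?case
    by (intro exI[of _ "\<lambda>_ _. 0"]) (simp add: heat_flow_Nil[abs_def])
next
  case (Cons q L)
  obtain a w p where q: "q = (a, w, p)" by (cases q)
  obtain ut ux uxx where IH:
    "\<And>t x. ((\<lambda>s. heat_flow L s x) has_real_derivative ut t x) (at t)"
    "\<And>t x. (heat_flow L t has_real_derivative ux t x) (at x)"
    "\<And>t x. (ux t has_real_derivative uxx t x) (at x)"
    "\<And>t x. ut t x = 1 / 2 * uxx t x" using Cons by blast
  define E where "E t = a * exp (- w\<^sup>2 * t / 2)" for t
  have E: "(E has_real_derivative - w\<^sup>2 / 2 * E t) (at t)" for t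
    unfolding E_def by (auto intro!: derivative_eq_intros)
  have hf: "heat_flow (q # L) t x = E t * cos (w * x + p) + heat_flow L t x" for t x
    unfolding q heat_flow_Cons E_def ..
  have "((\<lambda>s. heat_flow (q # L) s x) has_real_derivative - w\<^sup>2 / 2 * E t * cos (w * x + p) + ut t x) (at t)" for t x
    unfolding hf by (rule derivative_eq_intros E IH refl | simp)+
  moreover have "(heat_flow (q # L) t has_real_derivative - w * E t * sin (w * x + p) + ux t x) (at x)" for t x
    unfolding hf[abs_def] by (rule derivative_eq_intros IH refl | simp)+
  moreover have "((\<lambda>x. - w * E t * sin (w * x + p) + ux t x) has_real_derivative - w\<^sup>2 * E t * cos (w * x + p) + uxx t x) (at x)" for t x
    by (rule derivative_eq_intros IH refl | simp add: power2_eq_square)+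
  moreover have "- w\<^sup>2 / 2 * E t * cos (w * x + p) + ut t x = 1 / 2 * (- w\<^sup>2 * E t * cos (w * x + p) + uxx t x)" for t x
    unfolding IH(4) by (simp add: algebra_simps)
  ultimately show ?case
    by (intro exI[of _ "\<lambda>t x. - w\<^sup>2 / 2 * E t * cos (w * x + p) + ut t x"]
        exI[of _ "\<lambda>t x. - w * E t * sin (w * x + p) + ux t x"]
        exI[of _ "\<lambda>t x. - w\<^sup>2 * E t * cos (w * x + p) + uxx t x"]) simp
qed

text \<open>The error bound grows like \<open>x\<^sup>2 + t\<close>, which solves the heat equation with initial value \<open>x\<^sup>2\<close>.\<close>

lemma heat_solution_near_heat_flow:
  assumes sol: "heat_solution T f u" and growth: "gaussian_growth T u"
    and near: "\<And>x. \<bar>f x - trig_sum L x\<bar> \<le> e + D * x\<^sup>2" and "e \<ge> 0" "D \<ge> 0"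
    and t: "t \<in> {0..T}"
  shows "\<bar>u t x - heat_flow L t x\<bar> \<le> e + D * (x\<^sup>2 + t)"
proof -
  obtain ut ux uxx where u:
    "\<And>t x. t \<in> {0<..T} \<Longrightarrow> ((\<lambda>s. u s x) has_real_derivative ut t x) (at t within {0<..T})"
    "\<And>t x. t \<in> {0<..T} \<Longrightarrow> (u t has_real_derivative ux t x) (at x)"
    "\<And>t x. t \<in> {0<..T} \<Longrightarrow> (ux t has_real_derivative uxx t x) (at x)"
    "\<And>t x. t \<in> {0<..T} \<Longrightarrow> ut t x = 1 / 2 * uxx t x"
    using sol unfolding heat_solution_def by blast
  have cont: "continuous_on ({0..T} \<times> UNIV) (\<lambda>(t, x). u t x)" and init: "\<And>x. u 0 x = f x"
    using sol by (auto simp: heat_solution_def)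
  obtain vt vx vxx where v:
    "\<And>t x. ((\<lambda>s. heat_flow L s x) has_real_derivative vt t x) (at t)"
    "\<And>t x. (heat_flow L t has_real_derivative vx t x) (at x)"
    "\<And>t x. (vx t has_real_derivative vxx t x) (at x)"
    "\<And>t x. vt t x = 1 / 2 * vxx t x" using heat_flow_derivatives[of L] by blast
  obtain C where C: "C \<ge> 0" "\<And>t x. t \<ge> 0 \<Longrightarrow> \<bar>heat_flow L t x\<bar> \<le> C" using heat_flow_bounded[of L] by blast
  obtain a A where aA: "a > 0" "A > 0" "\<And>t x. t \<in> {0..T} \<Longrightarrow> \<bar>u t x\<bar> \<le> A * exp (a * x\<^sup>2)"
    using growth unfolding gaussian_growth_def by blast
  \<comment> \<open>The sign \<sigma> lets one application of the comparison principle give both the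
    upper and the lower bound.\<close>
  have le: "\<sigma> * (u t x - heat_flow L t x) - (e + D * (x\<^sup>2 + t)) \<le> 0" if \<sigma>: "\<sigma> = 1 \<or> \<sigma> = -1" for \<sigma> :: real
  proof (rule heat_comparison[where w = "\<lambda>t x. \<sigma> * (u t x - heat_flow L t x) - (e + D * (x\<^sup>2 + t))"
        and wt = "\<lambda>t x. \<sigma> * (ut t x - vt t x) - D" and wx = "\<lambda>t x. \<sigma> * (ux t x - vx t x) - D * (2 * x)"
        and wxx = "\<lambda>t x. \<sigma> * (uxx t x - vxx t x) - D * 2" and A = "A + C" and a = a and T = T])
    show "continuous_on ({0..T} \<times> UNIV) (\<lambda>(t, x). \<sigma> * (u t x - heat_flow L t x) - (e + D * (x\<^sup>2 + t)))"
      using cont heat_flow_continuous[of "{0..T} \<times> UNIV" L]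
      unfolding case_prod_unfold by (intro continuous_intros) auto
    \<comment> \<open>The subtracted term is nonnegative, and exp(a x^2) >= 1 lets the constant
      bound \<open>C\<close> of the heat flow be added to \<open>A\<close>.\<close>
    show "\<sigma> * (u t x - heat_flow L t x) - (e + D * (x\<^sup>2 + t)) \<le> (A + C) * exp (a * x\<^sup>2)"
      if t: "t \<in> {0..T}" for t x
    proof -
      have "\<sigma> * (u t x - heat_flow L t x) \<le> A * exp (a * x\<^sup>2) + C"
        using \<sigma> aA(3)[OF t, of x] C(2)[of t x] t by (auto simp: abs_le_iff)
      also have "\<dots> \<le> (A + C) * exp (a * x\<^sup>2)"
        using mult_left_mono[of 1 "exp (a * x\<^sup>2)" C] aA(1) C(1) by (simp add: distrib_right)
      finally show ?thesis using \<open>e \<ge> 0\<close> \<open>D \<ge> 0\<close> t by (smt (verit) atLeastAtMost_iff mult_nonneg_nonneg zero_le_power2)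
    qed
    show "\<sigma> * (u 0 x - heat_flow L 0 x) - (e + D * (x\<^sup>2 + 0)) \<le> 0" for x
      using \<sigma> near[of x] by (auto simp: init heat_flow_0 abs_le_iff)
    fix t x assume t: "t \<in> {0<..T}"
    show "((\<lambda>s. \<sigma> * (u s x - heat_flow L s x) - (e + D * (x\<^sup>2 + s))) has_real_derivative \<sigma> * (ut t x - vt t x) - D) (at t within {0<..T})"
      by (rule derivative_eq_intros u(1)[OF t] v(1)[THEN has_field_derivative_at_within] refl | simp)+
    show "((\<lambda>x. \<sigma> * (u t x - heat_flow L t x) - (e + D * (x\<^sup>2 + t))) has_real_derivative \<sigma> * (ux t x - vx t x) - D * (2 * x)) (at x)"
      by (rule derivative_eq_intros u(2)[OF t] v(2) refl | simp)+
    show "((\<lambda>x. \<sigma> * (ux t x - vx t x) - D * (2 * x)) has_real_derivative \<sigma> * (uxx t x - vxx t x) - D * 2) (at x)"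
      by (rule derivative_eq_intros u(3)[OF t] v(3) refl | simp)+
    show "\<sigma> * (ut t x - vt t x) - D = 1 / 2 * (\<sigma> * (uxx t x - vxx t x) - D * 2)"
      unfolding u(4)[OF t] v(4) by (simp add: algebra_simps)
  qed (use aA C t in auto)
  show ?thesis using le[of 1] le[of "-1"] by (simp add: abs_le_iff)
qed

text \<open>The shape of the chaos kernels of a function of \<open>B t\<close>: the n-fold integral
  of the tensor power is a Hermite polynomial in \<open>B t\<close>.\<close>

definition tensor_kernel :: "real \<Rightarrow> (nat \<Rightarrow> real) \<Rightarrow> nat \<Rightarrow> (nat \<Rightarrow> real) \<Rightarrow> real" where
  "tensor_kernel t C n s = C n * (\<Prod>j<n. indicator {0<..t} (s j))"

context fixes T t :: real assumes T_pos: "T > 0" and t: "t \<in> {0..T}" begin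

lemma tensor_kernel_Lp2: "tensor_kernel t C n \<in> Lp (cube T n) 2"
proof (rule finite_measure.Lp2_bounded[OF finite_measure_cube[OF T_pos]])
  have "(\<lambda>s. \<Prod>j<n. indicat_real {0<..t} (s j)) \<in> borel_measurable (cube T n)"
    by (intro borel_measurable_prod measurable_compose[OF coord_measurable[OF T_pos]]) auto
  then show "tensor_kernel t C n \<in> borel_measurable (cube T n)"
    unfolding tensor_kernel_def[abs_def] by (intro borel_measurable_times) auto
  have "\<bar>\<Prod>j<n. indicat_real {0<..t} (s j)\<bar> \<le> 1" for s
    unfolding abs_prod by (intro prod_le_1) (auto simp: indicator_def)
  then show "\<bar>tensor_kernel t C n s\<bar> \<le> \<bar>C n\<bar>" for s
    unfolding tensor_kernel_def abs_mult by (intro mult_left_le) auto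
qed

lemma tensor_kernel_symmetric: "tensor_kernel t C n \<in> symmetric_L2 T n"
proof -
  have "tensor_kernel t C n (\<lambda>j. s (\<pi> j)) = tensor_kernel t C n s" if "\<pi> permutes {..<n}" for \<pi> s
    unfolding tensor_kernel_def using prod.permute[OF that, of "\<lambda>j. indicat_real {0<..t} (s j)"] by (simp add: comp_def)
  then show ?thesis unfolding symmetric_L2_def using tensor_kernel_Lp2 by simp
qed

lemma integral_tensor_kernel_square: "(\<integral>s. (tensor_kernel t C n s)\<^sup>2 \<partial>cube T n) = (C n)\<^sup>2 * t ^ n"
proof -
  have sq: "(\<Prod>j<n. indicat_real {0<..t} (s j))\<^sup>2 = (\<Prod>j<n. indicator {0<..t} (s j))" for s
    unfolding prod_power_distrib by (intro prod.cong refl) (simp add: indicator_def)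
  have "(\<integral>s. (\<Prod>j<n. indicat_real {0<..t} (s j)) \<partial>cube T n) =
      (\<Prod>j<n. \<integral>x. indicat_real {0<..t} x \<partial>restrict_space lborel {0..T})"
    by (rule integral_cube_prod(2)[OF T_pos, where C = 1]) (auto simp: indicator_def)
  also have "\<dots> = t ^ n"
  proof -
    have "(\<integral>x. indicat_real {0<..t} x \<partial>restrict_space lborel {0..T}) = t - 0"
      using t by (intro integral_Ioc[OF T_pos]) auto
    then show ?thesis by (simp only: prod_constant card_lessThan diff_0_right)
  qed
  finally show ?thesis unfolding tensor_kernel_def power_mult_distrib sq by simp
qed

lemma integral_tensor_kernel_step_fun:
  assumes "S \<subseteq> {0..T}"
  shows "(\<integral>s. tensor_kernel t C n s * (\<Prod>j<n. step_fun S \<theta> (s j)) \<partial>cube T n) =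
    C n * (\<Sum>r\<in>S. \<theta> r * (min r t - min r 0)) ^ n"
proof -
  have bound: "\<bar>indicat_real {0<..t} x * step_fun S \<theta> x\<bar> \<le> (\<Sum>r\<in>S. \<bar>\<theta> r\<bar>)" for x
    using step_fun_bounded[of S \<theta> x] by (auto simp: indicator_def sum_nonneg)
  have "(\<integral>s. (\<Prod>j<n. indicat_real {0<..t} (s j) * step_fun S \<theta> (s j)) \<partial>cube T n) =
      (\<Prod>j<n. \<integral>x. indicat_real {0<..t} x * step_fun S \<theta> x \<partial>restrict_space lborel {0..T})"
    by (rule integral_cube_prod(2)[OF T_pos _ bound]) measurable
  also have "\<dots> = (\<Sum>r\<in>S. \<theta> r * (min r t - min r 0)) ^ n"
  proof -
    have "(\<integral>x. indicat_real {0<..t} x * step_fun S \<theta> x \<partial>restrict_space lborel {0..T}) =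
        (\<Sum>r\<in>S. \<theta> r * (min r t - min r 0))"
      using t by (intro integral_Ioc_step_fun[OF T_pos assms]) auto
    then show ?thesis by (simp only: prod_constant card_lessThan)
  qed
  finally have *: "(\<integral>s. (\<Prod>j<n. indicat_real {0<..t} (s j) * step_fun S \<theta> (s j)) \<partial>cube T n) =
      (\<Sum>r\<in>S. \<theta> r * (min r t - min r 0)) ^ n" .
  have "(\<integral>s. tensor_kernel t C n s * (\<Prod>j<n. step_fun S \<theta> (s j)) \<partial>cube T n) =
      (\<integral>s. C n * (\<Prod>j<n. indicat_real {0<..t} (s j) * step_fun S \<theta> (s j)) \<partial>cube T n)"
    unfolding tensor_kernel_def by (simp only: mult.assoc prod.distrib)
  also have "\<dots> = C n * (\<integral>s. (\<Prod>j<n. indicat_real {0<..t} (s j) * step_fun S \<theta> (s j)) \<partial>cube T n)"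
    by (rule integral_mult_right_zero)
  finally show ?thesis unfolding * .
qed

text \<open>The squared coefficient carries two inverse factorials; one cancels the n! of the norm
  and the other remains, so the weighted series converges for every \<open>l\<close>.\<close>

lemma tensor_kernel_weight_le:
  assumes C: "\<And>n. \<bar>C n\<bar> \<le> A * R ^ n / fact n" and "R \<ge> 0"
  shows "fact n * l ^ (2 * n) * (\<integral>s. (tensor_kernel t C n s)\<^sup>2 \<partial>cube T n) \<le> A\<^sup>2 * ((l\<^sup>2 * R\<^sup>2 * t) ^ n / fact n)"
proof -
  have "(C n)\<^sup>2 \<le> (A * R ^ n / fact n)\<^sup>2"
    using power_mono[OF C[of n] abs_ge_zero, of 2] by simp
  then have "fact n * l ^ (2 * n) * ((C n)\<^sup>2 * t ^ n) \<le> fact n * l ^ (2 * n) * ((A * R ^ n / fact n)\<^sup>2 * t ^ n)"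
    using t by (intro mult_left_mono mult_right_mono) (auto simp: power_mult)
  also have "\<dots> = A\<^sup>2 * ((l\<^sup>2 * R\<^sup>2 * t) ^ n / fact n)"
    by (simp add: power2_eq_square power_mult_distrib power_mult field_simps)
  finally show ?thesis unfolding integral_tensor_kernel_square .
qed

end

context brownian_filtered begin

text \<open>Identifies a chaos series without computing its terms: the coefficient bound makes it
  converge in L2, and its limit has the same transform as \<open>X\<close>, hence equals
  \<open>X\<close> almost surely.\<close>

lemma tendsto_chaos_sum:
  assumes t: "t \<in> {0..T}" and C: "\<And>n. \<bar>C n\<bar> \<le> A * R ^ n / fact n" and A: "A > 0" and R: "R \<ge> 0"
    and X: "X \<in> Lp M 2"
    and cos: "\<And>S \<theta> \<eta>. finite S \<Longrightarrow> S \<subseteq> {0..T} \<Longrightarrow>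
      \<exists>z. (\<lambda>n. l ^ n * (C n * ip S \<theta> 0 t ^ n) * cos (\<eta> + real n * (pi / 2))) sums z \<and>
        expectation (\<lambda>\<omega>. X \<omega> * cos (lin S \<theta> \<omega> + \<eta>)) = z * exp (- cov S \<theta> / 2)"
  shows "tendsto_Lp M 2 (\<lambda>N \<omega>. \<Sum>n<N. l ^ n * MI n (tensor_kernel t C n) \<omega>) X"
proof -
  note h = tensor_kernel_Lp2[OF T_pos t, of C]
  define y where "y = l\<^sup>2 * R\<^sup>2 * t"
  have y: "y \<ge> 0" using t by (simp add: y_def)
  \<comment> \<open>A summable sequence whose square dominates A^2 y^n / n!. Writing y^n / n! = v w
    with v = (4 y)^n / n! and w = (1/4)^n, and using v w <= (v + w)^2, avoids square roots of
    factorials.\<close>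
  define b where "b n = A * (inverse (fact n) * (4 * y) ^ n + (1 / 4) ^ n)" for n
  obtain W where W: "tendsto_Lp M 2 (\<lambda>N \<omega>. \<Sum>n<N. l ^ n * MI n (tensor_kernel t C n) \<omega>) W"
  proof (rule complete_sum_L2)
    show "(\<lambda>\<omega>. l ^ n * MI n (tensor_kernel t C n) \<omega>) \<in> Lp M 2" for n
      by (intro Lp2_cmult multiple_ito_Lp2 h)
    show "b n > 0" for n unfolding b_def using A y by (intro mult_pos_pos add_nonneg_pos) auto
    show "summable b" unfolding b_def by (intro summable_mult summable_add summable_exp summable_geometric) simp
    show "expectation (\<lambda>\<omega>. (l ^ n * MI n (tensor_kernel t C n) \<omega>)\<^sup>2) \<le> (b n)\<^sup>2" for n
    proof -
      define v where "v = inverse (fact n) * (4 * y) ^ n"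
      define w :: real where "w = (1 / 4) ^ n"
      have vw: "v \<ge> 0" "w \<ge> 0" using y by (auto simp: v_def w_def)
      have "expectation (\<lambda>\<omega>. (l ^ n * MI n (tensor_kernel t C n) \<omega>)\<^sup>2) =
          l ^ (2 * n) * expectation (\<lambda>\<omega>. (MI n (tensor_kernel t C n) \<omega>)\<^sup>2)"
        by (simp add: power_mult_distrib power_mult mult.commute flip: power_mult)
      also have "\<dots> \<le> l ^ (2 * n) * (fact n * (\<integral>s. (tensor_kernel t C n s)\<^sup>2 \<partial>cube T n))"
        by (intro mult_left_mono has_multiple_ito_square_le multiple_ito_has h) (simp add: power_mult)
      also have "\<dots> \<le> A\<^sup>2 * (y ^ n / fact n)"
        using tensor_kernel_weight_le[OF T_pos t C R, of n l] by (simp add: y_def mult_ac)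
      also have "y ^ n / fact n = v * w"
        by (simp add: v_def w_def power_mult_distrib power_divide field_simps)
      also have "A\<^sup>2 * (v * w) \<le> A\<^sup>2 * (v + w)\<^sup>2"
      proof (rule mult_left_mono)
        have "0 \<le> v * w" using vw by simp
        moreover have "(v + w)\<^sup>2 = v\<^sup>2 + w\<^sup>2 + 2 * (v * w)" by (simp add: power2_sum)
        ultimately show "v * w \<le> (v + w)\<^sup>2" using zero_le_power2[of v] zero_le_power2[of w] by linarith
      qed simp
      also have "\<dots> = (b n)\<^sup>2" by (simp add: b_def v_def w_def power_mult_distrib)
      finally show ?thesis .
    qed
  qed
  have WL: "W \<in> Lp M 2" using W by (simp add: tendsto_Lp_def)
  have "AE \<omega> in M. W \<omega> = X \<omega>"
  proof (rule AE_eq_if_cos_integrals_eq)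
    show "integrable M W" "integrable M X" using Lp2_imp_Lp1[OF WL] Lp2_imp_Lp1[OF X] by (simp_all only: Lp1_iff)
    fix S \<theta> \<eta> assume S: "finite S" "S \<subseteq> {0..T}"
    obtain z where z: "(\<lambda>n. l ^ n * (C n * ip S \<theta> 0 t ^ n) * cos (\<eta> + real n * (pi / 2))) sums z"
      "expectation (\<lambda>\<omega>. X \<omega> * cos (lin S \<theta> \<omega> + \<eta>)) = z * exp (- cov S \<theta> / 2)"
      using cos[OF S] by blast
    have "(\<lambda>N. expectation (\<lambda>\<omega>. (\<Sum>n<N. l ^ n * MI n (tensor_kernel t C n) \<omega>) * cos (lin S \<theta> \<omega> + \<eta>)))
        \<longlonglongrightarrow> expectation (\<lambda>\<omega>. W \<omega> * cos (lin S \<theta> \<omega> + \<eta>))"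
      by (intro tendsto_Lp1_cos tendsto_Lp2_imp_Lp1 W S)
    moreover have "(\<lambda>N. expectation (\<lambda>\<omega>. (\<Sum>n<N. l ^ n * MI n (tensor_kernel t C n) \<omega>) * cos (lin S \<theta> \<omega> + \<eta>)))
        \<longlonglongrightarrow> z * exp (- cov S \<theta> / 2)"
      unfolding partial_sum_cos[OF h S] integral_tensor_kernel_step_fun[OF T_pos t S(2)] ip_def[symmetric]
      by (intro tendsto_mult tendsto_const) (use z(1) in \<open>simp only: sums_def\<close>)
    ultimately have "expectation (\<lambda>\<omega>. W \<omega> * cos (lin S \<theta> \<omega> + \<eta>)) = z * exp (- cov S \<theta> / 2)"
      by (rule LIMSEQ_unique)
    then show "expectation (\<lambda>\<omega>. W \<omega> * cos (lin S \<theta> \<omega> + \<eta>)) = expectation (\<lambda>\<omega>. X \<omega> * cos (lin S \<theta> \<omega> + \<eta>))"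
      unfolding z(2) .
  qed
  then show ?thesis
    by (rule tendsto_Lp_cong_AE[OF W AE_I2[OF refl]]) (use W X in \<open>auto simp: tendsto_Lp_def Lp2_iff\<close>)
qed

lemma has_chaos_tensor:
  assumes "t \<in> {0..T}" and "tendsto_Lp M 2 (\<lambda>N \<omega>. \<Sum>n<N. 1 ^ n * MI n (tensor_kernel t C n) \<omega>) X"
  shows "has_chaos M T B X (tensor_kernel t C)"
  using assms(2) tensor_kernel_symmetric[OF T_pos assms(1)] by (simp add: has_chaos_def)

lemma tensor_second_quant_dom:
  assumes t: "t \<in> {0..T}" and C: "\<And>n. \<bar>C n\<bar> \<le> A * R ^ n / fact n" and R: "R \<ge> 0"
    and X: "has_chaos M T B X (tensor_kernel t C)"
  shows "X \<in> second_quant_dom M T B l"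
proof -
  have "summable (\<lambda>n. fact n * l ^ (2 * n) * (\<integral>s. (tensor_kernel t C n s)\<^sup>2 \<partial>cube T n))"
  proof (rule summable_comparison_test')
    show "summable (\<lambda>n. A\<^sup>2 * (inverse (fact n) * (l\<^sup>2 * R\<^sup>2 * t) ^ n))" by (intro summable_mult summable_exp)
    have "0 \<le> fact n * l ^ (2 * n) * (\<integral>s. (tensor_kernel t C n s)\<^sup>2 \<partial>cube T n)" for n
      by (intro mult_nonneg_nonneg) (auto simp: power_mult)
    then show "norm (fact n * l ^ (2 * n) * (\<integral>s. (tensor_kernel t C n s)\<^sup>2 \<partial>cube T n)) \<le>
        A\<^sup>2 * (inverse (fact n) * (l\<^sup>2 * R\<^sup>2 * t) ^ n)" for n
      using tensor_kernel_weight_le[OF T_pos t C R, of n l] by (simp add: divide_inverse mult_ac)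
  qed
  then show ?thesis using X unfolding second_quant_dom_def by auto
qed

section \<open>Transforms of the Brownian value and of its cosines\<close>

lemma integral_B_cos:
  assumes t: "t \<in> {0..T}" and S: "finite S" "S \<subseteq> {0..T}"
  shows "expectation (\<lambda>\<omega>. B t \<omega> * cos (lin S \<theta> \<omega> + \<eta>)) = ip S \<theta> 0 t * cos (\<eta> + pi / 2) * exp (- cov S \<theta> / 2)"
proof -
  define S' where "S' = S \<union> {0, t}"
  have S': "finite S'" "S' \<subseteq> {0..T}" "S \<subseteq> S'" using S t T_pos by (auto simp: S'_def)
  define \<theta>' where "\<theta>' s = (if s \<in> S then \<theta> s else 0)" for s
  note ext = lin_extend[OF S'(1,3), of \<theta>, folded \<theta>'_def[abs_def]]
  have [measurable]: "lin S \<theta> \<in> borel_measurable M" "B t \<in> borel_measurable M" "B 0 \<in> borel_measurable M"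
    using t T_pos S by (auto intro!: lin_measurable B_measurable)
  have "expectation (\<lambda>\<omega>. B t \<omega> * cos (lin S \<theta> \<omega> + \<eta>)) = expectation (\<lambda>\<omega>. (B t \<omega> - B 0 \<omega>) * cos (lin S \<theta> \<omega> + \<eta>))"
    using B_zero by (intro integral_cong_AE) (auto elim: eventually_mono)
  \<comment> \<open>The product formula with a single increment, from 0 to \<open>t\<close>; the
    unit type supplies the index.\<close>
  also have "\<dots> = ip S \<theta> 0 t * cos (\<eta> + pi / 2) * exp (- cov S \<theta> / 2)"
    using integral_prod_increments_cos[OF S'(1,2), of "{()}" "\<lambda>_. 0" "\<lambda>_. t" \<theta>' \<eta>] t
    unfolding ext by (simp add: S'_def)
  finally show ?thesis .
qed

text \<open>Almost surely w B_t is \<open>w\<close> times the increment over ]0, t], so this is the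
  characteristic functional after a shift of coefficients.\<close>

lemma integral_cos_lin_plus:
  assumes t: "t \<in> {0..T}" and S: "finite S" "S \<subseteq> {0..T}"
  shows "expectation (\<lambda>\<omega>. cos (lin S \<theta> \<omega> + w * B t \<omega> + \<eta>)) =
    exp (- (cov S \<theta> + 2 * w * ip S \<theta> 0 t + w\<^sup>2 * t) / 2) * cos \<eta>"
proof -
  define S' where "S' = S \<union> {0, t}"
  have S': "finite S'" "S' \<subseteq> {0..T}" "S \<subseteq> S'" "0 \<in> S'" "t \<in> S'" using S t T_pos by (auto simp: S'_def)
  define \<theta>' where "\<theta>' s = (if s \<in> S then \<theta> s else 0)" for s
  note ext = lin_extend[OF S'(1,3), of \<theta>, folded \<theta>'_def[abs_def]]
  have [measurable]: "lin S \<theta> \<in> borel_measurable M" "B t \<in> borel_measurable M" "B 0 \<in> borel_measurable M"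
    using t T_pos S by (auto intro!: lin_measurable B_measurable)
  have "expectation (\<lambda>\<omega>. cos (lin S \<theta> \<omega> + w * B t \<omega> + \<eta>)) =
      expectation (\<lambda>\<omega>. cos (lin S \<theta> \<omega> + w * (B t \<omega> - B 0 \<omega>) + \<eta>))"
    using B_zero by (intro integral_cong_AE) (auto elim: eventually_mono)
  also have "\<dots> = expectation (\<lambda>\<omega>. cos (lin S' (\<lambda>s. \<theta>' s + w * (indicat_real {t} s - indicat_real {0} s)) \<omega> + \<eta>))"
    unfolding lin_shift[OF S'(1,4,5)] ext ..
  also have "\<dots> = exp (- cov S' (\<lambda>s. \<theta>' s + w * (indicat_real {t} s - indicat_real {0} s)) / 2) * cos \<eta>"
    by (rule integral_cos_lin[OF S'(1,2)])
  also have "cov S' (\<lambda>s. \<theta>' s + w * (indicat_real {t} s - indicat_real {0} s)) = cov S \<theta> + 2 * w * ip S \<theta> 0 t + w\<^sup>2 * t"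
    using t by (subst cov_shift[OF S'(1,4,5)]) (simp_all add: ext)
  finally show ?thesis .
qed

text \<open>\<open>B t\<close> is the first-order integral of the indicator of ]0, t]; its only
  nonzero coefficient is the one with n = 1, which \<Gamma>(l) multiplies by
  \<open>l\<close>.\<close>

lemma second_quant_B:
  assumes t: "t \<in> {0..T}"
  shows "is_second_quant l (B t) (\<lambda>\<omega>. l * B t \<omega>)" "B t \<in> second_quant_dom M T B l"
proof -
  define C where "C n = (if n = 1 then 1 else 0 :: real)" for n :: nat
  have C: "\<bar>C n\<bar> \<le> 1 * 1 ^ n / fact n" for n by (simp add: C_def)
  have BL: "B t \<in> Lp M 2" by (intro all_moments_Lp B_all_moments t)
  have lim: "tendsto_Lp M 2 (\<lambda>N \<omega>. \<Sum>n<N. m ^ n * MI n (tensor_kernel t C n) \<omega>) (\<lambda>\<omega>. m * B t \<omega>)" for m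
  proof (rule tendsto_chaos_sum[OF t C])
    fix S \<theta> \<eta> assume S: "finite S" "S \<subseteq> {0..T}"
    have "(\<lambda>n. m ^ n * (C n * ip S \<theta> 0 t ^ n) * cos (\<eta> + real n * (pi / 2))) sums
        (\<Sum>n\<in>{1}. m ^ n * (C n * ip S \<theta> 0 t ^ n) * cos (\<eta> + real n * (pi / 2)))"
      by (rule sums_finite) (auto simp: C_def)
    moreover have "expectation (\<lambda>\<omega>. m * B t \<omega> * cos (lin S \<theta> \<omega> + \<eta>)) =
        (\<Sum>n\<in>{1}. m ^ n * (C n * ip S \<theta> 0 t ^ n) * cos (\<eta> + real n * (pi / 2))) * exp (- cov S \<theta> / 2)"
      using integral_B_cos[OF t S, of \<theta> \<eta>] by (simp add: C_def mult.assoc)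
    ultimately show "\<exists>z. (\<lambda>n. m ^ n * (C n * ip S \<theta> 0 t ^ n) * cos (\<eta> + real n * (pi / 2))) sums z \<and>
        expectation (\<lambda>\<omega>. m * B t \<omega> * cos (lin S \<theta> \<omega> + \<eta>)) = z * exp (- cov S \<theta> / 2)" by blast
  qed (auto intro: Lp2_cmult BL)
  have "has_chaos M T B (B t) (tensor_kernel t C)" using has_chaos_tensor[OF t lim[of 1]] by simp
  then show "is_second_quant l (B t) (\<lambda>\<omega>. l * B t \<omega>)" "B t \<in> second_quant_dom M T B l"
    using lim[of l] tensor_second_quant_dom[OF t C] unfolding is_second_quant_def by auto
qed

text \<open>Coefficients of \<open>a cos(w B\<^sub>t + p)\<close>, from the expansion
  \<open>exp (i w B\<^sub>t) = exp (- w\<^sup>2 t / 2) \<Sum>\<^sub>n (i w)\<^sup>n / n! I\<^sub>n(1\<^bsub>]0,t]\<^esub>\<^sup>\<otimes>\<^sup>n)\<close>.\<close>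

definition trig_coeff :: "real \<Rightarrow> (real \<times> real \<times> real) list \<Rightarrow> nat \<Rightarrow> real" where
  "trig_coeff t L n = (\<Sum>(a, w, p)\<leftarrow>L. a * exp (- w\<^sup>2 * t / 2) * w ^ n * cos (p + real n * (pi / 2)) / fact n)"

text \<open>The transform of \<Gamma>(l) applied to \<open>trig_sum L (B t)\<close>, without its
  factor exp(- cov / 2).\<close>

definition trig_cos :: "real set \<Rightarrow> (real \<Rightarrow> real) \<Rightarrow> real \<Rightarrow> real \<Rightarrow> real \<Rightarrow> (real \<times> real \<times> real) list \<Rightarrow> real" where
  "trig_cos S \<theta> t \<eta> l L = (\<Sum>(a, w, p)\<leftarrow>L. a * exp (- w\<^sup>2 * t / 2) *
    (exp (l * w * ip S \<theta> 0 t) * cos (\<eta> - p) + exp (- (l * w * ip S \<theta> 0 t)) * cos (\<eta> + p)) / 2)"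

lemma trig_coeff_bound:
  assumes "t \<ge> 0"
  shows "\<exists>A>0. \<exists>R\<ge>0. \<forall>n. \<bar>trig_coeff t L n\<bar> \<le> A * R ^ n / fact n"
proof (induction L)
  case Nil
  show ?case by (intro exI[of _ 1] conjI exI[of _ 1]) (auto simp: trig_coeff_def)
next
  case (Cons q L)
  obtain a w p where q: "q = (a, w, p)" by (cases q)
  obtain A R where AR: "A > 0" "R \<ge> 0" "\<And>n. \<bar>trig_coeff t L n\<bar> \<le> A * R ^ n / fact n" using Cons by blast
  define R' where "R' = max R \<bar>w\<bar>"
  have "\<bar>trig_coeff t (q # L) n\<bar> \<le> (\<bar>a\<bar> + A) * R' ^ n / fact n" for n
  proof -
    have "\<bar>a * exp (- w\<^sup>2 * t / 2) * w ^ n * cos (p + real n * (pi / 2))\<bar> \<le> \<bar>a\<bar> * 1 * R' ^ n * 1"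
      unfolding abs_mult power_abs using assms by (intro mult_mono power_mono) (auto simp: R'_def)
    then have "\<bar>a * exp (- w\<^sup>2 * t / 2) * w ^ n * cos (p + real n * (pi / 2)) / fact n\<bar> \<le> \<bar>a\<bar> * R' ^ n / fact n"
      by (simp add: abs_divide divide_right_mono)
    moreover have "A * R ^ n / fact n \<le> A * R' ^ n / fact n"
      using AR by (intro divide_right_mono mult_left_mono power_mono) (auto simp: R'_def)
    moreover have "trig_coeff t (q # L) n = a * exp (- w\<^sup>2 * t / 2) * w ^ n * cos (p + real n * (pi / 2)) / fact n + trig_coeff t L n"
      by (simp add: trig_coeff_def q)
    moreover have "(\<bar>a\<bar> + A) * R' ^ n / fact n = \<bar>a\<bar> * R' ^ n / fact n + A * R' ^ n / fact n"
      by (simp add: distrib_right add_divide_distrib)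
    ultimately show ?thesis using AR(3)[of n] by linarith
  qed
  moreover have "\<bar>a\<bar> + A > 0" "R' \<ge> 0" using AR by (auto simp: R'_def)
  ultimately show ?case by blast
qed

text \<open>With x = n pi / 2 the product-to-sum formula turns cos(p + x) cos(\<eta> + x) into half
  of cos(\<eta> - p) + (-1)^n cos(\<eta> + p). The two parts sum to exponential series at
  \<open>y\<close> and \<open>- y\<close>.\<close>

lemma trig_coeff_sums:
  "(\<lambda>n. l ^ n * (trig_coeff t L n * ip S \<theta> 0 t ^ n) * cos (\<eta> + real n * (pi / 2))) sums trig_cos S \<theta> t \<eta> l L"
proof (induction L)
  case Nil
  show ?case by (simp add: trig_coeff_def trig_cos_def)
next
  case (Cons q L)
  obtain a w p where q: "q = (a, w, p)" by (cases q)
  define y where "y = l * w * ip S \<theta> 0 t"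
  define k where "k = a * exp (- w\<^sup>2 * t / 2)"
  have cc: "cos (p + real n * (pi / 2)) * cos (\<eta> + real n * (pi / 2)) = (cos (\<eta> - p) + (- 1) ^ n * cos (\<eta> + p)) / 2" for n
  proof -
    have "cos (\<eta> + real n * (pi / 2)) * cos (p + real n * (pi / 2)) =
        (cos (\<eta> - p) + cos ((\<eta> + p) + real n * pi)) / 2"
      by (subst cos_times_cos) (simp add: algebra_simps)
    also have "cos ((\<eta> + p) + real n * pi) = (- 1) ^ n * cos (\<eta> + p)" by (simp add: cos_add)
    finally show ?thesis by (simp add: mult.commute)
  qed
  have "(\<lambda>n. y ^ n /\<^sub>R fact n) sums exp y" "(\<lambda>n. (- y) ^ n /\<^sub>R fact n) sums exp (- y)"
    by (rule exp_converges)+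
  then have "(\<lambda>n. k * ((y ^ n /\<^sub>R fact n) * cos (\<eta> - p) + ((- y) ^ n /\<^sub>R fact n) * cos (\<eta> + p)) / 2) sums
      (k * (exp y * cos (\<eta> - p) + exp (- y) * cos (\<eta> + p)) / 2)"
    by (intro sums_divide sums_mult sums_add sums_mult2)
  from sums_add[OF this Cons]
  have "(\<lambda>n. k * ((y ^ n /\<^sub>R fact n) * cos (\<eta> - p) + ((- y) ^ n /\<^sub>R fact n) * cos (\<eta> + p)) / 2 +
      l ^ n * (trig_coeff t L n * ip S \<theta> 0 t ^ n) * cos (\<eta> + real n * (pi / 2))) sums trig_cos S \<theta> t \<eta> l (q # L)"
    by (simp add: trig_cos_def q k_def y_def)
  moreover have "k * ((y ^ n /\<^sub>R fact n) * cos (\<eta> - p) + ((- y) ^ n /\<^sub>R fact n) * cos (\<eta> + p)) / 2 +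
      l ^ n * (trig_coeff t L n * ip S \<theta> 0 t ^ n) * cos (\<eta> + real n * (pi / 2)) =
      l ^ n * (trig_coeff t (q # L) n * ip S \<theta> 0 t ^ n) * cos (\<eta> + real n * (pi / 2))" for n
  proof -
    have alg: "k * ((v /\<^sub>R u) * c + ((e * v) /\<^sub>R u) * d) / 2 = k * (v / u) * ((c + e * d) / 2)"
      for u v e c d :: real
    proof -
      have "k * ((i * v) * c + (i * (e * v)) * d) * h = k * (v * i) * ((c + e * d) * h)" for i h by algebra
      then show ?thesis unfolding divide_inverse real_scaleR_def .
    qed
    have neg: "(- y) ^ n = (- 1) ^ n * y ^ n" by (rule power_minus)
    have "k * ((y ^ n /\<^sub>R fact n) * cos (\<eta> - p) + ((- y) ^ n /\<^sub>R fact n) * cos (\<eta> + p)) / 2 =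
        k * (y ^ n / fact n) * ((cos (\<eta> - p) + (- 1) ^ n * cos (\<eta> + p)) / 2)"
      unfolding neg by (rule alg)
    also have "\<dots> = k * (y ^ n / fact n) * (cos (p + real n * (pi / 2)) * cos (\<eta> + real n * (pi / 2)))"
      unfolding cc ..
    also have "\<dots> = l ^ n * (k * w ^ n * cos (p + real n * (pi / 2)) / fact n * ip S \<theta> 0 t ^ n) * cos (\<eta> + real n * (pi / 2))"
      by (simp add: y_def power_mult_distrib)
    also have "\<dots> + l ^ n * (trig_coeff t L n * ip S \<theta> 0 t ^ n) * cos (\<eta> + real n * (pi / 2)) =
        l ^ n * (trig_coeff t (q # L) n * ip S \<theta> 0 t ^ n) * cos (\<eta> + real n * (pi / 2))"
      unfolding distrib_right[symmetric] distrib_left[symmetric] by (simp add: trig_coeff_def q k_def)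
    finally show ?thesis .
  qed
  ultimately show ?case by (simp only:)
qed

text \<open>For 0 <= l <= 1 this is Mehler's formula: averaging cos(w (l x + sqrt((1 - l^2) t) Z) +
  p) over a standard normal Z yields the damping factor and the frequency l w.\<close>

definition mehler :: "real \<Rightarrow> real \<Rightarrow> (real \<times> real \<times> real) list \<Rightarrow> (real \<times> real \<times> real) list" where
  "mehler l t L = map (\<lambda>(a, w, p). (a * exp (- (1 - l\<^sup>2) * w\<^sup>2 * t / 2), l * w, p)) L"

lemma trig_sum_B_Lp2: "t \<in> {0..T} \<Longrightarrow> (\<lambda>\<omega>. trig_sum L (B t \<omega>)) \<in> Lp M 2"
proof (induction L)
  case Nil
  then show ?case by (simp add: trig_sum_def Lp2_iff)
next
  case (Cons q L)
  obtain a w p where q: "q = (a, w, p)" by (cases q)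
  have [measurable]: "B t \<in> borel_measurable M" using Cons.prems by (rule B_measurable)
  have "(\<lambda>\<omega>. cos (w * B t \<omega> + p)) \<in> Lp M 2" by (rule Lp2_bounded[where C = 1]) auto
  from Lp2_add[OF Lp2_cmult[OF this, of a] Cons.IH[OF Cons.prems]] show ?case
    by (simp add: trig_sum_def q)
qed

lemma integral_mehler_cos:
  assumes t: "t \<in> {0..T}" and S: "finite S" "S \<subseteq> {0..T}"
  shows "expectation (\<lambda>\<omega>. trig_sum (mehler l t L) (B t \<omega>) * cos (lin S \<theta> \<omega> + \<eta>)) =
    trig_cos S \<theta> t \<eta> l L * exp (- cov S \<theta> / 2)"
proof (induction L)
  case Nil
  show ?case by (simp add: mehler_def trig_sum_def trig_cos_def)
next
  case (Cons q L)
  obtain a w p where q: "q = (a, w, p)" by (cases q)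
  define k where "k = a * exp (- (1 - l\<^sup>2) * w\<^sup>2 * t / 2)"
  have [measurable]: "lin S \<theta> \<in> borel_measurable M" "B t \<in> borel_measurable M"
    using t S by (auto intro!: lin_measurable B_measurable)
  have intc: "integrable M (\<lambda>\<omega>. cos (lin S \<theta> \<omega> + x * B t \<omega> + y))" for x y
    by (rule integrable_const_bound[where B = 1]) auto
  have split: "trig_sum (mehler l t (q # L)) (B t \<omega>) * cos (lin S \<theta> \<omega> + \<eta>) =
      k / 2 * (cos (lin S \<theta> \<omega> + (- (l * w)) * B t \<omega> + (\<eta> - p)) + cos (lin S \<theta> \<omega> + (l * w) * B t \<omega> + (\<eta> + p))) +
      trig_sum (mehler l t L) (B t \<omega>) * cos (lin S \<theta> \<omega> + \<eta>)" for \<omega>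
  proof -
    have "cos (lin S \<theta> \<omega> + \<eta>) * cos (l * w * B t \<omega> + p) =
        (cos (lin S \<theta> \<omega> + (- (l * w)) * B t \<omega> + (\<eta> - p)) + cos (lin S \<theta> \<omega> + (l * w) * B t \<omega> + (\<eta> + p))) / 2"
      by (subst cos_times_cos) (simp add: algebra_simps)
    then have 1: "k * (cos (lin S \<theta> \<omega> + \<eta>) * cos (l * w * B t \<omega> + p)) =
        k / 2 * (cos (lin S \<theta> \<omega> + (- (l * w)) * B t \<omega> + (\<eta> - p)) + cos (lin S \<theta> \<omega> + (l * w) * B t \<omega> + (\<eta> + p)))"
      by (simp only: times_divide_eq_right times_divide_eq_left)
    have 2: "trig_sum (mehler l t (q # L)) (B t \<omega>) = k * cos (l * w * B t \<omega> + p) + trig_sum (mehler l t L) (B t \<omega>)"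
      by (simp add: trig_sum_def mehler_def q k_def)
    have 3: "(k * x + y) * z = k * (z * x) + y * z" for x y z by algebra
    show ?thesis unfolding 2 3 1 ..
  qed
  have "expectation (\<lambda>\<omega>. trig_sum (mehler l t (q # L)) (B t \<omega>) * cos (lin S \<theta> \<omega> + \<eta>)) =
      k / 2 * (expectation (\<lambda>\<omega>. cos (lin S \<theta> \<omega> + (- (l * w)) * B t \<omega> + (\<eta> - p))) +
        expectation (\<lambda>\<omega>. cos (lin S \<theta> \<omega> + (l * w) * B t \<omega> + (\<eta> + p)))) +
      expectation (\<lambda>\<omega>. trig_sum (mehler l t L) (B t \<omega>) * cos (lin S \<theta> \<omega> + \<eta>))"
    unfolding split
    by (simp only: Bochner_Integration.integral_add integral_mult_right_zero intc
        Bochner_Integration.integrable_add integrable_mult_right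
        integrable_mult_Lp2[OF trig_sum_B_Lp2[OF t] cos_lin_Lp2[OF S(2)]])
  also have "\<dots> = k / 2 * (exp (- (cov S \<theta> + 2 * (- (l * w)) * ip S \<theta> 0 t + (- (l * w))\<^sup>2 * t) / 2) * cos (\<eta> - p) +
      exp (- (cov S \<theta> + 2 * (l * w) * ip S \<theta> 0 t + (l * w)\<^sup>2 * t) / 2) * cos (\<eta> + p)) +
      trig_cos S \<theta> t \<eta> l L * exp (- cov S \<theta> / 2)"
    unfolding integral_cos_lin_plus[OF t S] Cons.IH ..
  also have "\<dots> = trig_cos S \<theta> t \<eta> l (q # L) * exp (- cov S \<theta> / 2)"
  proof -
    define m where "m = l * w * ip S \<theta> 0 t"
    \<comment> \<open>The Mehler factor and the variance of l w B_t combine to the exponent -w^2 t /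
      2, whatever \<open>l\<close> is.\<close>
    have e1: "exp (- (1 - l\<^sup>2) * w\<^sup>2 * t / 2) * exp (- (cov S \<theta> + 2 * (- (l * w)) * ip S \<theta> 0 t + (- (l * w))\<^sup>2 * t) / 2) =
        exp (- w\<^sup>2 * t / 2) * exp m * exp (- cov S \<theta> / 2)"
      unfolding exp_add[symmetric] m_def by (rule arg_cong[where f = exp]) (simp add: field_simps power2_eq_square)
    have e2: "exp (- (1 - l\<^sup>2) * w\<^sup>2 * t / 2) * exp (- (cov S \<theta> + 2 * (l * w) * ip S \<theta> 0 t + (l * w)\<^sup>2 * t) / 2) =
        exp (- w\<^sup>2 * t / 2) * exp (- m) * exp (- cov S \<theta> / 2)"
      unfolding exp_add[symmetric] m_def by (rule arg_cong[where f = exp]) (simp add: field_simps power2_eq_square)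
    have alg1: "a * d / 2 * (u * x + v * y) = a / 2 * ((d * u) * x + (d * v) * y)" for d u v x y :: real
      by (simp add: field_simps)
    have alg2: "a / 2 * ((d * u * c) * x + (d * v * c) * y) = a * d * (u * x + v * y) / 2 * c" for d u v x y c :: real
      by (simp add: field_simps)
    have "k / 2 * (exp (- (cov S \<theta> + 2 * (- (l * w)) * ip S \<theta> 0 t + (- (l * w))\<^sup>2 * t) / 2) * cos (\<eta> - p) +
      exp (- (cov S \<theta> + 2 * (l * w) * ip S \<theta> 0 t + (l * w)\<^sup>2 * t) / 2) * cos (\<eta> + p)) =
      a / 2 * ((exp (- w\<^sup>2 * t / 2) * exp m * exp (- cov S \<theta> / 2)) * cos (\<eta> - p) +
        (exp (- w\<^sup>2 * t / 2) * exp (- m) * exp (- cov S \<theta> / 2)) * cos (\<eta> + p))"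
      unfolding k_def alg1 e1 e2 ..
    also have "\<dots> = a * exp (- w\<^sup>2 * t / 2) * (exp m * cos (\<eta> - p) + exp (- m) * cos (\<eta> + p)) / 2 * exp (- cov S \<theta> / 2)"
      by (rule alg2)
    finally have first: "k / 2 * (exp (- (cov S \<theta> + 2 * (- (l * w)) * ip S \<theta> 0 t + (- (l * w))\<^sup>2 * t) / 2) * cos (\<eta> - p) +
      exp (- (cov S \<theta> + 2 * (l * w) * ip S \<theta> 0 t + (l * w)\<^sup>2 * t) / 2) * cos (\<eta> + p)) =
      a * exp (- w\<^sup>2 * t / 2) * (exp m * cos (\<eta> - p) + exp (- m) * cos (\<eta> + p)) / 2 * exp (- cov S \<theta> / 2)" .
    have "trig_cos S \<theta> t \<eta> l (q # L) =
        a * exp (- w\<^sup>2 * t / 2) * (exp m * cos (\<eta> - p) + exp (- m) * cos (\<eta> + p)) / 2 + trig_cos S \<theta> t \<eta> l L"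
      by (simp add: trig_cos_def q m_def)
    then show ?thesis unfolding first by (simp only: distrib_right)
  qed
  finally show ?case .
qed

text \<open>One coefficient sequence serves all values of \<open>l\<close>: for l = 1 it gives the
  chaos expansion of the sum itself, for general \<open>l\<close> that of its image.\<close>

lemma second_quant_trig_sum:
  assumes t: "t \<in> {0..T}"
  shows "is_second_quant l (\<lambda>\<omega>. trig_sum L (B t \<omega>)) (\<lambda>\<omega>. trig_sum (mehler l t L) (B t \<omega>))"
    "(\<lambda>\<omega>. trig_sum L (B t \<omega>)) \<in> second_quant_dom M T B l"
proof -
  have "t \<ge> 0" using t by simp
  from trig_coeff_bound[OF this, of L] obtain A R
    where AR: "A > 0" "R \<ge> 0" "\<And>n. \<bar>trig_coeff t L n\<bar> \<le> A * R ^ n / fact n" by blast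
  have lim: "tendsto_Lp M 2 (\<lambda>N \<omega>. \<Sum>n<N. m ^ n * MI n (tensor_kernel t (trig_coeff t L) n) \<omega>)
      (\<lambda>\<omega>. trig_sum (mehler m t L) (B t \<omega>))" for m
    using trig_coeff_sums integral_mehler_cos[OF t]
    by (intro tendsto_chaos_sum[OF t AR(3,1,2) trig_sum_B_Lp2[OF t]]) blast
  have "mehler 1 t L = L" by (induction L) (auto simp: mehler_def)
  then have "has_chaos M T B (\<lambda>\<omega>. trig_sum L (B t \<omega>)) (tensor_kernel t (trig_coeff t L))"
    using has_chaos_tensor[OF t lim[of 1]] by simp
  then show "is_second_quant l (\<lambda>\<omega>. trig_sum L (B t \<omega>)) (\<lambda>\<omega>. trig_sum (mehler l t L) (B t \<omega>))"
    "(\<lambda>\<omega>. trig_sum L (B t \<omega>)) \<in> second_quant_dom M T B l"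
    using lim[of l] tensor_second_quant_dom[OF t AR(3,2)] unfolding is_second_quant_def by auto
qed

end

section \<open>Wick functions and the heat equation\<close>

context brownian_filtered begin

text \<open>Since E[B_t^2] = t, the L1 error is at most e_k + d_k t. Integrability of the limit
  comes out of the bound.\<close>

lemma tendsto_Lp1_quadratic_bound:
  assumes t: "t \<in> {0..T}" and Xs: "\<And>k. Xs k \<in> Lp M 1" and X: "X \<in> borel_measurable M"
    and bound: "\<And>k. AE \<omega> in M. \<bar>Xs k \<omega> - X \<omega>\<bar> \<le> e k + d k * (B t \<omega>)\<^sup>2"
    and lim: "e \<longlonglongrightarrow> 0" "d \<longlonglongrightarrow> 0"
  shows "tendsto_Lp M 1 Xs X"
proof -
  have B2: "integrable M (\<lambda>\<omega>. (B t \<omega>)\<^sup>2)"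
    using all_moments_Lp[OF B_all_moments[OF t], of 2] by (simp add: Lp2_iff)
  have int: "integrable M (\<lambda>\<omega>. e k + d k * (B t \<omega>)\<^sup>2)" for k using B2 by simp
  have Xs': "integrable M (Xs k)" for k using Xs[of k] unfolding Lp1_iff .
  have diff: "integrable M (\<lambda>\<omega>. Xs k \<omega> - X \<omega>)" for k
  proof (rule Bochner_Integration.integrable_bound[OF int[of k]])
    show "AE \<omega> in M. norm (Xs k \<omega> - X \<omega>) \<le> norm (e k + d k * (B t \<omega>)\<^sup>2)"
      using bound[of k] by eventually_elim (simp add: abs_le_iff)
  qed (use Xs'[of k] X in measurable)
  have "integrable M X" using Bochner_Integration.integrable_diff[OF Xs'[of 0] diff[of 0]] by simp
  moreover have "(\<lambda>k. \<integral>\<omega>. \<bar>Xs k \<omega> - X \<omega>\<bar> \<partial>M) \<longlonglongrightarrow> 0"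
  proof (rule tendsto_sandwich[OF _ _ tendsto_const])
    show "\<forall>\<^sub>F k in sequentially. (\<integral>\<omega>. \<bar>Xs k \<omega> - X \<omega>\<bar> \<partial>M) \<le> e k + d k * t"
    proof (intro always_eventually allI)
      fix k
      have "(\<integral>\<omega>. \<bar>Xs k \<omega> - X \<omega>\<bar> \<partial>M) \<le> (\<integral>\<omega>. e k + d k * (B t \<omega>)\<^sup>2 \<partial>M)"
        using diff by (intro integral_mono_AE int bound) simp
      also have "\<dots> = e k + d k * t" using B2 by (simp add: B_second_moment[OF t] prob_space)
      finally show "(\<integral>\<omega>. \<bar>Xs k \<omega> - X \<omega>\<bar> \<partial>M) \<le> e k + d k * t" .
    qed
    show "(\<lambda>k. e k + d k * t) \<longlonglongrightarrow> 0"
      using tendsto_add[OF lim(1) tendsto_mult[OF lim(2) tendsto_const[of t]]] by simp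
  qed simp
  ultimately show ?thesis using Xs unfolding tendsto_Lp_def Lp1_iff by simp
qed

text \<open>The first two conclusions certify that \<open>wick_fun\<close> is applied inside its
  domain, so that the third one speaks about the operator and not about an arbitrary choice.\<close>

theorem wick_fun_heat_solution:
  assumes f: "bounded (range f)" "continuous_on UNIV f"
    and u: "heat_solution T f u" "gaussian_growth T u" and t: "t \<in> {0..T}"
  shows "B t \<in> second_quant_dom M T B (sqrt 2)"
    and "(\<lambda>\<omega>. f (second_quant M T B (sqrt 2) (B t) \<omega>)) \<in> Lp M 1"
    and "AE \<omega> in M. u t (B t \<omega>) = wick_fun M T B f (B t) \<omega>"
proof -
  show "B t \<in> second_quant_dom M T B (sqrt 2)" by (rule second_quant_B(2)[OF t])
  define V where "V = second_quant M T B (sqrt 2) (B t)"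
  have "is_second_quant (sqrt 2) (B t) V"
    unfolding V_def by (rule second_quant_is[OF second_quant_B(1)[OF t]])
  \<comment> \<open>\<open>V\<close> is some version of sqrt 2 B_t, so the two are compared almost
    surely.\<close>
  from is_second_quant_unique[OF this second_quant_B(1)[OF t]] is_second_quant_Lp2[OF this]
  have V: "AE \<omega> in M. V \<omega> = sqrt 2 * B t \<omega>" and [measurable]: "V \<in> borel_measurable M"
    by (auto simp: Lp2_iff)
  have [measurable]: "f \<in> borel_measurable borel" using f(2) by (rule borel_measurable_continuous_onI)
  have [measurable]: "B t \<in> borel_measurable M" by (rule B_measurable[OF t])
  obtain C where C: "\<And>x. \<bar>f x\<bar> \<le> C" using f(1) by (auto simp: bounded_iff)
  have C0: "C \<ge> 0" using C[of 0] by linarith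
  have "integrable M (\<lambda>\<omega>. f (V \<omega>))" by (rule integrable_const_bound[where B = C]) (auto simp: C)
  then show "(\<lambda>\<omega>. f (second_quant M T B (sqrt 2) (B t) \<omega>)) \<in> Lp M 1" unfolding V_def Lp1_iff .
  \<comment> \<open>Radius k + 1 and uniform error 1 / (k + 1) will be used; the quadratic
    coefficient (2 C + 1) / (k + 1)^2 is weakened to (2 C + 1) / (k + 1), a multiple of
    \<open>e k\<close>.\<close>
  define e where "e k = 1 / real (Suc k)" for k
  define d where "d k = (2 * C + 1) * e k" for k
  have e: "e k > 0" "e k \<le> 1" "e \<longlonglongrightarrow> 0" for k
    unfolding e_def using LIMSEQ_Suc[OF lim_1_over_n] by auto
  have d: "d k \<ge> 0" "d \<longlonglongrightarrow> 0" for k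
    using C0 e(1)[of k] tendsto_mult[OF tendsto_const e(3), of "2 * C + 1"] by (auto simp: d_def[abs_def])
  have "\<forall>k. \<exists>L. \<forall>x. \<bar>f x - trig_sum L x\<bar> \<le> e k + d k * x\<^sup>2"
  proof
    fix k
    obtain L where L: "\<And>x. \<bar>f x - trig_sum L x\<bar> \<le> e k + (2 * C + 1) * x\<^sup>2 / (real (Suc k))\<^sup>2"
      using trig_sum_approximation[OF f(2) C, of "real (Suc k)" "e k"] e by auto
    have "\<bar>f x - trig_sum L x\<bar> \<le> e k + d k * x\<^sup>2" for x
    proof -
      have "(2 * C + 1) * x\<^sup>2 / (real (Suc k))\<^sup>2 \<le> (2 * C + 1) * x\<^sup>2 / real (Suc k)"
        using C0 by (intro divide_left_mono) (auto simp: power2_eq_square)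
      also have "\<dots> = d k * x\<^sup>2" by (simp add: d_def e_def)
      finally show ?thesis using L[of x] by linarith
    qed
    then show "\<exists>L. \<forall>x. \<bar>f x - trig_sum L x\<bar> \<le> e k + d k * x\<^sup>2" by (intro exI[of _ L] allI)
  qed
  from choice[OF this] obtain L where L: "\<And>k x. \<bar>f x - trig_sum (L k) x\<bar> \<le> e k + d k * x\<^sup>2" by blast
  \<comment> \<open>The approximations of \<open>f\<close> are evaluated at sqrt 2 B_t, the argument
    that \<Gamma>(sqrt 2) produces.\<close>
  define L' where "L' k = map (\<lambda>(a, w, p). (a, sqrt 2 * w, p)) (L k)" for k
  have L': "trig_sum (L' k) x = trig_sum (L k) (sqrt 2 * x)" for k x
    unfolding L'_def by (simp add: trig_sum_def comp_def case_prod_unfold mult_ac)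
  \<comment> \<open>The factors sqrt 2 and 1 / sqrt 2 cancel in the frequency, and (1 - 1/2) (sqrt 2
    w)^2 = w^2 in the exponent.\<close>
  have heat: "mehler (1 / sqrt 2) t (L' k) = map (\<lambda>(a, w, p). (a * exp (- w\<^sup>2 * t / 2), w, p)) (L k)" for k
    unfolding L'_def mehler_def by (simp add: power_mult_distrib power_divide case_prod_unfold comp_def)
  have near: "\<bar>u t x - heat_flow (L k) t x\<bar> \<le> e k + d k * (x\<^sup>2 + t)" for x k
    by (rule heat_solution_near_heat_flow[OF u L less_imp_le[OF e(1)] d(1) t])
  have l: "0 < 1 / sqrt 2" "1 / sqrt 2 < (1 :: real)" by auto
  show "AE \<omega> in M. u t (B t \<omega>) = wick_fun M T B f (B t) \<omega>"
    unfolding wick_fun_def V_def[symmetric]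
  proof (rule second_quant_L1_eq[OF _ l])
    show dom: "(\<lambda>\<omega>. trig_sum (L' k) (B t \<omega>)) \<in> second_quant_dom M T B (1 / sqrt 2)" for k
      by (rule second_quant_trig_sum(2)[OF t])
    show "tendsto_Lp M 1 (\<lambda>k \<omega>. trig_sum (L' k) (B t \<omega>)) (\<lambda>\<omega>. f (V \<omega>))"
    proof (rule tendsto_Lp1_quadratic_bound[OF t])
      show "(\<lambda>\<omega>. trig_sum (L' k) (B t \<omega>)) \<in> Lp M 1" for k by (intro Lp2_imp_Lp1 trig_sum_B_Lp2 t)
      \<comment> \<open>The factor 2 is the square of sqrt 2 in the argument.\<close>
      show "AE \<omega> in M. \<bar>trig_sum (L' k) (B t \<omega>) - f (V \<omega>)\<bar> \<le> e k + 2 * d k * (B t \<omega>)\<^sup>2" for k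
        using V
      proof eventually_elim
        case (elim \<omega>)
        show ?case using L[of "sqrt 2 * B t \<omega>" k] unfolding elim L' by (simp add: power_mult_distrib abs_minus_commute mult_ac)
      qed
      show "(\<lambda>k. 2 * d k) \<longlonglongrightarrow> 0" using tendsto_mult[OF tendsto_const d(2), of 2] by simp
    qed (use e in auto)
    show "tendsto_Lp M 1 (\<lambda>k. second_quant M T B (1 / sqrt 2) (\<lambda>\<omega>. trig_sum (L' k) (B t \<omega>))) (\<lambda>\<omega>. u t (B t \<omega>))"
    proof (rule tendsto_Lp1_quadratic_bound[OF t])
      fix k
      note sq = second_quant_is[OF second_quant_trig_sum(1)[OF t, of "1 / sqrt 2" "L' k"]]
      show "second_quant M T B (1 / sqrt 2) (\<lambda>\<omega>. trig_sum (L' k) (B t \<omega>)) \<in> Lp M 1"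
        by (rule Lp2_imp_Lp1[OF is_second_quant_Lp2[OF sq]])
      show "AE \<omega> in M. \<bar>second_quant M T B (1 / sqrt 2) (\<lambda>\<omega>. trig_sum (L' k) (B t \<omega>)) \<omega> - u t (B t \<omega>)\<bar> \<le>
          (e k + d k * t) + d k * (B t \<omega>)\<^sup>2"
        using is_second_quant_unique[OF sq second_quant_trig_sum(1)[OF t]]
      proof eventually_elim
        case (elim \<omega>)
        have "trig_sum (mehler (1 / sqrt 2) t (L' k)) (B t \<omega>) = heat_flow (L k) t (B t \<omega>)"
          unfolding heat heat_flow_def ..
        then show ?case
          using near[of "B t \<omega>" k]
          unfolding elim by (simp add: abs_minus_commute distrib_left add_ac)
      qed
    next
      show "(\<lambda>k. e k + d k * t) \<longlonglongrightarrow> 0"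
        using tendsto_add[OF e(3) tendsto_mult[OF d(2) tendsto_const[of t]]] by simp
      \<comment> \<open>Continuity up to the initial time makes u(t, .) measurable for t = 0 as
        well.\<close>
      have "continuous_on ({0..T} \<times> UNIV) (\<lambda>(t, x). u t x)" using u(1) by (simp add: heat_solution_def)
      then have "continuous_on UNIV (\<lambda>x. (\<lambda>(t, x). u t x) (t, x))"
        by (rule continuous_on_compose2) (use t in \<open>auto intro!: continuous_intros\<close>)
      then have "u t \<in> borel_measurable borel" by (intro borel_measurable_continuous_onI) simp
      then show "(\<lambda>\<omega>. u t (B t \<omega>)) \<in> borel_measurable M" by measurable
    qed (rule d(2))
  qed
qed

end

theorem theorem4p2:
  fixes M :: "'a measure" and B :: "real \<Rightarrow> 'a \<Rightarrow> real" and T :: real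
    and f :: "real \<Rightarrow> real" and u :: "real \<Rightarrow> real \<Rightarrow> real"
  assumes "T > 0"
    and "prob_space M" and "complete_measure M"
    and "brownian_motion M T B"
    and "sets M = sets (augmented_filtration M B T)"
    and "bounded (range f)" and "continuous_on UNIV f"
    and "heat_solution T f u" and "gaussian_growth T u"
  shows "\<forall>t\<in>{0..T}.
    B t \<in> second_quant_dom M T B (sqrt 2) \<and>
    (\<lambda>\<omega>. f (second_quant M T B (sqrt 2) (B t) \<omega>)) \<in> Lp M 1 \<and>
    (AE \<omega> in M. u t (B t \<omega>) = wick_fun M T B f (B t) \<omega>)"
proof -
  interpret prob_space M by fact
  interpret brownian_filtered M B T
    by unfold_locales (use assms(1,4,5) in auto)
  show ?thesis using wick_fun_heat_solution[OF assms(6-9)] by blast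
qed

end
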